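(* Let $\Gamma$ be a free group of finite rank $n$. For every free generating set $\gamma=\{\gamma_1,\dots,\gamma_n\}$ of $\Gamma$ there is a unique additive group 1-cocycle $\mathfrak{s}_\gamma\colon \mathrm{Aut}(\Gamma)\to H_1(\Gamma,\mathbb{Z})$ such that for all $F\in\mathrm{Aut}(\Gamma)$ and all $u\in\mathrm{Der}(\widehat{\mathbb{K}\Gamma})$, $$\mathsf{Div}_{F(\gamma)}(u)-\mathsf{Div}_\gamma(u)=u\big(\tilde\Delta(\mathfrak{s}_\gamma(F))\big).$$ Furthermore, for $G\in\mathrm{Aut}(\Gamma)$ one has $$\mathfrak{s}_{G(\gamma)}(F)=\mathfrak{s}_\gamma(F)+F(\mathfrak{s}_\gamma(G))-\mathfrak{s}_\gamma(G).$$
   Context: $\mathbb{K}$ is a field of characteristic zero. $\widehat{\mathbb{K}\Gamma}$ is the completion of the group algebra $\mathbb{K}\Gamma$ with respect to powers of the augmentation ideal, and $\mathrm{Der}(\widehat{\mathbb{K}\Gamma})$ is the Lie algebra of its continuous derivations. For a topological associative algebra $B$, $|B|=B/[B,B]$, where $[B,B]$ is the closed span of commutators; $|b|$ is the class of $b$ and $\mathbf{1}=|1|$. Tensor products are completed. Derivations of $\widehat{\mathbb{K}\Gamma}$ act on $|\widehat{\mathbb{K}\Gamma}|$ and, by the Leibniz rule, on $|\widehat{\mathbb{K}\Gamma}|\otimes|\widehat{\mathbb{K}\Gamma}|$. For a free generating set $\gamma=\{\gamma_1,\dots,\gamma_n\}$ put $Z_j=\gamma_j-1$; then $\widehat{\mathbb{K}\Gamma}=\mathbb{K}\langle\langle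 Z_1,\dots,Z_n\rangle\rangle$. Let $\partial_{Z_j}\colon\widehat{\mathbb{K}\Gamma}\to\widehat{\mathbb{K}\Gamma}\otimes\widehat{\mathbb{K}\Gamma}$ be the continuous linear map with $\partial_{Z_j}(Z_k)=\delta_{jk}\,1\otimes 1$ and $\partial_{Z_j}(ab)=(a\otimes 1)\,\partial_{Z_j}(b)+\partial_{Z_j}(a)\,(1\otimes b)$ (ordinary factorwise products). Writing $|a\otimes b|=|a|\otimes|b|$, define $$\mathsf{Div}_\gamma\colon\mathrm{Der}(\widehat{\mathbb{K}\Gamma})\to|\widehat{\mathbb{K}\Gamma}|\otimes|\widehat{\mathbb{K}\Gamma}|,\qquad \mathsf{Div}_\gamma(u)=\sum_{j=1}^n|\partial_{Z_j}u(Z_j)|-\mathbf{1}\otimes\sum_{j=1}^n|u(\gamma_j)\gamma_j^{-1}|.$$ For $F\in\mathrm{Aut}(\Gamma)$, $F(\gamma)=\{F(\gamma_1),\dots,F(\gamma_n)\}$. The map $\Gamma\to|\widehat{\mathbb{K}\Gamma}|$, $g\mapsto|\log g|$, is a group homomorphism inducing an $\mathrm{Aut}(\Gamma)$-equivariant isomorphism of $H_1(\Gamma,\mathbb{Z})$ onto the lattice $\Lambda=\{|\log g|: g\in\Gamma\}$; $H_1(\Gamma,\mathbb{Z})$ is identified with $\Lambda$ in this way. On $\Lambda$, $\tilde\Delta(\lambda)=\lambda\otimes\mathbf{1}-\mathbf{1}\otimes\lambda$ (this is the restriction of the map induced by the twisted coproduct $(\mathrm{id}\otimes\iota)\circ\Delta$,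 where $\Delta(g)=g\otimes g$, $\iota(g)=g^{-1}$). An additive group 1-cocycle $\mathsf{c}$ of a group $\mathcal{G}$ with values in a $\mathcal{G}$-module satisfies $\mathsf{c}(FG)=\mathsf{c}(F)+F(\mathsf{c}(G))$. *)

theory Defs
  imports "HOL-Analysis.Analysis" "HOL-Library.Poly_Mapping"
begin

text \<open>
  The group \<open>\<Gamma>\<close> is a type of class \<^class>\<open>group_add\<close>, i.e. a not necessarily commutative group
  written additively. With this convention the convolution ring \<^typ>\<open>'g \<Rightarrow>\<^sub>0 'k\<close> of
  \<^theory>\<open>HOL-Library.Poly_Mapping\<close> is the group algebra \<open>\<bbbK>\<Gamma>\<close>; the group element \<open>g\<close> is
  \<^term>\<open>Poly_Mapping.single g 1\<close>, and the inverse of \<open>g\<close> is \<^term>\<open>- g\<close>.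
\<close>


section \<open>Free generating sets, automorphisms, first homology\<close>

text \<open>
  The letter \<^term>\<open>(g, True)\<close> stands for \<open>g\<close>, the letter \<^term>\<open>(g, False)\<close> for the inverse of \<open>g\<close>.
\<close>

definition word_value :: "('g::group_add \<times> bool) list \<Rightarrow> 'g" where
  "word_value w = sum_list (map (\<lambda>(g, b). if b then g else - g) w)"

definition reduced_words :: "'g set \<Rightarrow> ('g \<times> bool) list set" where
  "reduced_words S = {w. set w \<subseteq> S \<times> UNIV \<and> successively (\<lambda>(g, b) (h, c). g = h \<longrightarrow> b = c) w}"

definition free_generating_set :: "'g::group_add set \<Rightarrow> bool" where
  "free_generating_set S \<longleftrightarrow> bij_betw word_value (reduced_words S) UNIV"

definition group_aut :: "('g::group_add \<Rightarrow> 'g) set" where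
  "group_aut = {F. bij F \<and> (\<forall>x y. F (x + y) = F x + F y)}"

inductive_set commutator_subgroup :: "'g::group_add set" where
  zero: "0 \<in> commutator_subgroup"
| commutator: "x + y - x - y \<in> commutator_subgroup"
| add: "x \<in> commutator_subgroup \<Longrightarrow> y \<in> commutator_subgroup \<Longrightarrow> x + y \<in> commutator_subgroup"
| uminus: "x \<in> commutator_subgroup \<Longrightarrow> - x \<in> commutator_subgroup"

lemma commutator_subgroup_conj:
  assumes "x \<in> commutator_subgroup"
  shows "g + x - g \<in> commutator_subgroup"
proof -
  have "(g + x - g - x) + x \<in> commutator_subgroup"
    by (intro commutator_subgroup.add commutator_subgroup.commutator assms)
  then show ?thesis by simp
qed

lemma commutator_subgroup_minus_trans:
  assumes "x - y \<in> commutator_subgroup" "y - z \<in> commutator_subgroup"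
  shows "x - z \<in> commutator_subgroup"
proof -
  have "(x - y) + (y - z) \<in> commutator_subgroup"
    by (intro commutator_subgroup.add assms)
  then show ?thesis by (simp add: add_diff_eq)
qed

lemma commutator_subgroup_minus_sym:
  assumes "x - y \<in> commutator_subgroup"
  shows "y - x \<in> commutator_subgroup"
  using commutator_subgroup.uminus[OF assms] by simp

text \<open>\<open>H\<^sub>1(\<Gamma>, \<int>)\<close> is the abelianization of \<open>\<Gamma>\<close>.\<close>

quotient_type (overloaded) 'g H1 = "'g::group_add" / "\<lambda>x y. x - y \<in> commutator_subgroup"
  morphisms rep_H1 H1_class
proof (rule equivpI)
  show "reflp (\<lambda>x y::'g. x - y \<in> commutator_subgroup)"
    by (rule reflpI) (simp add: commutator_subgroup.zero)
  show "symp (\<lambda>x y::'g. x - y \<in> commutator_subgroup)"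
    by (rule sympI) (rule commutator_subgroup_minus_sym)
  show "transp (\<lambda>x y::'g. x - y \<in> commutator_subgroup)"
    by (rule transpI) (rule commutator_subgroup_minus_trans)
qed

instantiation H1 :: (group_add) ab_group_add
begin

lift_definition zero_H1 :: "'a H1" is "0" .

lift_definition plus_H1 :: "'a H1 \<Rightarrow> 'a H1 \<Rightarrow> 'a H1" is "(+)"
proof -
  fix x x' y y' :: 'a
  assume *: "x - x' \<in> commutator_subgroup" "y - y' \<in> commutator_subgroup"
  have "(x + (y - y') - x) + (x - x') \<in> commutator_subgroup"
    by (intro commutator_subgroup.add commutator_subgroup_conj *)
  then show "x + y - (x' + y') \<in> commutator_subgroup"
    by (simp add: add_diff_eq diff_add_eq_diff_diff_swap)
qed

lift_definition uminus_H1 :: "'a H1 \<Rightarrow> 'a H1" is "uminus"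
proof -
  fix x x' :: 'a
  assume "x - x' \<in> commutator_subgroup"
  from commutator_subgroup.uminus[OF commutator_subgroup_conj[OF this, of "- x"]]
  show "- x - - x' \<in> commutator_subgroup"
    by (simp add: minus_add add.assoc add_diff_eq)
qed

definition minus_H1 :: "'a H1 \<Rightarrow> 'a H1 \<Rightarrow> 'a H1" where
  "minus_H1 x y = x + - y"

instance
proof
  fix a b c :: "'a H1"
  show "a + b + c = a + (b + c)"
    by transfer (simp add: add.assoc commutator_subgroup.zero)
  show "a + b = b + a"
    by transfer (metis commutator_subgroup.commutator diff_add_eq_diff_diff_swap)
  show "0 + a = a"
    by transfer (simp add: commutator_subgroup.zero)
  show "- a + a = 0"
    by transfer (simp add: commutator_subgroup.zero)
  show "a - b = a + - b"
    by (simp add: minus_H1_def)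
qed

end

text \<open>
  The functorial action of automorphisms; here and below, maps induced on quotients and completions
  are evaluated on chosen representatives, on which the result does not depend.
\<close>

definition H1_map :: "('g::group_add \<Rightarrow> 'g) \<Rightarrow> 'g H1 \<Rightarrow> 'g H1" where
  "H1_map F h = H1_class (F (rep_H1 h))"

text \<open>Extensionality makes \<open>\<s>\<close> a function on \<^const>\<open>group_aut\<close> rather than on all self-maps.\<close>

definition additive_cocycle :: "(('g::group_add \<Rightarrow> 'g) \<Rightarrow> 'g H1) \<Rightarrow> bool" where
  "additive_cocycle \<s> \<longleftrightarrow> \<s> \<in> extensional group_aut \<and>
     (\<forall>F\<in>group_aut. \<forall>G\<in>group_aut. \<s> (F \<circ> G) = \<s> F + H1_map F (\<s> G))"


section \<open>Completion with respect to a filtration\<close>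

locale filtration =
  fixes N :: "nat \<Rightarrow> 'a::ab_group_add set"
  assumes zero_mem: "0 \<in> N m"
    and diff_mem: "x \<in> N m \<Longrightarrow> y \<in> N m \<Longrightarrow> x - y \<in> N m"
    and Suc_subset: "N (Suc m) \<subseteq> N m"
begin

lemma uminus_mem: "x \<in> N m \<Longrightarrow> - x \<in> N m"
  using diff_mem[OF zero_mem] by fastforce

lemma add_mem: "x \<in> N m \<Longrightarrow> y \<in> N m \<Longrightarrow> x + y \<in> N m"
  using diff_mem[OF _ uminus_mem] by fastforce

lemma antimono: "m \<le> n \<Longrightarrow> N n \<subseteq> N m"
  using lift_Suc_antimono_le[of N] Suc_subset by blast

end

definition filt_cauchy :: "(nat \<Rightarrow> 'a::ab_group_add set) \<Rightarrow> (nat \<Rightarrow> 'a) \<Rightarrow> bool" where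
  "filt_cauchy N X \<longleftrightarrow> (\<forall>m. \<exists>M. \<forall>i\<ge>M. \<forall>j\<ge>M. X i - X j \<in> N m)"

definition filt_null :: "(nat \<Rightarrow> 'a::ab_group_add set) \<Rightarrow> (nat \<Rightarrow> 'a) \<Rightarrow> bool" where
  "filt_null N X \<longleftrightarrow> (\<forall>m. \<exists>M. \<forall>i\<ge>M. X i \<in> N m)"

definition filt_rel :: "(nat \<Rightarrow> 'a::ab_group_add set) \<Rightarrow> (nat \<Rightarrow> 'a) \<Rightarrow> (nat \<Rightarrow> 'a) \<Rightarrow> bool" where
  "filt_rel N X Y \<longleftrightarrow> filt_cauchy N X \<and> filt_cauchy N Y \<and> filt_null N (\<lambda>i. X i - Y i)"

definition filt_open :: "(nat \<Rightarrow> 'a::ab_group_add set) \<Rightarrow> 'a set \<Rightarrow> bool" where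
  "filt_open N U \<longleftrightarrow> (\<forall>x\<in>U. \<exists>m. \<forall>y. y - x \<in> N m \<longrightarrow> y \<in> U)"

context filtration
begin

lemma filt_cauchy_const: "filt_cauchy N (\<lambda>_. c)"
  by (simp add: filt_cauchy_def zero_mem)

lemma filt_null_add:
  assumes "filt_null N X" "filt_null N Y"
  shows "filt_null N (\<lambda>i. X i + Y i)"
  unfolding filt_null_def
proof
  fix m
  from assms obtain A B where "\<forall>i\<ge>A. X i \<in> N m" "\<forall>i\<ge>B. Y i \<in> N m"
    unfolding filt_null_def by meson
  then show "\<exists>M. \<forall>i\<ge>M. X i + Y i \<in> N m"
    by (intro exI[of _ "max A B"]) (simp add: add_mem)
qed

lemma filt_null_uminus: "filt_null N X \<Longrightarrow> filt_null N (\<lambda>i. - X i)"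
  unfolding filt_null_def by (meson uminus_mem)

lemma filt_cauchy_add:
  assumes "filt_cauchy N X" "filt_cauchy N Y"
  shows "filt_cauchy N (\<lambda>i. X i + Y i)"
  unfolding filt_cauchy_def
proof
  fix m
  from assms obtain A B where
    "\<forall>i\<ge>A. \<forall>j\<ge>A. X i - X j \<in> N m" "\<forall>i\<ge>B. \<forall>j\<ge>B. Y i - Y j \<in> N m"
    unfolding filt_cauchy_def by meson
  then show "\<exists>M. \<forall>i\<ge>M. \<forall>j\<ge>M. X i + Y i - (X j + Y j) \<in> N m"
    by (intro exI[of _ "max A B"]) (simp add: add_mem add_diff_add)
qed

lemma filt_cauchy_uminus: "filt_cauchy N X \<Longrightarrow> filt_cauchy N (\<lambda>i. - X i)"
  unfolding filt_cauchy_def by (metis minus_diff_minus uminus_mem)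

lemma part_equivp_filt_rel: "part_equivp (filt_rel N)"
proof (rule part_equivpI)
  show "\<exists>X. filt_rel N X X"
    using filt_cauchy_const[of 0] by (auto simp: filt_rel_def filt_null_def zero_mem)
  show "symp (filt_rel N)"
    using filt_null_uminus by (force simp: filt_rel_def symp_def)
  show "transp (filt_rel N)"
    using filt_null_add by (force simp: filt_rel_def transp_def)
qed

lemma filt_rel_refl: "filt_rel N X X \<longleftrightarrow> filt_cauchy N X"
  by (auto simp: filt_rel_def filt_null_def zero_mem)

lemma filt_rel_add:
  assumes "filt_rel N X X'" "filt_rel N Y Y'"
  shows "filt_rel N (\<lambda>i. X i + Y i) (\<lambda>i. X' i + Y' i)"
  using assms filt_null_add[of "\<lambda>i. X i - X' i" "\<lambda>i. Y i - Y' i"]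
  by (simp add: filt_rel_def filt_cauchy_add add_diff_add)

lemma filt_rel_uminus:
  assumes "filt_rel N X X'"
  shows "filt_rel N (\<lambda>i. - X i) (\<lambda>i. - X' i)"
  using assms filt_null_uminus[of "\<lambda>i. X i - X' i"]
  by (simp add: filt_rel_def filt_cauchy_uminus)

lemma filt_open_Int:
  assumes "filt_open N U" "filt_open N V"
  shows "filt_open N (U \<inter> V)"
  unfolding filt_open_def
proof
  fix x assume "x \<in> U \<inter> V"
  then obtain k l where kl: "\<forall>y. y - x \<in> N k \<longrightarrow> y \<in> U" "\<forall>y. y - x \<in> N l \<longrightarrow> y \<in> V"
    using assms unfolding filt_open_def by blast
  have "N (max k l) \<subseteq> N k" "N (max k l) \<subseteq> N l" by (simp_all add: antimono)
  with kl show "\<exists>m. \<forall>y. y - x \<in> N m \<longrightarrow> y \<in> U \<inter> V"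
    by (intro exI[of _ "max k l"]) blast
qed

lemma filt_open_coset: "filt_open N {y. y - x \<in> N m}"
  unfolding filt_open_def
proof (intro ballI exI[of _ m] allI impI)
  fix y z assume "y \<in> {y. y - x \<in> N m}" "z - y \<in> N m"
  then show "z \<in> {y. y - x \<in> N m}" using add_mem[of "z - y" m "y - x"] by simp
qed

end

lemma filt_open_UNIV: "filt_open N UNIV"
  by (simp add: filt_open_def)

lemma filt_open_Union: "\<forall>U\<in>K. filt_open N U \<Longrightarrow> filt_open N (\<Union>K)"
  unfolding filt_open_def by (meson UnionE UnionI)


section \<open>The completed group algebra\<close>

definition pm_scale :: "'k::field \<Rightarrow> ('a \<Rightarrow>\<^sub>0 'k) \<Rightarrow> ('a \<Rightarrow>\<^sub>0 'k)" where
  "pm_scale c x = Poly_Mapping.map ((*) c) x"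

lemma lookup_pm_scale: "Poly_Mapping.lookup (pm_scale c x) a = c * Poly_Mapping.lookup x a"
  by (simp add: pm_scale_def Poly_Mapping.map.rep_eq when_def)

interpretation pm: vector_space "pm_scale :: 'k::field \<Rightarrow> ('a \<Rightarrow>\<^sub>0 'k) \<Rightarrow> _"
  by unfold_locales
    (auto intro!: poly_mapping_eqI simp: lookup_pm_scale lookup_add algebra_simps)

lemma pm_sum_single: "(\<Sum>a\<in>Poly_Mapping.keys x. Poly_Mapping.single a (Poly_Mapping.lookup x a)) = x"
  by (rule poly_mapping_eqI)
    (simp add: lookup_sum lookup_single when_def in_keys_iff)

lemma pm_scale_mult_left:
  fixes x y :: "'g::group_add \<Rightarrow>\<^sub>0 'k::field"
  shows "pm_scale c x * y = pm_scale c (x * y)"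
  by (simp add: pm_scale_def mult_map_scale_conv_mult mult.assoc)

lemma pm_scale_mult_right:
  fixes x y :: "'g::group_add \<Rightarrow>\<^sub>0 'k::field"
  shows "x * pm_scale c y = pm_scale c (x * y)"
proof -
  have "(\<Sum>a\<in>Poly_Mapping.keys x. Poly_Mapping.single a (Poly_Mapping.lookup x a)) *
      Poly_Mapping.single 0 c = Poly_Mapping.single 0 c *
      (\<Sum>a\<in>Poly_Mapping.keys x. Poly_Mapping.single a (Poly_Mapping.lookup x a))"
    unfolding sum_distrib_left sum_distrib_right by (simp add: mult_single mult.commute)
  then have "x * Poly_Mapping.single 0 c = Poly_Mapping.single 0 c * x"
    unfolding pm_sum_single .
  then show ?thesis
    by (simp add: pm_scale_def mult_map_scale_conv_mult flip: mult.assoc)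
qed

definition augmentation :: "('g::group_add \<Rightarrow>\<^sub>0 'k::field) \<Rightarrow> 'k" where
  "augmentation x = (\<Sum>g\<in>Poly_Mapping.keys x. Poly_Mapping.lookup x g)"

definition augmentation_ideal :: "('g::group_add \<Rightarrow>\<^sub>0 'k::field) set" where
  "augmentation_ideal = {x. augmentation x = 0}"

primrec aug_pow :: "nat \<Rightarrow> ('g::group_add \<Rightarrow>\<^sub>0 'k::field) set" where
  "aug_pow 0 = UNIV"
| "aug_pow (Suc m) = module.span pm_scale {x * y | x y. x \<in> augmentation_ideal \<and> y \<in> aug_pow m}"


lemma augmentation_superset:
  assumes "finite A" "Poly_Mapping.keys x \<subseteq> A"
  shows "augmentation x = (\<Sum>g\<in>A. Poly_Mapping.lookup x g)"
  unfolding augmentation_def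
  by (rule sum.mono_neutral_left) (use assms in \<open>auto simp: in_keys_iff\<close>)

lemma augmentation_add: "augmentation (x + y) = augmentation x + augmentation y"
  using keys_add[of x y]
  by (simp add: augmentation_superset[of "Poly_Mapping.keys x \<union> Poly_Mapping.keys y"]
      lookup_add sum.distrib)

lemma augmentation_0: "augmentation 0 = 0"
  by (simp add: augmentation_def)

lemma augmentation_sum: "augmentation (\<Sum>i\<in>A. f i) = (\<Sum>i\<in>A. augmentation (f i))"
  by (induction A rule: infinite_finite_induct) (simp_all add: augmentation_add augmentation_0)

lemma augmentation_scale: "augmentation (pm_scale c x) = c * augmentation x"
  by (subst augmentation_superset[of "Poly_Mapping.keys x"])
    (auto simp: in_keys_iff lookup_pm_scale augmentation_def sum_distrib_left)

lemma augmentation_single: "augmentation (Poly_Mapping.single g c) = c"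
  by (simp add: augmentation_def)

lemma augmentation_mult: "augmentation (x * y) = augmentation x * augmentation y"
proof -
  have "x * y = (\<Sum>a\<in>Poly_Mapping.keys x. Poly_Mapping.single a (Poly_Mapping.lookup x a)) *
      (\<Sum>b\<in>Poly_Mapping.keys y. Poly_Mapping.single b (Poly_Mapping.lookup y b))"
    by (simp add: pm_sum_single)
  then have "x * y = (\<Sum>a\<in>Poly_Mapping.keys x. \<Sum>b\<in>Poly_Mapping.keys y.
      Poly_Mapping.single (a + b) (Poly_Mapping.lookup x a * Poly_Mapping.lookup y b))"
    by (simp add: sum_product mult_single)
  then show ?thesis
    by (simp add: augmentation_sum augmentation_single) (simp add: augmentation_def sum_product)
qed

lemma subspace_augmentation_ideal: "pm.subspace augmentation_ideal"
  by (auto simp: pm.subspace_def augmentation_ideal_def augmentation_add augmentation_scale)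
    (simp add: augmentation_def)

lemma subspace_aug_pow: "pm.subspace (aug_pow m)"
  by (cases m) (simp_all add: pm.subspace_def pm.span_zero pm.span_add pm.span_scale)

lemma aug_pow_mult_left: "y \<in> aug_pow m \<Longrightarrow> z * y \<in> aug_pow m"
proof (cases m)
  case (Suc k)
  assume "y \<in> aug_pow m"
  then have "y \<in> pm.span {x * y | x y. x \<in> augmentation_ideal \<and> y \<in> aug_pow k}"
    by (simp add: Suc)
  then have "z * y \<in> pm.span {x * y | x y. x \<in> augmentation_ideal \<and> y \<in> aug_pow k}"
  proof (induction rule: pm.span_induct_alt)
    case base
    then show ?case by (simp add: pm.span_zero)
  next
    case (step c u v)
    then obtain x y where "u = x * y" "x \<in> augmentation_ideal" "y \<in> aug_pow k" by blast
    then have "z * u = (z * x) * y" "z * x \<in> augmentation_ideal"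
      by (simp_all add: mult.assoc augmentation_ideal_def augmentation_mult)
    with \<open>y \<in> aug_pow k\<close>
    have "z * u \<in> pm.span {x * y | x y. x \<in> augmentation_ideal \<and> y \<in> aug_pow k}"
      by (blast intro: pm.span_base)
    with step show ?case
      unfolding distrib_left pm_scale_mult_right by (intro pm.span_add pm.span_scale)
  qed
  then show ?thesis by (simp add: Suc)
qed simp

lemma aug_pow_mult_right: "y \<in> aug_pow m \<Longrightarrow> y * z \<in> aug_pow m"
proof (induction m arbitrary: y)
  case (Suc k)
  then have "y \<in> pm.span {x * y | x y. x \<in> augmentation_ideal \<and> y \<in> aug_pow k}"
    by simp
  then have "y * z \<in> pm.span {x * y | x y. x \<in> augmentation_ideal \<and> y \<in> aug_pow k}"
  proof (induction rule: pm.span_induct_alt)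
    case base
    then show ?case by (simp add: pm.span_zero)
  next
    case (step c u v)
    then obtain x w where "u = x * w" "x \<in> augmentation_ideal" "w \<in> aug_pow k" by blast
    then have "u * z = x * (w * z)" "x \<in> augmentation_ideal" "w * z \<in> aug_pow k"
      using Suc.IH by (simp_all add: mult.assoc)
    then have "u * z \<in> pm.span {x * y | x y. x \<in> augmentation_ideal \<and> y \<in> aug_pow k}"
      by (blast intro: pm.span_base)
    with step show ?case
      unfolding distrib_right pm_scale_mult_left by (intro pm.span_add pm.span_scale)
  qed
  then show ?case by simp
qed simp

lemma aug_pow_1: "aug_pow (Suc 0) \<subseteq> augmentation_ideal"
  unfolding aug_pow.simps
  by (rule pm.span_minimal[OF _ subspace_augmentation_ideal])
    (auto simp: augmentation_ideal_def augmentation_mult)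

interpretation aug: filtration "aug_pow :: nat \<Rightarrow> ('g::group_add \<Rightarrow>\<^sub>0 'k::field) set"
proof
  fix m and x y :: "'g \<Rightarrow>\<^sub>0 'k"
  show "(0 :: 'g \<Rightarrow>\<^sub>0 'k) \<in> aug_pow m"
    by (rule pm.subspace_0[OF subspace_aug_pow])
  show "x \<in> aug_pow m \<Longrightarrow> y \<in> aug_pow m \<Longrightarrow> x - y \<in> aug_pow m"
    by (rule pm.subspace_diff[OF subspace_aug_pow])
  show "(aug_pow (Suc m) :: ('g \<Rightarrow>\<^sub>0 'k) set) \<subseteq> aug_pow m"
    unfolding aug_pow.simps
    by (rule pm.span_minimal[OF _ subspace_aug_pow]) (auto intro: aug_pow_mult_left)
qed

text \<open>
  Cauchy sequences modulo null sequences for the filtration by the powers of the augmentation ideal.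
\<close>

quotient_type (overloaded) ('g, 'k) cga = "nat \<Rightarrow> ('g::group_add \<Rightarrow>\<^sub>0 'k::field)"
  / partial: "filt_rel aug_pow"
  morphisms rep_cga cga_lim
  by (rule aug.part_equivp_filt_rel)

instantiation cga :: (group_add, field) ring_1
begin

lift_definition zero_cga :: "('a, 'b) cga" is "\<lambda>_. 0"
  by (simp add: aug.filt_rel_refl aug.filt_cauchy_const)

lift_definition one_cga :: "('a, 'b) cga" is "\<lambda>_. 1"
  by (simp add: aug.filt_rel_refl aug.filt_cauchy_const)

lift_definition plus_cga :: "('a, 'b) cga \<Rightarrow> ('a, 'b) cga \<Rightarrow> ('a, 'b) cga"
  is "\<lambda>X Y i. X i + Y i"
  by (rule aug.filt_rel_add)

lift_definition uminus_cga :: "('a, 'b) cga \<Rightarrow> ('a, 'b) cga" is "\<lambda>X i. - X i"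
  by (rule aug.filt_rel_uminus)

definition minus_cga :: "('a, 'b) cga \<Rightarrow> ('a, 'b) cga \<Rightarrow> ('a, 'b) cga" where
  "minus_cga x y = x + - y"

lemma aug_mult_diff:
  fixes a b c d :: "'g::group_add \<Rightarrow>\<^sub>0 'k::field"
  assumes "a - b \<in> aug_pow m" "c - d \<in> aug_pow m"
  shows "a * c - b * d \<in> aug_pow m"
proof -
  have "(a - b) * c + b * (c - d) \<in> aug_pow m"
    by (intro aug.add_mem aug_pow_mult_left aug_pow_mult_right assms)
  then show ?thesis by (simp add: algebra_simps)
qed

lemma filt_cauchy_mult:
  assumes "filt_cauchy aug_pow X" "filt_cauchy aug_pow Y"
  shows "filt_cauchy aug_pow (\<lambda>i. X i * Y i)"
  unfolding filt_cauchy_def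
proof
  fix m
  from assms obtain A B where
    "\<forall>i\<ge>A. \<forall>j\<ge>A. X i - X j \<in> aug_pow m" "\<forall>i\<ge>B. \<forall>j\<ge>B. Y i - Y j \<in> aug_pow m"
    unfolding filt_cauchy_def by meson
  then show "\<exists>M. \<forall>i\<ge>M. \<forall>j\<ge>M. X i * Y i - X j * Y j \<in> aug_pow m"
    by (intro exI[of _ "max A B"]) (simp add: aug_mult_diff)
qed

lift_definition times_cga :: "('a, 'b) cga \<Rightarrow> ('a, 'b) cga \<Rightarrow> ('a, 'b) cga"
  is "\<lambda>X Y i. X i * Y i"
  unfolding filt_rel_def
proof (intro conjI, elim conjE, rule filt_cauchy_mult, assumption+,
    elim conjE, rule filt_cauchy_mult, assumption+)
  fix X X' Y Y' :: "nat \<Rightarrow> ('a \<Rightarrow>\<^sub>0 'b)"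
  assume *: "filt_cauchy aug_pow X \<and> filt_cauchy aug_pow X' \<and> filt_null aug_pow (\<lambda>i. X i - X' i)"
    "filt_cauchy aug_pow Y \<and> filt_cauchy aug_pow Y' \<and> filt_null aug_pow (\<lambda>i. Y i - Y' i)"
  show "filt_null aug_pow (\<lambda>i. X i * Y i - X' i * Y' i)"
    unfolding filt_null_def
  proof
    fix m
    from * obtain A B where "\<forall>i\<ge>A. X i - X' i \<in> aug_pow m" "\<forall>i\<ge>B. Y i - Y' i \<in> aug_pow m"
      unfolding filt_null_def by meson
    then show "\<exists>M. \<forall>i\<ge>M. X i * Y i - X' i * Y' i \<in> aug_pow m"
      by (intro exI[of _ "max A B"]) (simp add: aug_mult_diff)
  qed
qed

instance
proof
  fix a b c :: "('a, 'b) cga"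
  show "a + b + c = a + (b + c)"
    by transfer (simp add: add.assoc aug.filt_rel_refl aug.filt_cauchy_add)
  show "a + b = b + a"
    by transfer (simp add: add.commute aug.filt_rel_refl aug.filt_cauchy_add)
  show "0 + a = a"
    by transfer simp
  show "- a + a = 0"
    by transfer (simp add: aug.filt_rel_refl aug.filt_cauchy_const)
  show "a - b = a + - b"
    by (simp add: minus_cga_def)
  show "a * b * c = a * (b * c)"
    by transfer (simp add: mult.assoc aug.filt_rel_refl filt_cauchy_mult)
  show "1 * a = a" "a * 1 = a"
    by (transfer; simp)+
  show "(a + b) * c = a * c + b * c" "a * (b + c) = a * b + a * c"
    by (transfer; simp add: algebra_simps aug.filt_rel_refl filt_cauchy_mult aug.filt_cauchy_add)+
  have "1 \<notin> (aug_pow (Suc 0) :: ('a \<Rightarrow>\<^sub>0 'b) set)"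
    using aug_pow_1 by (auto simp: augmentation_ideal_def augmentation_single simp flip: single_one)
  then have "0 - 1 \<notin> (aug_pow (Suc 0) :: ('a \<Rightarrow>\<^sub>0 'b) set)"
    using aug.uminus_mem[of "- 1" "Suc 0"] by (auto simp del: aug_pow.simps)
  then have "\<not> filt_rel aug_pow (\<lambda>_. 0 :: 'a \<Rightarrow>\<^sub>0 'b) (\<lambda>_. 1)"
    unfolding filt_rel_def filt_null_def by blast
  then show "(0 :: ('a, 'b) cga) \<noteq> 1"
    by transfer
qed

end


lemma cga_lim_eq_iff:
  assumes "filt_cauchy aug_pow X" "filt_cauchy aug_pow Y"
  shows "cga_lim X = cga_lim Y \<longleftrightarrow> filt_null aug_pow (\<lambda>i. X i - Y i)"
  using Quotient3_rel[OF Quotient3_cga, of X Y] assms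
  by (auto simp: filt_rel_def aug.filt_rel_refl filt_null_def aug.zero_mem)

lemma filt_cauchy_rep_cga: "filt_cauchy aug_pow (rep_cga x)"
  using Quotient3_rep_reflp[OF Quotient3_cga, of x] by (simp add: aug.filt_rel_refl)

lemma cga_lim_rep: "cga_lim (rep_cga x) = x"
  by (rule Quotient3_abs_rep[OF Quotient3_cga])

lemma cga_lim_add:
  "filt_cauchy aug_pow X \<Longrightarrow> filt_cauchy aug_pow Y \<Longrightarrow>
    cga_lim X + cga_lim Y = cga_lim (\<lambda>i. X i + Y i)"
  by (rule plus_cga.abs_eq) (simp_all add: aug.filt_rel_refl)

lemma cga_lim_uminus: "filt_cauchy aug_pow X \<Longrightarrow> - cga_lim X = cga_lim (\<lambda>i. - X i)"
  by (rule uminus_cga.abs_eq) (simp_all add: aug.filt_rel_refl)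

lemma cga_lim_diff:
  "filt_cauchy aug_pow X \<Longrightarrow> filt_cauchy aug_pow Y \<Longrightarrow>
    cga_lim X - cga_lim Y = cga_lim (\<lambda>i. X i - Y i)"
  using cga_lim_add[of X "\<lambda>i. - Y i"] by (simp add: minus_cga_def cga_lim_uminus aug.filt_cauchy_uminus)

lemma cga_lim_mult:
  "filt_cauchy aug_pow X \<Longrightarrow> filt_cauchy aug_pow Y \<Longrightarrow>
    cga_lim X * cga_lim Y = cga_lim (\<lambda>i. X i * Y i)"
  by (rule times_cga.abs_eq) (simp_all add: aug.filt_rel_refl)

definition cga_of :: "('g::group_add \<Rightarrow>\<^sub>0 'k::field) \<Rightarrow> ('g, 'k) cga" where
  "cga_of x = cga_lim (\<lambda>_. x)"

definition cga_group :: "'g::group_add \<Rightarrow> ('g, 'k::field) cga" where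
  "cga_group g = cga_of (Poly_Mapping.single g 1)"

definition cga_scale :: "'k::field \<Rightarrow> ('g::group_add, 'k) cga \<Rightarrow> ('g, 'k) cga" where
  "cga_scale c x = cga_of (Poly_Mapping.single 0 c) * x"

lemma cga_scale_lim:
  "filt_cauchy aug_pow X \<Longrightarrow> cga_scale c (cga_lim X) = cga_lim (\<lambda>i. pm_scale c (X i))"
  by (simp add: cga_scale_def cga_of_def cga_lim_mult aug.filt_cauchy_const pm_scale_def
      mult_map_scale_conv_mult)

interpretation cga: vector_space "cga_scale :: 'k::field \<Rightarrow> ('g::group_add, 'k) cga \<Rightarrow> _"
proof
  fix a b :: 'k and x y :: "('g, 'k) cga"
  show "cga_scale a (x + y) = cga_scale a x + cga_scale a y"
    by (simp add: cga_scale_def distrib_left)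
  show "cga_scale (a + b) x = cga_scale a x + cga_scale b x"
    by (simp add: cga_scale_def cga_of_def single_add aug.filt_cauchy_const
        flip: distrib_right cga_lim_add)
  have "cga_of (Poly_Mapping.single 0 a) * cga_of (Poly_Mapping.single 0 b)
      = (cga_of (Poly_Mapping.single 0 (a * b)) :: ('g, 'k) cga)"
    by (simp add: cga_of_def cga_lim_mult aug.filt_cauchy_const mult_single)
  then show "cga_scale a (cga_scale b x) = cga_scale (a * b) x"
    by (simp add: cga_scale_def flip: mult.assoc)
  have "cga_of (Poly_Mapping.single 0 1) = (1 :: ('g, 'k) cga)"
    by (simp add: cga_of_def one_cga_def)
  then show "cga_scale 1 x = x"
    by (simp add: cga_scale_def)
qed

text \<open>
  The closures of the powers of the augmentation ideal; they form a base of neighbourhoods of \<open>0\<close>.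
\<close>

definition cga_filt :: "nat \<Rightarrow> ('g::group_add, 'k::field) cga set" where
  "cga_filt m = {cga_lim X | X. filt_cauchy aug_pow X \<and> (\<forall>i. X i \<in> aug_pow m)}"

lemma cga_filt_scale: "x \<in> cga_filt m \<Longrightarrow> cga_scale c x \<in> cga_filt m"
proof -
  assume "x \<in> cga_filt m"
  then obtain X where X: "x = cga_lim X" "filt_cauchy aug_pow X" "\<forall>i. X i \<in> aug_pow m"
    unfolding cga_filt_def by blast
  have "filt_cauchy aug_pow (\<lambda>i. pm_scale c (X i))"
    using X(2) unfolding filt_cauchy_def
    by (metis pm.scale_right_diff_distrib pm.subspace_scale subspace_aug_pow)
  with X show ?thesis
    unfolding cga_filt_def
    by (auto simp: cga_scale_lim intro!: exI[of _ "\<lambda>i. pm_scale c (X i)"]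
        pm.subspace_scale[OF subspace_aug_pow])
qed

interpretation cga: filtration "cga_filt :: nat \<Rightarrow> ('g::group_add, 'k::field) cga set"
proof
  fix m and x y :: "('g, 'k) cga"
  show "(0 :: ('g, 'k) cga) \<in> cga_filt m"
    unfolding cga_filt_def zero_cga_def
    using aug.filt_cauchy_const aug.zero_mem by blast
  show "x \<in> cga_filt m \<Longrightarrow> y \<in> cga_filt m \<Longrightarrow> x - y \<in> cga_filt m"
    unfolding cga_filt_def mem_Collect_eq
  proof (elim exE conjE)
    fix X Y :: "nat \<Rightarrow> ('g \<Rightarrow>\<^sub>0 'k)"
    assume *: "x = cga_lim X" "filt_cauchy aug_pow X" "\<forall>i. X i \<in> aug_pow m"
      "y = cga_lim Y" "filt_cauchy aug_pow Y" "\<forall>i. Y i \<in> aug_pow m"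
    have "filt_cauchy aug_pow (\<lambda>i. X i - Y i)"
      using aug.filt_cauchy_add[OF *(2) aug.filt_cauchy_uminus[OF *(5)]] by simp
    with * show "\<exists>Z. x - y = cga_lim Z \<and> filt_cauchy aug_pow Z \<and> (\<forall>i. Z i \<in> aug_pow m)"
      by (intro exI[of _ "\<lambda>i. X i - Y i"]) (simp add: cga_lim_diff aug.diff_mem)
  qed
  show "(cga_filt (Suc m) :: ('g, 'k) cga set) \<subseteq> cga_filt m"
    unfolding cga_filt_def using aug.Suc_subset by blast
qed

instantiation cga :: (group_add, field) topological_space
begin

definition open_cga :: "('a, 'b) cga set \<Rightarrow> bool" where
  "open_cga = filt_open cga_filt"

instance
  by standard (auto simp: open_cga_def filt_open_UNIV filt_open_Union cga.filt_open_Int)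

end

lemma closure_cga_iff:
  fixes x :: "('g::group_add, 'k::field) cga"
  shows "x \<in> closure S \<longleftrightarrow> (\<forall>m. \<exists>s\<in>S. s - x \<in> cga_filt m)"
proof
  assume x: "x \<in> closure S"
  show "\<forall>m. \<exists>s\<in>S. s - x \<in> cga_filt m"
  proof
    fix m
    have "open {y. y - x \<in> cga_filt m}" "x \<in> {y. y - x \<in> cga_filt m}"
      by (simp_all add: open_cga_def cga.filt_open_coset cga.zero_mem)
    with x have "S \<inter> {y. y - x \<in> cga_filt m} \<noteq> {}"
      unfolding closure_iff_nhds_not_empty by blast
    then show "\<exists>s\<in>S. s - x \<in> cga_filt m" by blast
  qed
next
  assume *: "\<forall>m. \<exists>s\<in>S. s - x \<in> cga_filt m"
  show "x \<in> closure S"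
    unfolding closure_iff_nhds_not_empty
  proof (intro allI impI)
    fix A U assume "U \<subseteq> A" "open U" "x \<in> U"
    then obtain m where "\<forall>y. y - x \<in> cga_filt m \<longrightarrow> y \<in> U"
      unfolding open_cga_def filt_open_def by blast
    with * \<open>U \<subseteq> A\<close> show "S \<inter> A \<noteq> {}" by blast
  qed
qed

definition cga_derivations :: "(('g::group_add, 'k::field) cga \<Rightarrow> ('g, 'k) cga) set" where
  "cga_derivations = {u. continuous_on UNIV u \<and> Vector_Spaces.linear cga_scale cga_scale u \<and>
     (\<forall>a b. u (a * b) = u a * b + a * u b)}"

definition cga_log :: "'g::group_add \<Rightarrow> ('g, 'k::field_char_0) cga" where
  "cga_log g = suminf (\<lambda>k. cga_scale ((- 1) ^ k / of_nat (Suc k)) ((cga_group g - 1) ^ Suc k))"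


section \<open>The quotient by the closed span of commutators\<close>

definition cga_commutators :: "('g::group_add, 'k::field) cga set" where
  "cga_commutators = closure (module.span cga_scale {a * b - b * a | a b. True})"

lemma subspace_cga_commutators:
  "cga.subspace (cga_commutators :: ('g::group_add, 'k::field) cga set)"
  unfolding cga.subspace_def
proof (intro conjI ballI allI)
  let ?S = "cga.span {a * b - b * a | a b :: ('g, 'k) cga. True}"
  show "0 \<in> (cga_commutators :: ('g, 'k) cga set)"
    unfolding cga_commutators_def by (rule subsetD[OF closure_subset]) (rule cga.span_zero)
  fix x :: "('g, 'k) cga"
  assume "x \<in> cga_commutators"
  then have x: "\<forall>m. \<exists>s\<in>?S. s - x \<in> cga_filt m"
    unfolding cga_commutators_def closure_cga_iff .
  show "cga_scale c x \<in> cga_commutators" for c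
    unfolding cga_commutators_def closure_cga_iff
  proof
    fix m
    from x obtain s where "s \<in> ?S" "s - x \<in> cga_filt m" by blast
    then show "\<exists>s\<in>?S. s - cga_scale c x \<in> cga_filt m"
      by (intro bexI[of _ "cga_scale c s"])
        (simp_all add: cga.span_scale cga_filt_scale flip: cga.scale_right_diff_distrib)
  qed
  fix y :: "('g, 'k) cga"
  assume "y \<in> cga_commutators"
  then have y: "\<forall>m. \<exists>s\<in>?S. s - y \<in> cga_filt m"
    unfolding cga_commutators_def closure_cga_iff .
  show "x + y \<in> cga_commutators"
    unfolding cga_commutators_def closure_cga_iff
  proof
    fix m
    from x obtain s where "s \<in> ?S" "s - x \<in> cga_filt m" by blast
    moreover from y obtain t where "t \<in> ?S" "t - y \<in> cga_filt m" by blast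
    ultimately show "\<exists>s\<in>?S. s - (x + y) \<in> cga_filt m"
      by (intro bexI[of _ "s + t"]) (simp_all add: cga.span_add cga.add_mem add_diff_add)
  qed
qed

text \<open>
  \<^typ>\<open>('g, 'k) cga\<close> modulo the closed span of commutators; \<^term>\<open>cyc_class a\<close> is \<open>\<bar>a\<bar>\<close>.
\<close>

quotient_type (overloaded) ('g, 'k) cyc = "('g::group_add, 'k::field) cga"
  / "\<lambda>x y. x - y \<in> cga_commutators"
  morphisms rep_cyc cyc_class
proof (rule equivpI)
  show "reflp (\<lambda>x y :: ('g, 'k) cga. x - y \<in> cga_commutators)"
    by (rule reflpI) (simp add: cga.subspace_0[OF subspace_cga_commutators])
  show "symp (\<lambda>x y :: ('g, 'k) cga. x - y \<in> cga_commutators)"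
    by (rule sympI) (use cga.subspace_neg[OF subspace_cga_commutators] in fastforce)
  show "transp (\<lambda>x y :: ('g, 'k) cga. x - y \<in> cga_commutators)"
    by (rule transpI) (use cga.subspace_add[OF subspace_cga_commutators] in fastforce)
qed

instantiation cyc :: (group_add, field) ab_group_add
begin

lift_definition zero_cyc :: "('a, 'b) cyc" is "0" .

lift_definition plus_cyc :: "('a, 'b) cyc \<Rightarrow> ('a, 'b) cyc \<Rightarrow> ('a, 'b) cyc" is "(+)"
  by (simp add: add_diff_add cga.subspace_add[OF subspace_cga_commutators])

lift_definition uminus_cyc :: "('a, 'b) cyc \<Rightarrow> ('a, 'b) cyc" is "uminus"
  by (drule cga.subspace_neg[OF subspace_cga_commutators]) simp

lift_definition minus_cyc :: "('a, 'b) cyc \<Rightarrow> ('a, 'b) cyc \<Rightarrow> ('a, 'b) cyc" is "(-)"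
proof -
  fix x x' y y' :: "('a, 'b) cga"
  assume "x - x' \<in> cga_commutators" "y - y' \<in> cga_commutators"
  then have "(x - x') - (y - y') \<in> cga_commutators"
    by (rule cga.subspace_diff[OF subspace_cga_commutators])
  then show "x - y - (x' - y') \<in> cga_commutators"
    by (simp add: algebra_simps)
qed

instance
  by standard (transfer; simp add: algebra_simps cga.subspace_0[OF subspace_cga_commutators])+

end

definition cyc_map ::
    "(('g::group_add, 'k::field) cga \<Rightarrow> ('g, 'k) cga) \<Rightarrow> ('g, 'k) cyc \<Rightarrow> ('g, 'k) cyc" where
  "cyc_map f x = cyc_class (f (rep_cyc x))"

definition cyc_scale :: "'k::field \<Rightarrow> ('g::group_add, 'k) cyc \<Rightarrow> ('g, 'k) cyc" where
  "cyc_scale c = cyc_map (cga_scale c)"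

text \<open>The quotient filtration, which defines the quotient topology.\<close>

definition cyc_filt :: "nat \<Rightarrow> ('g::group_add, 'k::field) cyc set" where
  "cyc_filt m = cyc_class ` cga_filt m"

interpretation cyc: filtration "cyc_filt :: nat \<Rightarrow> ('g::group_add, 'k::field) cyc set"
proof
  fix m and x y :: "('g, 'k) cyc"
  show "(0 :: ('g, 'k) cyc) \<in> cyc_filt m"
    unfolding cyc_filt_def zero_cyc_def using cga.zero_mem by blast
  show "x \<in> cyc_filt m \<Longrightarrow> y \<in> cyc_filt m \<Longrightarrow> x - y \<in> cyc_filt m"
    unfolding cyc_filt_def by (auto simp: minus_cyc.abs_eq cga.diff_mem)
  show "(cyc_filt (Suc m) :: ('g, 'k) cyc set) \<subseteq> cyc_filt m"
    unfolding cyc_filt_def using cga.Suc_subset by blast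
qed


section \<open>Completed tensor products\<close>

text \<open>
  For vector spaces \<open>V\<close>, \<open>W\<close> with filtrations \<open>F\<close>, \<open>G\<close>, the following subspace \<open>N\<^sub>m\<close> of the vector
  space \<open>U\<close> with basis \<open>V \<times> W\<close> satisfies \<open>U / N\<^sub>m = V / F\<^sub>m \<otimes> W / G\<^sub>m\<close>. Hence the completion of \<open>U\<close>
  with respect to the \<open>N\<^sub>m\<close> is the completed tensor product of \<open>V\<close> and \<open>W\<close>.
\<close>

definition tensor_nbhd :: "('k::field \<Rightarrow> 'v \<Rightarrow> 'v) \<Rightarrow> ('k \<Rightarrow> 'w \<Rightarrow> 'w) \<Rightarrow>
    (nat \<Rightarrow> 'v::ab_group_add set) \<Rightarrow> (nat \<Rightarrow> 'w::ab_group_add set) \<Rightarrow> nat \<Rightarrow>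
    ('v \<times> 'w \<Rightarrow>\<^sub>0 'k) set" where
  "tensor_nbhd s t F G m = module.span pm_scale
     (let e = (\<lambda>v w. Poly_Mapping.single (v, w) 1) in
      {e (v + v') w - e v w - e v' w | v v' w. True} \<union>
      {e v (w + w') - e v w - e v w' | v w w'. True} \<union>
      {e (s c v) w - pm_scale c (e v w) | c v w. True} \<union>
      {e v (t c w) - pm_scale c (e v w) | c v w. True} \<union>
      {e v w | v w. v \<in> F m \<or> w \<in> G m})"

lemma filtration_tensor_nbhd:
  assumes "filtration F" "filtration G"
  shows "filtration (tensor_nbhd s t F G)"
proof
  fix m x y
  show "0 \<in> tensor_nbhd s t F G m"
    unfolding tensor_nbhd_def by (rule pm.span_zero)
  show "x \<in> tensor_nbhd s t F G m \<Longrightarrow> y \<in> tensor_nbhd s t F G m \<Longrightarrow> x - y \<in> tensor_nbhd s t F G m"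
    unfolding tensor_nbhd_def by (rule pm.span_diff)
  show "tensor_nbhd s t F G (Suc m) \<subseteq> tensor_nbhd s t F G m"
    unfolding tensor_nbhd_def Let_def
    using filtration.Suc_subset[OF assms(1), of m] filtration.Suc_subset[OF assms(2), of m]
    by (intro pm.span_mono Un_mono order_refl) blast
qed

definition formal_tensor_map :: "('v \<Rightarrow> 'v') \<Rightarrow> ('w \<Rightarrow> 'w') \<Rightarrow>
    ('v \<times> 'w \<Rightarrow>\<^sub>0 'k::field) \<Rightarrow> ('v' \<times> 'w' \<Rightarrow>\<^sub>0 'k)" where
  "formal_tensor_map f g x = (\<Sum>(v, w)\<in>Poly_Mapping.keys x.
     Poly_Mapping.single (f v, g w) (Poly_Mapping.lookup x (v, w)))"

interpretation cga2: filtration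
  "tensor_nbhd cga_scale cga_scale cga_filt cga_filt ::
    nat \<Rightarrow> (('g::group_add, 'k::field) cga \<times> ('g, 'k) cga \<Rightarrow>\<^sub>0 'k) set"
  by (intro filtration_tensor_nbhd cga.filtration_axioms)

interpretation cyc2: filtration
  "tensor_nbhd cyc_scale cyc_scale cyc_filt cyc_filt ::
    nat \<Rightarrow> (('g::group_add, 'k::field) cyc \<times> ('g, 'k) cyc \<Rightarrow>\<^sub>0 'k) set"
  by (intro filtration_tensor_nbhd cyc.filtration_axioms)

text \<open>
  The completed tensor squares of \<^typ>\<open>('g, 'k) cga\<close> and \<^typ>\<open>('g, 'k) cyc\<close>, respectively.
\<close>

quotient_type (overloaded) ('g, 'k) cga2 =
  "nat \<Rightarrow> (('g::group_add, 'k::field) cga \<times> ('g, 'k) cga \<Rightarrow>\<^sub>0 'k)"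
  / partial: "filt_rel (tensor_nbhd cga_scale cga_scale cga_filt cga_filt)"
  morphisms rep_cga2 cga2_lim
  by (rule cga2.part_equivp_filt_rel)

quotient_type (overloaded) ('g, 'k) cyc2 =
  "nat \<Rightarrow> (('g::group_add, 'k::field) cyc \<times> ('g, 'k) cyc \<Rightarrow>\<^sub>0 'k)"
  / partial: "filt_rel (tensor_nbhd cyc_scale cyc_scale cyc_filt cyc_filt)"
  morphisms rep_cyc2 cyc2_lim
  by (rule cyc2.part_equivp_filt_rel)

instantiation cga2 :: (group_add, field) ab_group_add
begin

lift_definition zero_cga2 :: "('a, 'b) cga2" is "\<lambda>_. 0"
  by (simp add: cga2.filt_rel_refl cga2.filt_cauchy_const)

lift_definition plus_cga2 :: "('a, 'b) cga2 \<Rightarrow> ('a, 'b) cga2 \<Rightarrow> ('a, 'b) cga2"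
  is "\<lambda>X Y i. X i + Y i"
  by (rule cga2.filt_rel_add)

lift_definition uminus_cga2 :: "('a, 'b) cga2 \<Rightarrow> ('a, 'b) cga2" is "\<lambda>X i. - X i"
  by (rule cga2.filt_rel_uminus)

definition minus_cga2 :: "('a, 'b) cga2 \<Rightarrow> ('a, 'b) cga2 \<Rightarrow> ('a, 'b) cga2" where
  "minus_cga2 x y = x + - y"

instance
proof
  fix a b c :: "('a, 'b) cga2"
  show "a + b + c = a + (b + c)"
    by transfer (simp add: add.assoc cga2.filt_rel_refl cga2.filt_cauchy_add)
  show "a + b = b + a"
    by transfer (simp add: add.commute cga2.filt_rel_refl cga2.filt_cauchy_add)
  show "0 + a = a"
    by transfer simp
  show "- a + a = 0"
    by transfer (simp add: cga2.filt_rel_refl cga2.filt_cauchy_const)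
  show "a - b = a + - b"
    by (simp add: minus_cga2_def)
qed

end

instantiation cyc2 :: (group_add, field) ab_group_add
begin

lift_definition zero_cyc2 :: "('a, 'b) cyc2" is "\<lambda>_. 0"
  by (simp add: cyc2.filt_rel_refl cyc2.filt_cauchy_const)

lift_definition plus_cyc2 :: "('a, 'b) cyc2 \<Rightarrow> ('a, 'b) cyc2 \<Rightarrow> ('a, 'b) cyc2"
  is "\<lambda>X Y i. X i + Y i"
  by (rule cyc2.filt_rel_add)

lift_definition uminus_cyc2 :: "('a, 'b) cyc2 \<Rightarrow> ('a, 'b) cyc2" is "\<lambda>X i. - X i"
  by (rule cyc2.filt_rel_uminus)

definition minus_cyc2 :: "('a, 'b) cyc2 \<Rightarrow> ('a, 'b) cyc2 \<Rightarrow> ('a, 'b) cyc2" where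
  "minus_cyc2 x y = x + - y"

instance
proof
  fix a b c :: "('a, 'b) cyc2"
  show "a + b + c = a + (b + c)"
    by transfer (simp add: add.assoc cyc2.filt_rel_refl cyc2.filt_cauchy_add)
  show "a + b = b + a"
    by transfer (simp add: add.commute cyc2.filt_rel_refl cyc2.filt_cauchy_add)
  show "0 + a = a"
    by transfer simp
  show "- a + a = 0"
    by transfer (simp add: cyc2.filt_rel_refl cyc2.filt_cauchy_const)
  show "a - b = a + - b"
    by (simp add: minus_cyc2_def)
qed

end

definition cga2_filt :: "nat \<Rightarrow> ('g::group_add, 'k::field) cga2 set" where
  "cga2_filt m = {cga2_lim X | X.
     filt_cauchy (tensor_nbhd cga_scale cga_scale cga_filt cga_filt) X \<and>
     (\<forall>i. X i \<in> tensor_nbhd cga_scale cga_scale cga_filt cga_filt m)}"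

lemma filtration_cga2_filt: "filtration (cga2_filt :: nat \<Rightarrow> ('g::group_add, 'k::field) cga2 set)"
proof
  fix m and x y :: "('g, 'k) cga2"
  let ?N = "tensor_nbhd cga_scale cga_scale cga_filt cga_filt ::
    nat \<Rightarrow> (('g, 'k) cga \<times> ('g, 'k) cga \<Rightarrow>\<^sub>0 'k) set"
  show "(0 :: ('g, 'k) cga2) \<in> cga2_filt m"
    unfolding cga2_filt_def zero_cga2_def
    using cga2.filt_cauchy_const cga2.zero_mem by blast
  show "x \<in> cga2_filt m \<Longrightarrow> y \<in> cga2_filt m \<Longrightarrow> x - y \<in> cga2_filt m"
    unfolding cga2_filt_def mem_Collect_eq
  proof (elim exE conjE)
    fix X Y
    assume *: "x = cga2_lim X" "filt_cauchy ?N X" "\<forall>i. X i \<in> ?N m"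
      "y = cga2_lim Y" "filt_cauchy ?N Y" "\<forall>i. Y i \<in> ?N m"
    have "x - y = cga2_lim X + cga2_lim (\<lambda>i. - Y i)"
      using * by (simp add: minus_cga2_def uminus_cga2.abs_eq cga2.filt_rel_refl)
    also have "\<dots> = cga2_lim (\<lambda>i. X i + - Y i)"
      by (rule plus_cga2.abs_eq) (simp_all add: * cga2.filt_rel_refl cga2.filt_cauchy_uminus)
    finally show "\<exists>Z. x - y = cga2_lim Z \<and> filt_cauchy ?N Z \<and> (\<forall>i. Z i \<in> ?N m)"
      using * cga2.filt_cauchy_add[OF *(2) cga2.filt_cauchy_uminus[OF *(5)]]
      by (intro exI[of _ "\<lambda>i. X i + - Y i"]) (simp add: cga2.diff_mem)
  qed
  show "(cga2_filt (Suc m) :: ('g, 'k) cga2 set) \<subseteq> cga2_filt m"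
    unfolding cga2_filt_def using cga2.Suc_subset by blast
qed

instantiation cga2 :: (group_add, field) topological_space
begin

definition open_cga2 :: "('a, 'b) cga2 set \<Rightarrow> bool" where
  "open_cga2 = filt_open cga2_filt"

instance
  by standard (auto simp: open_cga2_def filt_open_UNIV filt_open_Union
      filtration.filt_open_Int[OF filtration_cga2_filt])

end

definition cga2_scale :: "'k::field \<Rightarrow> ('g::group_add, 'k) cga2 \<Rightarrow> ('g, 'k) cga2" where
  "cga2_scale c x = cga2_lim (\<lambda>i. pm_scale c (rep_cga2 x i))"

definition cga_tensor :: "('g::group_add, 'k::field) cga \<Rightarrow> ('g, 'k) cga \<Rightarrow> ('g, 'k) cga2" where
  "cga_tensor a b = cga2_lim (\<lambda>_. Poly_Mapping.single (a, b) 1)"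

definition cyc_tensor :: "('g::group_add, 'k::field) cyc \<Rightarrow> ('g, 'k) cyc \<Rightarrow> ('g, 'k) cyc2" where
  "cyc_tensor x y = cyc2_lim (\<lambda>_. Poly_Mapping.single (x, y) 1)"

text \<open>
  The maps \<open>f \<otimes> g\<close> on completed tensor products, for continuous linear maps \<open>f\<close> and \<open>g\<close>.
\<close>

definition cga2_map :: "(('g::group_add, 'k::field) cga \<Rightarrow> ('g, 'k) cga) \<Rightarrow>
    (('g, 'k) cga \<Rightarrow> ('g, 'k) cga) \<Rightarrow> ('g, 'k) cga2 \<Rightarrow> ('g, 'k) cga2" where
  "cga2_map f g x = cga2_lim (\<lambda>i. formal_tensor_map f g (rep_cga2 x i))"

definition cyc2_map :: "(('g::group_add, 'k::field) cyc \<Rightarrow> ('g, 'k) cyc) \<Rightarrow>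
    (('g, 'k) cyc \<Rightarrow> ('g, 'k) cyc) \<Rightarrow> ('g, 'k) cyc2 \<Rightarrow> ('g, 'k) cyc2" where
  "cyc2_map f g x = cyc2_lim (\<lambda>i. formal_tensor_map f g (rep_cyc2 x i))"

text \<open>The map \<open>a \<otimes> b \<mapsto> \<bar>a\<bar> \<otimes> \<bar>b\<bar>\<close>.\<close>

definition cyc2_class :: "('g::group_add, 'k::field) cga2 \<Rightarrow> ('g, 'k) cyc2" where
  "cyc2_class x = cyc2_lim (\<lambda>i. formal_tensor_map cyc_class cyc_class (rep_cga2 x i))"

text \<open>Multiplication by \<open>a \<otimes> 1\<close> from the left and by \<open>1 \<otimes> b\<close> from the right, respectively.\<close>

definition cga2_lmult :: "('g::group_add, 'k::field) cga \<Rightarrow> ('g, 'k) cga2 \<Rightarrow> ('g, 'k) cga2" where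
  "cga2_lmult a x = cga2_map (\<lambda>y. a * y) id x"

definition cga2_rmult :: "('g::group_add, 'k::field) cga2 \<Rightarrow> ('g, 'k) cga \<Rightarrow> ('g, 'k) cga2" where
  "cga2_rmult x b = cga2_map id (\<lambda>y. y * b) x"

definition der_act :: "(('g::group_add, 'k::field) cga \<Rightarrow> ('g, 'k) cga) \<Rightarrow>
    ('g, 'k) cyc2 \<Rightarrow> ('g, 'k) cyc2" where
  "der_act u x = cyc2_map (cyc_map u) id x + cyc2_map id (cyc_map u) x"


section \<open>The divergence\<close>

text \<open>\<open>\<partial>\<close> with respect to \<open>Z\<^sub>g = g - 1\<close>, for an element \<open>g\<close> of the free generating set \<open>\<gamma>\<close>.\<close>

definition cga_partial :: "'g::group_add set \<Rightarrow> 'g \<Rightarrow> ('g, 'k::field) cga \<Rightarrow> ('g, 'k) cga2" where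
  "cga_partial \<gamma> g = (THE D. continuous_on UNIV D \<and>
     Vector_Spaces.linear cga_scale cga2_scale D \<and>
     (\<forall>h\<in>\<gamma>. D (cga_group h - 1) = (if h = g then cga_tensor 1 1 else 0)) \<and>
     (\<forall>a b. D (a * b) = cga2_lmult a (D b) + cga2_rmult (D a) b))"

definition Div :: "'g::group_add set \<Rightarrow>
    (('g, 'k::field) cga \<Rightarrow> ('g, 'k) cga) \<Rightarrow> ('g, 'k) cyc2" where
  "Div \<gamma> u = (\<Sum>g\<in>\<gamma>. cyc2_class (cga_partial \<gamma> g (u (cga_group g - 1)))) -
     cyc_tensor (cyc_class 1) (\<Sum>g\<in>\<gamma>. cyc_class (u (cga_group g) * cga_group (- g)))"

text \<open>
  The identification of \<open>H\<^sub>1(\<Gamma>, \<int>)\<close> with the lattice \<open>\<Lambda>\<close>, and \<open>\<Delta>\<close> with a tilde on \<open>\<Lambda>\<close>.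
\<close>

definition H1_log :: "'g::group_add H1 \<Rightarrow> ('g, 'k::field_char_0) cyc" where
  "H1_log h = cyc_class (cga_log (rep_H1 h))"

definition twisted_coproduct :: "('g::group_add, 'k::field) cyc \<Rightarrow> ('g, 'k) cyc2" where
  "twisted_coproduct x = cyc_tensor x (cyc_class 1) - cyc_tensor (cyc_class 1) x"


text \<open>
  The type argument fixes the ground field, which does not occur in the type of \<open>\<s>\<close>.
\<close>

definition divergence_cocycle ::
    "'k::field_char_0 itself \<Rightarrow> 'g::group_add set \<Rightarrow> (('g \<Rightarrow> 'g) \<Rightarrow> 'g H1) \<Rightarrow> bool" where
  "divergence_cocycle _ \<gamma> \<s> \<longleftrightarrow> additive_cocycle \<s> \<and>
     (\<forall>F\<in>group_aut. \<forall>u\<in>(cga_derivations :: (('g, 'k) cga \<Rightarrow> ('g, 'k) cga) set).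
        Div (F ` \<gamma>) u - Div \<gamma> u = der_act u (twisted_coproduct (H1_log (\<s> F))))"

end

theory Submission
  imports Defs
begin

text \<open>
  Replacing a basis element \<open>x\<close> by \<open>x y\<close>, with \<open>y\<close> another basis element, does not change the
  divergence, and replacing \<open>x\<close> by its inverse changes it by \<open>u\<close> applied to the twisted coproduct of
  \<open>- \<bar>log x\<bar>\<close>. By Nielsen's theorem any two bases are connected by such moves, so the divergences of
  two bases differ by \<open>u\<close> applied to the twisted coproduct of a class in \<open>H\<^sub>1\<close>, the sum of the
  contributions of the moves. The class is unique: for \<open>u\<close> with \<open>u(\<gamma>\<^sub>k) = \<gamma>\<^sub>k\<^sup>2\<close> and \<open>u(\<gamma>\<^sub>j) = 0\<close>
  otherwise, the tensor product of the \<open>k\<close>-th exponent and the augmentation reads off its \<open>k\<close>-th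
  coordinate. An automorphism maps sequences of moves to sequences of moves and acts on the
  contributions, so uniqueness yields the cocycle identity and the change of basis formula.

  Since \<open>u\<close> is a derivation, \<open>u(\<bar>log g\<bar>) = \<bar>u(g) g\<inverse>\<bar>\<close>, which is additive in \<open>g\<close>; no
  Baker-Campbell-Hausdorff formula is needed.
\<close>

section \<open>Free groups\<close>

text \<open>The derivatives \<open>cga_partial\<close> are given by a definite description, so a
  change of basis is handled through uniqueness: candidates for the new derivatives are written in
  terms of the old ones and checked on the new basis. For one move the candidates are short; for a
  general automorphism they would form a full Jacobian, which is why the proof goes through moves.
  The candidates differ from the old derivatives by factors inserted between the two tensor legs.
  These factors can be cancelled only after cyclic rotation, hence only in cyclic words. Replacing
  \<open>x\<close> by \<open>x + y\<close> leaves an extra term 1 tensor \<open>dlog y\<close>,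
  which is what the second sum in \<open>Div\<close> compensates; this accounts for the asymmetric
  correction. Crossed homomorphisms on a free group supply both the derivatives and the derivations
  that separate classes. Different sequences of moves may join the same two bases, so the class
  attached to a sequence is not visibly well defined. That follows only from the separation of
  classes by derivations, so the cocycle property rests on the uniqueness argument too.\<close>

abbreviation letters :: "'g set \<Rightarrow> ('g \<times> bool) set" where
  "letters S \<equiv> S \<times> UNIV"

definition letter_value :: "'g::group_add \<times> bool \<Rightarrow> 'g" where
  "letter_value l = (if snd l then fst l else - fst l)"

definition letter_inv :: "'g \<times> bool \<Rightarrow> 'g \<times> bool" where
  "letter_inv l = (fst l, \<not> snd l)"

definition word_inv :: "('g \<times> bool) list \<Rightarrow> ('g \<times> bool) list" where
  "word_inv w = rev (map letter_inv w)"

definition word_of :: "'g::group_add set \<Rightarrow> 'g \<Rightarrow> ('g \<times> bool) list" where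
  "word_of S = inv_into (reduced_words S) word_value"

definition generates :: "'g::group_add set \<Rightarrow> bool" where
  "generates S \<longleftrightarrow> (\<forall>g. \<exists>w. set w \<subseteq> letters S \<and> word_value w = g)"

lemma letter_inv_simps [simp]:
  "letter_inv (letter_inv l) = l" "letter_inv l \<noteq> l" "l \<noteq> letter_inv l"
  "letter_inv l \<in> letters S \<longleftrightarrow> l \<in> letters S"
  by (cases l; auto simp: letter_inv_def)+

lemma letter_value_inv [simp]: "letter_value (letter_inv l) = - letter_value l"
  by (simp add: letter_value_def letter_inv_def)

lemma letter_value_simps [simp]: "letter_value (s, True) = s" "letter_value (s, False) = - s"
  by (simp_all add: letter_value_def)

lemma word_value_Nil [simp]: "word_value [] = 0"
  by (simp add: word_value_def)

lemma word_value_Cons [simp]: "word_value (l # w) = letter_value l + word_value w"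
  by (cases l) (simp add: word_value_def letter_value_def)

lemma word_value_append [simp]: "word_value (v @ w) = word_value v + word_value w"
  by (induction v) (simp_all add: add.assoc)

lemma word_inv_Nil [simp]: "word_inv [] = []"
  by (simp add: word_inv_def)

lemma word_inv_append [simp]: "word_inv (v @ w) = word_inv w @ word_inv v"
  by (simp add: word_inv_def)

lemma word_inv_inv [simp]: "word_inv (word_inv w) = w"
  by (simp add: word_inv_def rev_map comp_def)

lemma length_word_inv [simp]: "length (word_inv w) = length w"
  by (simp add: word_inv_def)

lemma word_value_inv [simp]: "word_value (word_inv w) = - word_value w"
  by (induction w) (simp_all add: word_inv_def minus_add)

lemma mem_reduced_words:
  "w \<in> reduced_words S \<longleftrightarrow>
     set w \<subseteq> letters S \<and> successively (\<lambda>l m. m \<noteq> letter_inv l) w"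
proof -
  have "(\<lambda>(g, b) (h, c). g = h \<longrightarrow> b = c) = (\<lambda>l m :: 'a \<times> bool. m \<noteq> letter_inv l)"
    by (auto simp: letter_inv_def fun_eq_iff)
  then show ?thesis
    by (simp add: reduced_words_def)
qed

lemma word_inv_reduced: "w \<in> reduced_words S \<Longrightarrow> word_inv w \<in> reduced_words S"
  by (auto simp: mem_reduced_words word_inv_def successively_map letter_inv_def
      elim!: successively_mono)

lemma drop_reduced: "w \<in> reduced_words S \<Longrightarrow> drop k w \<in> reduced_words S"
  using append_take_drop_id[of k w] set_drop_subset[of k w]
  by (metis (no_types, lifting) mem_reduced_words order_trans successively_append_iff)

lemma word_of_mem: "free_generating_set S \<Longrightarrow> word_of S g \<in> reduced_words S"
  and word_value_word_of [simp]: "free_generating_set S \<Longrightarrow> word_value (word_of S g) = g"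
  and word_of_word_value:
    "free_generating_set S \<Longrightarrow> w \<in> reduced_words S \<Longrightarrow> word_of S (word_value w) = w"
  unfolding word_of_def free_generating_set_def bij_betw_def
  by (simp_all add: inv_into_into f_inv_into_f)

lemma word_of_eqI:
  "free_generating_set S \<Longrightarrow> w \<in> reduced_words S \<Longrightarrow> word_value w = g \<Longrightarrow> word_of S g = w"
  using word_of_word_value by blast

lemma word_of_0: "free_generating_set S \<Longrightarrow> word_of S 0 = []"
  by (rule word_of_eqI) (simp_all add: mem_reduced_words)

lemma word_of_letter:
  "free_generating_set S \<Longrightarrow> l \<in> letters S \<Longrightarrow> word_of S (letter_value l) = [l]"
  by (rule word_of_eqI) (simp_all add: mem_reduced_words)

lemma word_of_uminus: "free_generating_set S \<Longrightarrow> word_of S (- g) = word_inv (word_of S g)"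
  by (rule word_of_eqI) (simp_all add: word_inv_reduced word_of_mem)

lemma letter_value_inj:
  "free_generating_set S \<Longrightarrow> l \<in> letters S \<Longrightarrow> m \<in> letters S \<Longrightarrow>
    letter_value l = letter_value m \<Longrightarrow> l = m"
  by (metis word_of_letter list.inject)

lemma free_not_0: "free_generating_set S \<Longrightarrow> s \<in> S \<Longrightarrow> s \<noteq> 0"
  using word_of_letter[of S "(s, True)"] word_of_0[of S] by auto

lemma free_uminus_notin: "free_generating_set S \<Longrightarrow> s \<in> S \<Longrightarrow> - s \<notin> S"
  using letter_value_inj[of S "(s, False)" "(- s, True)"] by auto

lemma free_generates: "free_generating_set S \<Longrightarrow> generates S"
  unfolding generates_def by (metis mem_reduced_words word_of_mem word_value_word_of)

lemma generates_induct [consumes 1, case_names zero letter]: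
  assumes "generates S" "P 0"
    and "\<And>l g. l \<in> letters S \<Longrightarrow> P g \<Longrightarrow> P (letter_value l + g)"
  shows "P g"
proof -
  have "P (word_value w)" if "set w \<subseteq> letters S" for w
    using that by (induction w) (auto intro: assms)
  with assms(1) show ?thesis
    unfolding generates_def by metis
qed

lemma hom_zero:
  fixes f :: "'g::group_add \<Rightarrow> 'h::group_add"
  assumes "\<And>x y. f (x + y) = f x + f y"
  shows "f 0 = 0" "f (- x) = - f x"
proof -
  show *: "f 0 = 0" using assms[of 0 0] by (metis add.right_neutral add_left_cancel)
  show "f (- x) = - f x"
    using assms[of "- x" x] * by (simp add: eq_neg_iff_add_eq_0)
qed

lemma generates_hom_eq:
  fixes f g :: "'g::group_add \<Rightarrow> 'h::group_add"
  assumes "generates S" "\<And>x y. f (x + y) = f x + f y" "\<And>x y. g (x + y) = g x + g y"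
    and "\<And>s. s \<in> S \<Longrightarrow> f s = g s"
  shows "f x = g x"
  using assms(1)
proof (induction rule: generates_induct[where P = "\<lambda>x. f x = g x"])
  case zero
  then show ?case using assms(2,3) by (simp add: hom_zero)
next
  case (letter l x)
  then have "f (letter_value l) = g (letter_value l)"
    using assms(4) hom_zero(2)[of f, OF assms(2)] hom_zero(2)[of g, OF assms(3)]
    by (auto simp: letter_value_def)
  with letter show ?case by (simp add: assms(2,3))
qed

text \<open>
  A crossed homomorphism is determined on a word letter by letter; the recursion on reduced words
  respects concatenation because cancelling letters contribute opposite amounts.
\<close>

lemma free_crossed_hom:
  fixes act :: "'g::group_add \<Rightarrow> 'm::group_add \<Rightarrow> 'm"
  assumes free: "free_generating_set S"
    and act_add: "\<And>g x y. act g (x + y) = act g x + act g y"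
    and act_act: "\<And>g h x. act (g + h) x = act g (act h x)"
    and act_0: "\<And>x. act 0 x = x"
  obtains d where "\<And>g h. d (g + h) = d g + act g (d h)" "\<And>s. s \<in> S \<Longrightarrow> d s = f s"
proof -
  \<comment> \<open>The value on an inverse letter is forced by
    \<open>d (- s + s) = 0\<close>.\<close>
  define lt where "lt l = (if snd l then f (fst l) else - act (- fst l) (f (fst l)))" for l
  define dw where "dw w = foldr (\<lambda>l m. lt l + act (letter_value l) m) w 0" for w
  define d where "d g = dw (word_of S g)" for g
  have act_zero: "act g 0 = 0" for g
    using act_add[of g 0 0] by (metis add.right_neutral add_left_cancel)
  have act_minus: "act g (- x) = - act g x" for g x
    using act_add[of g x "- x"] by (simp add: act_zero eq_neg_iff_add_eq_0 minus_unique)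
  have lt_cancel: "lt l + act (letter_value l) (lt (letter_inv l)) = 0" for l
    by (cases "snd l")
      (simp_all add: lt_def letter_inv_def letter_value_def act_minus act_0 flip: act_act)
  \<comment> \<open>Either the new letter cancels the head of the reduced word, or the longer word
    is again reduced.\<close>
  have d_letter: "d (letter_value l + g) = lt l + act (letter_value l) (d g)"
    if l: "l \<in> letters S" for l g
  proof (cases "\<exists>w. word_of S g = letter_inv l # w")
    case True
    then obtain w where w: "word_of S g = letter_inv l # w" by blast
    then have "w \<in> reduced_words S"
      using word_of_mem[OF free, of g] by (auto simp: mem_reduced_words successively_Cons)
    moreover have "word_value w = letter_value l + g"
      using word_value_word_of[OF free, of g] by (simp add: w flip: add.assoc)
        (metis add.assoc add.left_neutral add.right_inverse letter_value_inv word_value_Cons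
          word_value_word_of[OF free, of g] w)
    ultimately have "d (letter_value l + g) = dw w"
      by (simp add: d_def word_of_eqI[OF free])
    moreover have "lt l + act (letter_value l) (d g) = dw w"
      using lt_cancel[of l] by (simp add: d_def w dw_def act_add act_0 flip: act_act add.assoc)
    ultimately show ?thesis by simp
  next
    case False
    then have "l # word_of S g \<in> reduced_words S"
      using word_of_mem[OF free, of g] l by (cases "word_of S g") (auto simp: mem_reduced_words)
    then have "word_of S (letter_value l + g) = l # word_of S g"
      by (rule word_of_eqI[OF free]) (simp add: free)
    then show ?thesis by (simp add: d_def dw_def)
  qed
  show ?thesis
  proof
    show "d (g + h) = d g + act g (d h)" for g h
      using free_generates[OF free]
    proof (induction g rule: generates_induct)
      case zero
      then show ?case by (simp add: d_def dw_def word_of_0 free act_0)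
    next
      case (letter l g)
      then show ?case
        by (simp add: add.assoc d_letter act_add act_act)
    qed
    show "d s = f s" if "s \<in> S" for s
      using word_of_letter[OF free, of "(s, True)"] that
      by (simp add: d_def dw_def lt_def act_zero)
  qed
qed

lemma free_hom:
  fixes f :: "'g::group_add \<Rightarrow> 'h::group_add"
  assumes "free_generating_set S"
  obtains d where "\<And>g h. d (g + h) = d g + d h" "\<And>s. s \<in> S \<Longrightarrow> d s = f s"
  by (rule free_crossed_hom[OF assms, of "\<lambda>_ x. x" f]) auto

section \<open>Automorphisms and elementary changes of basis\<close>

lemma group_aut_image_free:
  assumes F: "F \<in> group_aut" and free: "free_generating_set S"
  shows "free_generating_set (F ` S)"
proof -
  have hom: "F (x + y) = F x + F y" and "bij F" for x y
    using F by (auto simp: group_aut_def)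
  then have inj: "inj F" by (simp add: bij_is_inj)
  let ?m = "map (apfst F)"
  have letter: "letter_value (apfst F l) = F (letter_value l)" for l
    by (cases l) (simp add: letter_value_def hom_zero[of F, OF hom])
  then have word: "word_value (?m w) = F (word_value w)" for w
    by (induction w) (simp_all add: hom hom_zero[of F, OF hom])
  have inj_letter: "inj (apfst F :: 'a \<times> bool \<Rightarrow> _)"
    using inj by (auto simp: inj_def)
  have inv: "apfst F m \<noteq> letter_inv (apfst F l) \<longleftrightarrow> m \<noteq> letter_inv l" for l m :: "'a \<times> bool"
    using inj by (auto simp: letter_inv_def apfst_def map_prod_def inj_eq split: prod.splits)
  have "?m ` reduced_words S = reduced_words (F ` S)"
  proof
    show "?m ` reduced_words S \<subseteq> reduced_words (F ` S)"
    proof (intro subsetI, elim imageE)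
      fix w v assume "w = ?m v" "v \<in> reduced_words S"
      moreover from this have "apfst F ` set v \<subseteq> letters (F ` S)"
        by (force simp: mem_reduced_words)
      ultimately show "w \<in> reduced_words (F ` S)"
        by (simp add: mem_reduced_words successively_map inv)
    qed
    show "reduced_words (F ` S) \<subseteq> ?m ` reduced_words S"
    proof
      fix w assume w: "w \<in> reduced_words (F ` S)"
      have "letters (F ` S) = apfst F ` letters S"
        by force
      with w have "w \<in> lists (apfst F ` letters S)"
        by (auto simp: mem_reduced_words in_lists_conv_set)
      then obtain v where v: "set v \<subseteq> letters S" "w = ?m v"
        unfolding lists_image by (auto simp: in_lists_conv_set)
      with w show "w \<in> ?m ` reduced_words S"
        by (auto simp: mem_reduced_words successively_map inv)
    qed
  qed
  then have m: "bij_betw ?m (reduced_words S) (reduced_words (F ` S))"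
    using inj_letter by (simp add: bij_betw_def inj_on_def inj_map_eq_map)
  have "bij_betw (F \<circ> word_value) (reduced_words S) UNIV"
    using free \<open>bij F\<close> unfolding free_generating_set_def by (rule bij_betw_trans)
  then have "bij_betw (word_value \<circ> ?m) (reduced_words S) UNIV"
    by (simp add: comp_def word)
  then show ?thesis
    unfolding free_generating_set_def by (simp add: bij_betw_comp_iff[OF m])
qed

text \<open>Checking the two composites on \<open>S\<close> suffices, since they are homomorphisms
  and \<open>S\<close> generates.\<close>

lemma free_group_autI:
  assumes free: "free_generating_set S"
    and "\<And>x y. F (x + y) = F x + F y" "\<And>x y. G (x + y) = G x + G y"
    and "\<And>s. s \<in> S \<Longrightarrow> F (G s) = s" "\<And>s. s \<in> S \<Longrightarrow> G (F s) = s"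
  shows "F \<in> group_aut"
proof -
  have "F (G x) = id x" "G (F x) = id x" for x
    by (rule generates_hom_eq[OF free_generates[OF free]]; simp add: assms)+
  then have "bij F" by (intro o_bij[of G]) auto
  with assms(2) show ?thesis by (simp add: group_aut_def)
qed


text \<open>The homomorphisms fixing \<open>B\<close> and sending \<open>x\<close> to
  \<open>x1\<close> and to \<open>x2\<close> are mutually inverse. The last two hypotheses say so on
  the basis; they are quantified over all homomorphisms with these values, so that for a concrete
  move they are settled by simplification.\<close>

lemma free_replace:
  assumes free: "free_generating_set (insert x B)" and x: "x \<notin> B"
    and F: "\<And>f. (\<And>y z. f (y + z) = f y + f z) \<Longrightarrow> (\<And>b. b \<in> B \<Longrightarrow> f b = b) \<Longrightarrow> f x = x1 \<Longrightarrow>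
      f x2 = x"
    and G: "\<And>f. (\<And>y z. f (y + z) = f y + f z) \<Longrightarrow> (\<And>b. b \<in> B \<Longrightarrow> f b = b) \<Longrightarrow> f x = x2 \<Longrightarrow>
      f x1 = x"
  shows "free_generating_set (insert x1 B)" "x1 \<notin> B"
proof -
  obtain f where f: "\<And>y z. f (y + z) = f y + f z"
    "\<And>s. s \<in> insert x B \<Longrightarrow> f s = (if s = x then x1 else s)"
    by (rule free_hom[OF free, of "\<lambda>s. if s = x then x1 else s"]) blast
  obtain g where g: "\<And>y z. g (y + z) = g y + g z"
    "\<And>s. s \<in> insert x B \<Longrightarrow> g s = (if s = x then x2 else s)"
    by (rule free_hom[OF free, of "\<lambda>s. if s = x then x2 else s"]) blast
  have fg: "\<And>b. b \<in> B \<Longrightarrow> f b = b" "\<And>b. b \<in> B \<Longrightarrow> g b = b" "f x = x1" "g x = x2"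
    using f(2) g(2) x by auto
  have "f x2 = x" "g x1 = x"
    by (rule F, rule f, rule fg, assumption, rule fg) (rule G, rule g, rule fg, assumption, rule fg)
  then have aut: "f \<in> group_aut"
    using fg by (intro free_group_autI[OF free, of f g] f g) auto
  have im: "f ` B = B"
    using fg(1) by auto
  then have "insert x1 B = f ` insert x B"
    by (simp add: fg)
  then show "free_generating_set (insert x1 B)"
    using group_aut_image_free[OF aut free] by simp
  show "x1 \<notin> B"
  proof
    assume "x1 \<in> B"
    then have "f x1 = f x" using fg by simp
    then have "x1 = x" using aut by (simp add: group_aut_def bij_is_inj inj_eq)
    with \<open>x1 \<in> B\<close> x show False by simp
  qed
qed

lemma free_replace_uminus:
  assumes "free_generating_set (insert x B)" "x \<notin> B"
  shows "free_generating_set (insert (- x) B)" "- x \<notin> B"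
  by (rule free_replace[OF assms, of "- x" "- x"]; simp add: hom_zero)+

lemma free_replace_add:
  assumes "free_generating_set (insert x B)" "x \<notin> B" "y \<in> B"
  shows "free_generating_set (insert (x + y) B)" "x + y \<notin> B"
  by (rule free_replace[OF assms(1,2), of "x + y" "x - y"];
      use assms(3) in \<open>simp add: hom_zero diff_conv_add_uminus add.assoc del: add_uminus_conv_diff\<close>)+

text \<open>The exponent sum of \<open>s\<close>. It serves as an obstruction below: a set on which
  it vanishes cannot generate.\<close>

lemma free_exponent:
  assumes "free_generating_set (S :: 'g::group_add set)" and "s \<in> S"
  obtains e :: "'g::group_add \<Rightarrow> int" where "\<And>g h. e (g + h) = e g + e h"
    "\<And>t. t \<in> S \<Longrightarrow> e t = (if t = s then 1 else 0)"
  by (rule free_hom[OF assms(1), of "\<lambda>t. if t = s then 1 else (0 :: int)"]) auto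

text \<open>If neither \<open>s\<close> nor its inverse were in \<open>T\<close>, the exponent sum
  of \<open>s\<close> would vanish on \<open>T\<close>, hence everywhere.\<close>

lemma free_mem_of_generates:
  assumes free: "free_generating_set S" and s: "s \<in> S" and gen: "generates T"
    and T: "\<And>t. t \<in> T \<Longrightarrow> \<exists>r\<in>S. t = r \<or> t = - r"
  shows "s \<in> T \<or> - s \<in> T"
proof (rule ccontr)
  assume not: "\<not> (s \<in> T \<or> - s \<in> T)"
  obtain e :: "'a \<Rightarrow> int" where e: "\<And>g h. e (g + h) = e g + e h"
      "\<And>t. t \<in> S \<Longrightarrow> e t = (if t = s then 1 else 0)"
    using free_exponent[OF free s] by blast
  have "e t = 0" if "t \<in> T" for t
  proof -
    from T[OF that] obtain r where r: "r \<in> S" "t = r \<or> t = - r" by blast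
    then have "r \<noteq> s" using not that by auto
    then have "e r = 0" using e(2) r(1) by simp
    then show ?thesis using r(2) hom_zero[of e, OF e(1)] by auto
  qed
  then have "e s = 0"
    by - (rule generates_hom_eq[OF gen e(1), of "\<lambda>_. 0"]; simp)
  with e(2) s show False by simp
qed

text \<open>The elements of \<open>S\<close> involve only finitely many letters of \<open>T\<close>;
  any other element of \<open>T\<close> would have exponent sum zero on \<open>S\<close> and hence
  on the whole group. This makes the sums in \<open>Div\<close> finite for every basis.\<close>

lemma free_finite:
  assumes S: "free_generating_set (S :: 'g::group_add set)" "finite S"
    and T: "free_generating_set (T :: 'g set)"
  shows "finite T"
proof -
  define T0 where "T0 = (\<Union>s\<in>S. fst ` set (word_of T s))"
  have fin: "finite T0"
    using S(2) by (simp add: T0_def)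
  have "T \<subseteq> T0"
  proof (rule ccontr)
    assume "\<not> T \<subseteq> T0"
    then obtain t where t: "t \<in> T" "t \<notin> T0" by blast
    obtain e :: "'g \<Rightarrow> int" where e: "\<And>g h. e (g + h) = e g + e h"
        "\<And>r. r \<in> T \<Longrightarrow> e r = (if r = t then 1 else 0)"
      using free_exponent[OF T t(1)] by blast
    have e_word: "e (word_value w) = 0" if "set w \<subseteq> letters (T - {t})" for w
      using that e(2)
      by (induction w) (auto simp: e(1) letter_value_def hom_zero[of e, OF e(1)] split: if_splits)
    have "e s = 0" if "s \<in> S" for s
    proof -
      have "set (word_of T s) \<subseteq> letters (T - {t})"
        using word_of_mem[OF T, of s] t(2) that by (force simp: T0_def mem_reduced_words)
      from e_word[OF this] show ?thesis by (simp add: T)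
    qed
    then have "e t = 0"
      by - (rule generates_hom_eq[OF free_generates[OF S(1)] e(1), of "\<lambda>_. 0"]; simp)
    with e(2) t(1) show False by simp
  qed
  with fin show ?thesis by (rule rev_finite_subset)
qed

section \<open>Nielsen's theorem\<close>

fun common_prefix :: "'a list \<Rightarrow> 'a list \<Rightarrow> nat" where
  "common_prefix (x # xs) (y # ys) = (if x = y then Suc (common_prefix xs ys) else 0)"
| "common_prefix _ _ = 0"

lemma le_common_prefix_iff:
  "k \<le> common_prefix xs ys \<longleftrightarrow> k \<le> length xs \<and> k \<le> length ys \<and> take k xs = take k ys"
proof (induction xs ys arbitrary: k rule: common_prefix.induct)
  case (1 x xs y ys)
  then show ?case by (cases k) auto
qed auto

lemma common_prefix_le: "common_prefix xs ys \<le> length xs" "common_prefix xs ys \<le> length ys"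
  and take_common_prefix: "take (common_prefix xs ys) xs = take (common_prefix xs ys) ys"
  using le_common_prefix_iff[of "common_prefix xs ys" xs ys] by simp_all

lemma common_prefix_commute: "common_prefix xs ys = common_prefix ys xs"
  by (induction xs ys rule: common_prefix.induct) auto

lemma common_prefix_hd_drop:
  "drop (common_prefix xs ys) xs \<noteq> [] \<Longrightarrow> drop (common_prefix xs ys) ys \<noteq> [] \<Longrightarrow>
    hd (drop (common_prefix xs ys) xs) \<noteq> hd (drop (common_prefix xs ys) ys)"
  by (induction xs ys rule: common_prefix.induct) auto

text \<open>Agreement on the first \<open>k\<close> entries is transitive.\<close>

lemma common_prefix_ultrametric:
  "min (common_prefix xs ys) (common_prefix ys zs) \<le> common_prefix xs zs"
proof -
  let ?k = "min (common_prefix xs ys) (common_prefix ys zs)"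
  have "?k \<le> common_prefix xs ys" "?k \<le> common_prefix ys zs" by auto
  then show ?thesis by (simp only: le_common_prefix_iff)
qed

text \<open>\<open>zs\<close> leaves \<open>xs\<close> while \<open>xs\<close> and \<open>ys\<close>
  still agree, so it leaves both at the same place.\<close>

lemma common_prefix_isosceles:
  "common_prefix xs zs < common_prefix xs ys \<Longrightarrow> common_prefix ys zs = common_prefix xs zs"
  using common_prefix_ultrametric[of xs ys zs] common_prefix_ultrametric[of ys xs zs]
  by (simp add: common_prefix_commute[of ys xs] min_def split: if_splits)

text \<open>The common prefix cancels and nothing beyond it does: if both remaining words are
  nonempty, they begin with different letters.\<close>

lemma word_of_minus_add:
  fixes S :: "'g::group_add set"
  assumes free: "free_generating_set S"
  defines "k \<equiv> \<lambda>g h. common_prefix (word_of S g) (word_of S h)"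
  shows "word_of S (- g + h) = word_inv (drop (k g h) (word_of S g)) @ drop (k g h) (word_of S h)"
proof (rule word_of_eqI[OF free])
  let ?g = "word_of S g" and ?h = "word_of S h"
  let ?v = "drop (k g h) ?g" and ?w = "drop (k g h) ?h"
  have red: "?v \<in> reduced_words S" "?w \<in> reduced_words S"
    by (simp_all add: drop_reduced word_of_mem free)
  have "?v = [] \<or> ?w = [] \<or> hd ?w \<noteq> letter_inv (letter_inv (hd ?v))"
    using common_prefix_hd_drop[of ?g ?h] by (auto simp: k_def)
  moreover have "word_inv ?v \<noteq> [] \<longleftrightarrow> ?v \<noteq> []" and
    "?v \<noteq> [] \<Longrightarrow> last (word_inv ?v) = letter_inv (hd ?v)"
    by (auto simp: word_inv_def last_rev hd_map)
  ultimately show "word_inv ?v @ ?w \<in> reduced_words S"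
    using red word_inv_reduced[OF red(1)] unfolding mem_reduced_words successively_append_iff
    by auto
  have p: "take (k g h) ?g = take (k g h) ?h"
    unfolding k_def by (rule take_common_prefix)
  have "g = word_value (take (k g h) ?g @ ?v)" "h = word_value (take (k g h) ?h @ ?w)"
    by (simp_all only: append_take_drop_id word_value_word_of[OF free])
  then have "g = word_value (take (k g h) ?g) + word_value ?v"
      "h = word_value (take (k g h) ?g) + word_value ?w"
    by (simp_all only: word_value_append p)
  then have "- g + h = - word_value ?v + (- word_value (take (k g h) ?g) + word_value (take (k g h) ?g)) + word_value ?w"
    by (metis add.assoc minus_add)
  then show "word_value (word_inv ?v @ ?w) = - g + h"
    by simp
qed

section \<open>Length and cancellation relative to a basis\<close>

locale free_basis =
  fixes S :: "'g::group_add set"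
  assumes free: "free_generating_set S"
begin

definition len :: "'g \<Rightarrow> nat" where
  "len g = length (word_of S g)"

text \<open>The letters cancelled at the end of \<open>g\<close> are, inverted, the initial letters
  of \<open>- g\<close>. Counting them by a common prefix makes the ultrametric inequality
  applicable.\<close>

definition cancel :: "'g \<Rightarrow> 'g \<Rightarrow> nat" where
  "cancel g h = common_prefix (word_of S (- g)) (word_of S h)"

lemma len_uminus [simp]: "len (- g) = len g"
  by (simp add: len_def word_of_uminus free)

lemma len_eq_0_iff: "len g = 0 \<longleftrightarrow> g = 0"
  by (metis free len_def length_0_conv word_of_0 word_value_Nil word_value_word_of)

lemma len_add: "len (g + h) + 2 * cancel g h = len g + len h"
  using word_of_minus_add[OF free, of "- g" h]
    common_prefix_le[of "word_of S (- g)" "word_of S h"]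
  by (simp add: len_def cancel_def) (simp add: word_of_uminus free)

lemma cancel_uminus: "cancel (- h) (- g) = cancel g h"
  by (simp add: cancel_def common_prefix_commute)

text \<open>If half of \<open>g\<close> cancelled, \<open>g\<close> and its inverse would agree on
  their first halves. At the middle of the word this makes a letter its own inverse, or two adjacent
  letters inverse to each other.\<close>

lemma cancel_self:
  assumes "g \<noteq> 0"
  shows "2 * cancel g g < len g"
proof (rule ccontr)
  let ?w = "word_of S g" and ?l = "len g"
  \<comment> \<open>For odd length, position \<open>i\<close> is its own mirror image; for even
    length, its mirror image is \<open>Suc i\<close>.\<close>
  define i where "i = (?l - 1) div 2"
  assume "\<not> 2 * cancel g g < ?l"
  moreover have l: "?l > 0"
    using assms len_eq_0_iff by blast
  ultimately have "Suc i \<le> cancel g g"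
    unfolding i_def by linarith
  then have "take (Suc i) (word_inv ?w) = take (Suc i) ?w"
    by (simp add: cancel_def le_common_prefix_iff word_of_uminus free del: take_Suc)
  then have "word_inv ?w ! i = ?w ! i"
    by (metis lessI nth_take)
  moreover have il: "i < ?l" using l by (simp add: i_def)
  ultimately have eq: "?w ! i = letter_inv (?w ! (?l - Suc i))"
    by (simp add: word_inv_def rev_nth len_def)
  have "?l - Suc i = i \<or> ?l - Suc i = Suc i"
    using l unfolding i_def by linarith
  then show False
  proof
    assume "?l - Suc i = i"
    with eq show False by simp
  next
    assume *: "?l - Suc i = Suc i"
    with il have "Suc i < length ?w" unfolding len_def by linarith
    then have "?w ! Suc i \<noteq> letter_inv (?w ! i)"
      using word_of_mem[OF free, of g] by (auto simp: mem_reduced_words successively_conv_nth)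
    with eq * show False by simp
  qed
qed

text \<open>Nielsen's two conditions, expressed by cancellation. The first is equivalent to
  \<open>u + v\<close> being no shorter than either factor; the second lets some letter of
  \<open>v\<close> survive between any two admissible neighbours.\<close>

definition nielsen_reduced :: "'g set \<Rightarrow> bool" where
  "nielsen_reduced T \<longleftrightarrow>
     (\<forall>u v. u \<in> letter_value ` letters T \<longrightarrow> v \<in> letter_value ` letters T \<longrightarrow> v \<noteq> - u \<longrightarrow>
        2 * cancel u v \<le> len u \<and> 2 * cancel u v \<le> len v) \<and>
     (\<forall>u v w. u \<in> letter_value ` letters T \<longrightarrow> v \<in> letter_value ` letters T \<longrightarrow>
        w \<in> letter_value ` letters T \<longrightarrow> v \<noteq> - u \<longrightarrow> w \<noteq> - v \<longrightarrow>
        cancel u v + cancel v w < len v)"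

text \<open>The first conjunct carries the induction: more of the first factor survives as a prefix
  of the product than any admissible left neighbour can cancel. Hence a further factor cancels
  against the product exactly as it does against the first factor alone, and the length estimates
  follow.\<close>

lemma nielsen_reduced_product:
  assumes T: "free_generating_set T" "nielsen_reduced T"
    and "l # w \<in> reduced_words T"
  shows "(\<forall>u \<in> letter_value ` letters T. letter_value l \<noteq> - u \<longrightarrow>
      cancel u (letter_value l) < common_prefix (word_of S (letter_value l)) (word_of S (word_value (l # w))))
    \<and> len (letter_value l) \<le> len (word_value (l # w))
    \<and> (w \<noteq> [] \<longrightarrow> 2 \<le> len (word_value (l # w)))"
  using assms(3)
proof (induction w arbitrary: l)
  have pos: "0 < len (letter_value l)" if "l \<in> letters T" for l
    using that free_not_0[OF T(1)] len_eq_0_iff by (force simp: letter_value_def)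
  {
    case Nil
    then have l: "l \<in> letters T" by (simp add: mem_reduced_words)
    have "common_prefix xs xs = length xs" for xs :: "('g \<times> bool) list"
      by (induction xs) auto
    moreover have "cancel u (letter_value l) < len (letter_value l)"
      if "u \<in> letter_value ` letters T" "letter_value l \<noteq> - u" for u
    proof -
      have "letter_value l \<in> letter_value ` letters T" using l by blast
      with T(2) that have "2 * cancel u (letter_value l) \<le> len (letter_value l)"
        unfolding nielsen_reduced_def by blast
      with pos[OF l] show ?thesis by linarith
    qed
    ultimately show ?case by (simp add: len_def)
  next
    case (Cons m w)
    let ?u = "letter_value l" and ?v = "letter_value m" and ?q = "word_value (m # w)"
    let ?p = "?u + ?q"
    from Cons.prems have red: "m # w \<in> reduced_words T" and l: "l \<in> letters T" "m \<in> letters T"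
      and ml: "m \<noteq> letter_inv l"
      by (auto simp: mem_reduced_words)
    have uv: "?u \<in> letter_value ` letters T" "?v \<in> letter_value ` letters T"
      using l by blast+
    have "?v \<noteq> - ?u"
      using ml l letter_value_inj[OF T(1), of m "letter_inv l"] by auto
    note IH = Cons.IH[OF red]
    have "cancel ?u ?v < common_prefix (word_of S ?v) (word_of S ?q)"
      using IH uv \<open>?v \<noteq> - ?u\<close> by blast
    then have "common_prefix (word_of S ?v) (word_of S (- ?u)) < common_prefix (word_of S ?v) (word_of S ?q)"
      by (simp add: cancel_def common_prefix_commute)
    \<comment> \<open>The inverse of the new factor branches off from \<open>?v\<close> before
      \<open>?q\<close> does, so it branches off from \<open>?q\<close> at the same place.\<close>
    from common_prefix_isosceles[OF this] have k: "cancel ?u ?q = cancel ?u ?v"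
      by (simp add: cancel_def common_prefix_commute)
    have n1: "2 * cancel ?u ?v \<le> len ?u" "2 * cancel ?u ?v \<le> len ?v"
      using T(2) uv \<open>?v \<noteq> - ?u\<close> unfolding nielsen_reduced_def by blast+
    have len_p: "len ?p + 2 * cancel ?u ?v = len ?u + len ?q"
      using len_add[of ?u ?q] unfolding k .
    \<comment> \<open>\<open>cancel (- ?u) ?p\<close> is the common prefix of \<open>?u\<close> and
      \<open>?p\<close>. It is computed by cancelling \<open>?u\<close> from \<open>?p\<close>
      again, which returns \<open>?q\<close>.\<close>
    have "len (- ?u + ?p) + 2 * cancel (- ?u) ?p = len ?u + len ?p"
      using len_add[of "- ?u" ?p] by simp
    moreover have "- ?u + ?p = ?q" by (simp flip: add.assoc)
    ultimately have "len ?q + 2 * cancel (- ?u) ?p = len ?u + len ?p"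
      by simp
    with len_p have cp: "cancel (- ?u) ?p + cancel ?u ?v = len ?u"
      by linarith
    have "cancel t ?u < common_prefix (word_of S ?u) (word_of S ?p)"
      if t: "t \<in> letter_value ` letters T" "?u \<noteq> - t" for t
    proof -
      have "cancel t ?u + cancel ?u ?v < len ?u"
        using T(2) uv t \<open>?v \<noteq> - ?u\<close> unfolding nielsen_reduced_def by blast
      with cp have "cancel t ?u < cancel (- ?u) ?p" by linarith
      then show ?thesis by (simp add: cancel_def)
    qed
    moreover have "len ?u \<le> len ?p"
      using len_p n1 IH by linarith
    \<comment> \<open>Without cancellation both factors contribute a letter. Otherwise
      \<open>?p\<close> is at least as long as \<open>?u\<close>, whose length is at least twice the
      positive amount cancelled.\<close>
    moreover have "2 \<le> len ?p"
      using len_p n1 IH pos[OF l(1)] pos[OF l(2)]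
      by (cases "cancel ?u ?v") simp_all
    ultimately show ?case by simp
  }
qed

text \<open>An element of \<open>S\<close> has length one, whereas a reduced product of two or more
  letters of \<open>T\<close> has length at least two.\<close>

lemma nielsen_reduced_contains:
  assumes T: "free_generating_set T" "nielsen_reduced T" and s: "s \<in> S"
  shows "\<exists>t\<in>T. s = t \<or> s = - t"
proof -
  have "len s = 1"
    using word_of_letter[OF free, of "(s, True)"] s by (simp add: len_def)
  have red: "word_of T s \<in> reduced_words T" and val: "word_value (word_of T s) = s"
    using T by (simp_all add: word_of_mem)
  consider "word_of T s = []" | l where "word_of T s = [l]" | l m w where "word_of T s = l # m # w"
    by (metis list.exhaust)
  then show ?thesis
  proof cases
    case 1
    with val \<open>len s = 1\<close> show ?thesis using len_eq_0_iff[of s] by auto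
  next
    case (2 l)
    with val red show ?thesis
      by (cases l) (force simp: mem_reduced_words letter_value_def split: if_splits)
  next
    case (3 l m w)
    then have "2 \<le> len s"
      using nielsen_reduced_product[OF T, of l "m # w"] red val by (simp del: word_value_Cons)
    with \<open>len s = 1\<close> show ?thesis by simp
  qed
qed

end

text \<open>The label is the class by which the divergence changes, see \<open>Div_nielsen_path\<close> below.\<close>

inductive nielsen_path :: "'g::group_add set \<Rightarrow> 'g set \<Rightarrow> 'g H1 \<Rightarrow> bool" where
  refl: "nielsen_path S S 0"
| inv: "free_generating_set (insert x B) \<Longrightarrow> x \<notin> B \<Longrightarrow>
    nielsen_path (insert x B) (insert (- x) B) (H1_class (- x))"
| mult: "free_generating_set (insert x B) \<Longrightarrow> x \<notin> B \<Longrightarrow> y \<in> B \<Longrightarrow>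
    nielsen_path (insert x B) (insert (x + y) B) 0"
| sym: "nielsen_path S T h \<Longrightarrow> nielsen_path T S (- h)"
| trans: "nielsen_path S T h \<Longrightarrow> nielsen_path T U k \<Longrightarrow> nielsen_path S U (h + k)"

definition nielsen_equiv :: "'g::group_add set \<Rightarrow> 'g set \<Rightarrow> bool" where
  "nielsen_equiv S T \<longleftrightarrow> (\<exists>h. nielsen_path S T h)"

lemma nielsen_equiv_refl: "nielsen_equiv S S"
  and nielsen_equiv_sym: "nielsen_equiv S T \<Longrightarrow> nielsen_equiv T S"
  and nielsen_equiv_trans: "nielsen_equiv S T \<Longrightarrow> nielsen_equiv T U \<Longrightarrow> nielsen_equiv S U"
  unfolding nielsen_equiv_def by (blast intro: nielsen_path.intros)+

lemma nielsen_equiv_uminus: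
  "free_generating_set (insert x B) \<Longrightarrow> x \<notin> B \<Longrightarrow> nielsen_equiv (insert x B) (insert (- x) B)"
  unfolding nielsen_equiv_def by (blast intro: nielsen_path.intros)

lemma nielsen_equiv_add:
  assumes free: "free_generating_set (insert x B)" and x: "x \<notin> B"
    and l: "l \<in> letters B"
  shows "nielsen_equiv (insert x B) (insert (x + letter_value l) B)"
    and "free_generating_set (insert (x + letter_value l) B)" and "x + letter_value l \<notin> B"
proof -
  obtain y where y: "y \<in> B" and l': "letter_value l = y \<or> letter_value l = - y"
    using l by (auto simp: letter_value_def)
  define C where "C = B - {y}"
  have C: "insert y C = B" "y \<notin> C" using y by (auto simp: C_def)
  have sub: "free_generating_set (insert (x + - y) B) \<and> x + - y \<notin> B"
    by (intro conjI; rule free_replace[OF free x, of "x + - y" "x + y"])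
      (simp_all add: y hom_zero add.assoc del: add_uminus_conv_diff)
  \<comment> \<open>Multiplying by the inverse of \<open>y\<close> is a move read backwards,
    starting from \<open>x + - y\<close>.\<close>
  have "nielsen_equiv (insert (x + - y) B) (insert (x + - y + y) B)"
    unfolding nielsen_equiv_def using sub y nielsen_path.mult by blast
  then have "nielsen_equiv (insert x B) (insert (x + - y) B)"
    by (simp add: add.assoc nielsen_equiv_sym)
  moreover have "nielsen_equiv (insert x B) (insert (x + y) B)"
    unfolding nielsen_equiv_def using free x y nielsen_path.mult by blast
  ultimately show "nielsen_equiv (insert x B) (insert (x + letter_value l) B)"
    "free_generating_set (insert (x + letter_value l) B)" "x + letter_value l \<notin> B"
    using l' sub free_replace_add[OF free x y] by auto
qed

text \<open>Left multiplication is right multiplication conjugated by inversion.\<close>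

lemma nielsen_equiv_replace:
  assumes free: "free_generating_set (insert x B)" and x: "x \<notin> B"
    and l: "l \<in> letters B" and w: "w = x \<or> w = - x"
  shows "nielsen_equiv (insert x B) (insert (letter_value l + w) B)"
    and "free_generating_set (insert (letter_value l + w) B)" and "letter_value l + w \<notin> B"
proof -
  have w1: "nielsen_equiv (insert x B) (insert (- w) B)" "free_generating_set (insert (- w) B)"
    "- w \<notin> B"
    using w nielsen_equiv_uminus[OF free x] free_replace_uminus[OF free x] free x nielsen_equiv_refl
    by auto
  have l': "letter_inv l \<in> letters B" using l by simp
  note w2 = nielsen_equiv_add[OF w1(2,3) l']
  note w3 = nielsen_equiv_uminus[OF w2(2,3)] free_replace_uminus[OF w2(2,3)]
  have "- (- w + letter_value (letter_inv l)) = letter_value l + w"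
    by (simp add: minus_add)
  then show "nielsen_equiv (insert x B) (insert (letter_value l + w) B)"
    and "free_generating_set (insert (letter_value l + w) B)" and "letter_value l + w \<notin> B"
    using w1 w2 w3 nielsen_equiv_trans by metis+
qed

text \<open>Reads a word as a number in base \<open>b\<close> with digits \<open>f x\<close>. For
  digits below \<open>b\<close> this encodes the lexicographic order on words of equal length in
  natural numbers, which can then be added over a basis.\<close>

primrec horner :: "('a \<Rightarrow> nat) \<Rightarrow> nat \<Rightarrow> 'a list \<Rightarrow> nat" where
  "horner f b [] = 0"
| "horner f b (x # xs) = f x * b ^ length xs + horner f b xs"

lemma horner_less: "(\<And>x. x \<in> set xs \<Longrightarrow> f x < b) \<Longrightarrow> horner f b xs < b ^ length xs"
proof (induction xs)
  case (Cons x xs)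
  then have "Suc (f x) \<le> b" and less: "horner f b xs < b ^ length xs" by (auto simp: Suc_le_eq)
  then have "Suc (f x) * b ^ length xs \<le> b * b ^ length xs" by (intro mult_right_mono) auto
  with less show ?case by simp
qed simp

lemma horner_append: "horner f b (xs @ ys) = horner f b xs * b ^ length ys + horner f b ys"
  by (induction xs) (simp_all add: algebra_simps power_add)

lemma horner_append_less:
  assumes "horner f b xs < horner f b ys" "\<And>x. x \<in> set zs \<Longrightarrow> f x < b"
  shows "horner f b (xs @ zs) < horner f b (ys @ zs)"
proof -
  have "b ^ length zs > 0"
    using horner_less[of zs f b] assms(2) by (metis gr_zeroI less_nat_zero_code)
  with assms(1) show ?thesis by (simp add: horner_append)
qed

text \<open>The quotient by \<open>b ^ length xs\<close> recovers the leading digit.\<close>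

lemma horner_inj:
  "length xs = length ys \<Longrightarrow> (\<And>x. x \<in> set xs \<union> set ys \<Longrightarrow> f x < b) \<Longrightarrow>
    inj_on f (set xs \<union> set ys) \<Longrightarrow> horner f b xs = horner f b ys \<Longrightarrow> xs = ys"
proof (induction xs ys rule: list_induct2)
  case (Cons x xs y ys)
  have less: "horner f b xs < b ^ length xs" "horner f b ys < b ^ length xs"
    using Cons.prems(1) Cons.hyps by (auto intro!: horner_less[THEN order_less_le_trans])
  have eq: "f x * b ^ length xs + horner f b xs = f y * b ^ length xs + horner f b ys"
    using Cons.prems(3) Cons.hyps by simp
  then have "(horner f b xs + f x * b ^ length xs) div b ^ length xs =
      (horner f b ys + f y * b ^ length xs) div b ^ length xs"
    by (simp add: add.commute)
  moreover have nz: "b ^ length xs \<noteq> 0" using less by linarith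
  ultimately have "f x = f y"
    using less unfolding div_mult_self1[OF nz] by (simp only: div_less add_0_right)
  with eq have "horner f b xs = horner f b ys" by (metis add_left_cancel)
  moreover have "x = y" by (rule inj_onD[OF Cons.prems(2) \<open>f x = f y\<close>]) simp_all
  moreover have "inj_on f (set xs \<union> set ys)"
    using Cons.prems(2) by (rule inj_on_subset) auto
  ultimately show ?case using Cons by auto
qed simp

section \<open>Descent to Nielsen reduced bases\<close>

locale enumerated_free_basis = free_basis S for S :: "'g::group_add set" +
  fixes idx :: "'g \<times> bool \<Rightarrow> nat" and b :: nat
  assumes idx_less: "l \<in> letters S \<Longrightarrow> idx l < b" and idx_inj: "inj_on idx (letters S)"
begin

text \<open>
  The length does not decide which neighbour of \<open>v\<close> to replace when exactly half of \<open>v\<close> cancels on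
  both sides. The tie is broken by the lexicographic rank of first halves: such a replacement
  exchanges an initial segment of one element and leaves the first half of its inverse unchanged.
\<close>

definition half_rank :: "'g \<Rightarrow> nat" where
  "half_rank g = horner idx b (take (len g div 2) (word_of S g))"

text \<open>Symmetrised in \<open>g\<close> and \<open>- g\<close> because the descent determines
  the element to be replaced only up to inversion.\<close>

definition rank :: "'g \<Rightarrow> nat" where
  "rank g = half_rank g + half_rank (- g)"

lemma rank_uminus [simp]: "rank (- g) = rank g"
  by (simp add: rank_def)

definition descends :: "'g \<Rightarrow> 'g \<Rightarrow> bool" where
  "descends v w \<longleftrightarrow> len (v + w) < len w \<or> len (v + w) = len w \<and> rank (v + w) < rank w"

lemma word_of_letters: "set (word_of S g) \<subseteq> letters S"
  using word_of_mem[OF free, of g] by (simp add: mem_reduced_words)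

text \<open>Let \<open>P\<close> and \<open>Q\<close> be the first halves of \<open>v\<close> and
  \<open>- v\<close>. Then \<open>v\<close> is \<open>P\<close> followed by the inverse of
  \<open>Q\<close>, \<open>w\<close> is \<open>Q\<close> followed by some \<open>R\<close>, and
  \<open>v + w\<close> is \<open>P\<close> followed by \<open>R\<close>. As \<open>Q\<close> lies
  within the first half of \<open>w\<close>, the first half of \<open>- w\<close> involves only
  \<open>R\<close>; so the half rank of \<open>w\<close> drops and that of \<open>- w\<close> is
  unchanged.\<close>

lemma descends_half:
  assumes v: "len v = 2 * k" "cancel v w = k" and w: "2 * k \<le> len w"
    and less: "horner idx b (take k (word_of S v)) < horner idx b (take k (word_of S (- v)))"
  shows "descends v w"
proof -
  let ?P = "take k (word_of S v)" and ?Q = "take k (word_of S (- v))"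
  define R where "R = drop k (word_of S w)"
  let ?h = "len w div 2"
  have kh: "k \<le> ?h" "?h \<le> len w - k" using w by auto
  have R: "length R = len w - k" "set R \<subseteq> letters S"
    using set_drop_subset[of k "word_of S w"] word_of_letters[of w] by (auto simp: R_def len_def)
  have "word_of S (- v) = word_inv (drop k (word_of S v)) @ word_inv ?P"
    by (simp add: word_of_uminus free flip: word_inv_append)
  moreover have "length (word_inv (drop k (word_of S v))) = k"
    using v(1) by (simp add: len_def)
  ultimately have "word_inv (drop k (word_of S (- v))) = ?P"
    by simp
  then have vw: "word_of S (v + w) = ?P @ R"
    using word_of_minus_add[OF free, of "- v" w] v(2) by (simp add: R_def cancel_def)
  have "?Q = take k (word_of S w)"
    using take_common_prefix[of "word_of S (- v)" "word_of S w"] v(2) by (simp add: cancel_def)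
  then have w': "word_of S w = ?Q @ R"
    by (simp add: R_def)
  have len_vw: "len (v + w) = len w"
    using len_add[of v w] v by simp
  have len_PQ: "length ?P = k" "length ?Q = k"
    using v(1) len_uminus[of v] by (simp_all add: len_def)
  have "take ?h (word_of S (v + w)) = ?P @ take (?h - k) R"
    "take ?h (word_of S w) = ?Q @ take (?h - k) R"
    using kh len_PQ by (simp_all add: vw w')
  then have "half_rank (v + w) < half_rank w"
    unfolding half_rank_def len_vw
    using horner_append_less[OF less, of "take (?h - k) R"] R(2) set_take_subset[of "?h - k" R]
    by (auto intro!: idx_less)
  moreover have "take ?h (word_of S (- (v + w))) = take ?h (word_inv R)"
    "take ?h (word_of S (- w)) = take ?h (word_inv R)"
    using kh R(1) unfolding word_of_uminus[OF free] vw w' by simp_all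
  then have "half_rank (- (v + w)) = half_rank (- w)"
    unfolding half_rank_def len_uminus len_vw by simp
  ultimately show ?thesis
    by (simp add: descends_def rank_def len_vw)
qed

text \<open>If the first condition fails, \<open>u + v\<close> is shorter than one of its factors.
  If only the second fails, exactly half of \<open>v\<close> cancels on each side, and the order of
  its two halves decides whether \<open>w\<close> or \<open>- u\<close> descends.\<close>

lemma not_nielsen_reduced_descends:
  assumes T: "free_generating_set T" and not: "\<not> nielsen_reduced T"
  obtains v w where "v \<in> letter_value ` letters T" "w \<in> letter_value ` letters T"
    "w \<noteq> v" "w \<noteq> - v" "descends v w"
proof -
  let ?L = "letter_value ` letters T"
  have minus: "- u \<in> ?L" if "u \<in> ?L" for u
  proof -
    from that obtain l where l: "l \<in> letters T" "u = letter_value l" by blast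
    show ?thesis
      by (rule image_eqI[of _ _ "letter_inv l"]) (simp_all only: l letter_inv_simps letter_value_inv)
  qed
  have nz: "u \<noteq> 0" if "u \<in> ?L" for u
    using that free_not_0[OF T] by (auto simp: letter_value_def split: if_splits)
  show thesis
  proof (cases "\<exists>u\<in>?L. \<exists>v\<in>?L. v \<noteq> - u \<and> (len u < 2 * cancel u v \<or> len v < 2 * cancel u v)")
    case True
    then obtain u v where uv: "u \<in> ?L" "v \<in> ?L" "v \<noteq> - u"
      and c: "len u < 2 * cancel u v \<or> len v < 2 * cancel u v" by blast
    have "v \<noteq> u" using c cancel_self[OF nz[OF uv(1)]] by auto
    from c show thesis
    proof
      assume "len u < 2 * cancel u v"
      then have "descends u v" using len_add[of u v] by (simp add: descends_def)
      with uv \<open>v \<noteq> u\<close> show thesis by (intro that)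
    next
      \<comment> \<open>Now \<open>u + v\<close> is shorter than \<open>u\<close>. Passing to
        inverses turns the right multiplication of \<open>u\<close> into a left multiplication of
        \<open>- u\<close>.\<close>
      assume "len v < 2 * cancel u v"
      then have "descends (- v) (- u)"
        using len_add[of u v] len_uminus[of "u + v"] by (simp add: descends_def minus_add)
      moreover have "- u \<noteq> - v" "- u \<noteq> - (- v)" using uv(3) \<open>v \<noteq> u\<close> by auto
      ultimately show thesis using uv minus by (intro that)
    qed
  next
    case False
    then have n1: "2 * cancel u v \<le> len u \<and> 2 * cancel u v \<le> len v"
      if "u \<in> ?L" "v \<in> ?L" "v \<noteq> - u" for u v
      using that by (meson not_le)
    with not obtain u v w where uvw: "u \<in> ?L" "v \<in> ?L" "w \<in> ?L" "v \<noteq> - u" "w \<noteq> - v"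
      and c: "\<not> cancel u v + cancel v w < len v"
      unfolding nielsen_reduced_def by blast
    define k where "k = cancel u v"
    \<comment> \<open>Each of the two cancellations is at most half of \<open>v\<close>, and
      together they are at least all of it.\<close>
    have k: "2 * k = len v" "cancel v w = k" "2 * k \<le> len u" "2 * k \<le> len w"
      using n1[OF uvw(1,2,4)] n1[OF uvw(2,3,5)] c unfolding k_def by linarith+
    have uv: "u \<noteq> v" "w \<noteq> v"
      using cancel_self[OF nz[OF uvw(2)]] k by (auto simp: k_def)
    let ?P = "take k (word_of S v)" and ?Q = "take k (word_of S (- v))"
    \<comment> \<open>Equal halves would make \<open>v\<close> a word followed by its inverse, hence
      zero.\<close>
    have "?P \<noteq> ?Q"
    proof
      assume PQ: "?P = ?Q"
      have "length (word_inv (drop k (word_of S v))) = k"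
        using k(1) by (simp add: len_def)
      moreover have "word_of S (- v) = word_inv (drop k (word_of S v)) @ word_inv ?P"
        by (simp add: word_of_uminus free flip: word_inv_append)
      ultimately have "?Q = word_inv (drop k (word_of S v))" by simp
      with PQ have "word_value ?P = - word_value (drop k (word_of S v))"
        by (metis word_value_inv)
      then have "word_value (?P @ drop k (word_of S v)) = 0"
        unfolding word_value_append by simp
      then show False using nz[OF uvw(2)] by (simp add: free)
    qed
    moreover have "length ?P = length ?Q"
      using len_uminus[of v] by (simp add: len_def)
    moreover have sub: "set ?P \<union> set ?Q \<subseteq> letters S"
      using set_take_subset[of k "word_of S v"] set_take_subset[of k "word_of S (- v)"]
        word_of_letters by blast
    ultimately have "horner idx b ?P \<noteq> horner idx b ?Q"
      using horner_inj[of ?P ?Q idx b] inj_on_subset[OF idx_inj sub] idx_less by blast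
    then consider "horner idx b ?P < horner idx b ?Q" | "horner idx b ?Q < horner idx b ?P"
      by linarith
    then show thesis
    proof cases
      case 1
      then have "descends v w" using k by (intro descends_half[of v k]) auto
      with uvw uv show thesis by (intro that)
    next
      case 2
      then have "descends (- v) (- u)"
        using k by (intro descends_half[of "- v" k]) (auto simp: k_def cancel_uminus)
      moreover have "- u \<noteq> - v" "- u \<noteq> - (- v)" using uvw(4) uv by auto
      ultimately show thesis using uvw minus by (intro that)
    qed
  qed
qed

lemma nielsen_equiv_descent:
  assumes T: "free_generating_set T" "finite T" and not: "\<not> nielsen_reduced T"
  obtains T' where "nielsen_equiv T T'" "free_generating_set T'" "finite T'"
    "((sum len T', sum rank T'), (sum len T, sum rank T)) \<in> less_than <*lex*> less_than"
proof -
  obtain v w where vw: "v \<in> letter_value ` letters T" "w \<in> letter_value ` letters T"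
      "w \<noteq> v" "w \<noteq> - v" "descends v w"
    using not_nielsen_reduced_descends[OF T(1) not] by blast
  obtain l where l: "l \<in> letters T" "v = letter_value l" using vw(1) by blast
  obtain x where x: "x \<in> T" "w = x \<or> w = - x"
    using vw(2) by (auto simp: letter_value_def split: if_splits)
  define B where "B = T - {x}"
  have B: "T = insert x B" "x \<notin> B" "finite B" using x(1) T(2) by (auto simp: B_def)
  \<comment> \<open>The element that multiplies must belong to the part of the basis that stays;
    this is why \<open>w\<close> was required to differ from \<open>v\<close> and
    \<open>- v\<close>.\<close>
  have "fst l \<noteq> x" using vw(3,4) l x(2) by (auto simp: letter_value_def split: if_splits)
  then have lB: "l \<in> letters B" using l(1) by (auto simp: B_def)
  note r = nielsen_equiv_replace[OF T(1)[unfolded B(1)] B(2) lB x(2)]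
  have "len w = len x" "rank w = rank x" using x(2) by auto
  then have "((sum len (insert (v + w) B), sum rank (insert (v + w) B)), (sum len T, sum rank T))
      \<in> less_than <*lex*> less_than"
    using vw(5) r(3) B by (auto simp: l(2) descends_def)
  with r B show thesis by (intro that[of "insert (v + w) B"]) (simp_all add: l(2))
qed

end

text \<open>Each inversion move brings one more element of \<open>T\<close> into \<open>S\<close>.
  Once \<open>T\<close> is contained in \<open>S\<close>, equality follows because \<open>T\<close>
  generates and \<open>S\<close> contains no element together with its inverse.\<close>

lemma nielsen_equiv_signs:
  assumes "finite T" "free_generating_set T" and S: "free_generating_set S"
    and "\<And>t. t \<in> T \<Longrightarrow> t \<in> S \<or> - t \<in> S"
  shows "nielsen_equiv T S"
  using assms(1,2,4)
proof (induction "card (T - S)" arbitrary: T rule: less_induct)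
  case (less T)
  show ?case
  proof (cases "T \<subseteq> S")
    case True
    have "S \<subseteq> T"
      using free_mem_of_generates[OF S _ free_generates[OF less.prems(2)]] True
        free_uminus_notin[OF S] by (metis subset_iff)
    with True show ?thesis by (simp add: nielsen_equiv_refl)
  next
    case False
    then obtain x where x: "x \<in> T" "x \<notin> S" by blast
    define B where "B = T - {x}"
    have B: "T = insert x B" "x \<notin> B" using x(1) by (auto simp: B_def)
    let ?T = "insert (- x) B"
    have mx: "- x \<in> S" using less.prems(3) x by blast
    then have "?T - S \<subset> T - S" using x B by auto
    then have "card (?T - S) < card (T - S)" using less.prems(1) by (intro psubset_card_mono) auto
    moreover have "free_generating_set ?T"
      using free_replace_uminus[of x B] less.prems(2) B by simp
    ultimately have "nielsen_equiv ?T S"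
      using less.prems(1,3) mx B by (intro less.hyps) auto
    moreover have "nielsen_equiv T ?T"
      using nielsen_equiv_uminus[of x B] less.prems(2) B by simp
    ultimately show ?thesis by (rule nielsen_equiv_trans[rotated])
  qed
qed

text \<open>Descent on total length, then total rank, ends at a Nielsen reduced basis. Such a basis
  contains \<open>S\<close> up to signs and, as \<open>S\<close> generates, nothing else.\<close>

theorem nielsen_equiv:
  fixes S T :: "'g::group_add set"
  assumes S: "free_generating_set S" "finite S" and T: "free_generating_set T" "finite T"
  shows "nielsen_equiv T S"
proof -
  have "finite (letters S)" using S(2) by simp
  then obtain idx :: "'g \<times> bool \<Rightarrow> nat" and n where "idx ` letters S = {i. i < n}"
      "inj_on idx (letters S)"
    using finite_imp_inj_to_nat_seg by metis
  then interpret enumerated_free_basis S idx n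
    using S(1) by unfold_locales auto
  let ?m = "\<lambda>T. (sum len T, sum rank T)"
  have "wf (inv_image (less_than <*lex*> less_than) ?m)" by auto
  then show ?thesis
    using T
  proof (induction T rule: wf_induct_rule)
    case (less T)
    show ?case
    proof (cases "nielsen_reduced T")
      case False
      then obtain T' where "nielsen_equiv T T'" "free_generating_set T'" "finite T'"
          "(?m T', ?m T) \<in> less_than <*lex*> less_than"
        using nielsen_equiv_descent less.prems by metis
      then show ?thesis using less.IH[of T'] nielsen_equiv_trans by simp
    next
      case True
      have "\<exists>t\<in>T. s = t \<or> s = - t" if "s \<in> S" for s
        using nielsen_reduced_contains[OF less.prems(1) True that] .
      \<comment> \<open>Here the roles are exchanged: \<open>S\<close> generates and consists of
        elements of \<open>T\<close> up to sign.\<close>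
      then have "t \<in> S \<or> - t \<in> S" if "t \<in> T" for t
        using free_mem_of_generates[OF less.prems(1) that free_generates[OF S(1)]] by blast
      then show ?thesis
        using nielsen_equiv_signs[OF less.prems(2,1) S(1)] by blast
    qed
  qed
qed

section \<open>The abelianization and the action of automorphisms on it\<close>

lemma commutator_subgroup_hom:
  assumes "\<And>x y. F (x + y) = F x + F y" "x \<in> commutator_subgroup"
  shows "F x \<in> commutator_subgroup"
  using assms(2)
proof induction
  case (commutator x y)
  have "F (x + y - x - y) = F x + F y - F x - F y"
    by (simp add: assms(1) hom_zero[of F, OF assms(1)] diff_conv_add_uminus del: add_uminus_conv_diff)
  then show ?case by (simp add: commutator_subgroup.commutator)
qed (simp_all add: assms(1) hom_zero[of F, OF assms(1)] commutator_subgroup.intros)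

lemma H1_class_add: "H1_class (x + y) = H1_class x + H1_class y"
  by (simp add: plus_H1.abs_eq)

lemma H1_class_0: "H1_class 0 = 0"
  by (simp add: zero_H1_def)

lemma H1_class_uminus: "H1_class (- x) = - H1_class x"
  by (simp add: uminus_H1.abs_eq)

lemma H1_class_eq_iff: "H1_class x = H1_class y \<longleftrightarrow> x - y \<in> commutator_subgroup"
  using Quotient3_rel[OF Quotient3_H1, of x y] by (simp add: commutator_subgroup.zero)

lemma H1_class_rep: "H1_class (rep_H1 h) = h"
  by (rule Quotient3_abs_rep[OF Quotient3_H1])

lemma H1_map_class:
  assumes "F \<in> group_aut"
  shows "H1_map F (H1_class x) = H1_class (F x)"
proof -
  have hom: "F (x + y) = F x + F y" for x y using assms by (simp add: group_aut_def)
  have "rep_H1 (H1_class x) - x \<in> commutator_subgroup"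
    by (simp add: H1_class_rep flip: H1_class_eq_iff)
  from commutator_subgroup_hom[of F, OF hom this]
  show ?thesis
    by (simp add: H1_map_def H1_class_eq_iff hom hom_zero[of F, OF hom] diff_conv_add_uminus
        del: add_uminus_conv_diff)
qed

lemma H1_induct: "(\<And>x. P (H1_class x)) \<Longrightarrow> P h"
  by (metis H1_class_rep)

lemma H1_map_add: "F \<in> group_aut \<Longrightarrow> H1_map F (h + k) = H1_map F h + H1_map F k"
  by (induction h rule: H1_induct; induction k rule: H1_induct)
    (simp add: H1_map_class group_aut_def flip: H1_class_add)

lemma nielsen_path_image:
  assumes F: "F \<in> group_aut" and "nielsen_path S T h"
  shows "nielsen_path (F ` S) (F ` T) (H1_map F h)"
  using assms(2)
proof induction
  have hom: "F (x + y) = F x + F y" and inj: "inj F" for x y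
    using F by (auto simp: group_aut_def bij_is_inj)
  note hom0 = hom_zero[of F, OF hom]
  have free: "free_generating_set (insert (F x) (F ` B))"
    if "free_generating_set (insert x B)" for x B
    using group_aut_image_free[OF F that] by simp
  have map_0: "H1_map F 0 = 0" and map_uminus: "H1_map F (- h) = - H1_map F h" for h
    using hom_zero[of "H1_map F"] H1_map_add[OF F] by blast+
  {
    case (refl S)
    then show ?case by (simp add: map_0 nielsen_path.refl)
  next
    case (inv x B)
    then show ?case
      using nielsen_path.inv[OF free, of x B] inj
      by (simp add: H1_map_class F hom0 inj_image_mem_iff)
  next
    case (mult x B y)
    then show ?case
      using nielsen_path.mult[OF free, of x B "F y"] inj
      by (simp add: map_0 hom inj_image_mem_iff)
  next
    case (sym S T h)
    then show ?case by (simp add: map_uminus nielsen_path.sym)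
  next
    case (trans S T h U k)
    then show ?case by (simp add: H1_map_add F nielsen_path.trans)
  }
qed

section \<open>Completions\<close>

text \<open>Continuity at zero. For additive maps this is the same as continuity, by
  \<open>filt_bounded_continuous\<close> and \<open>continuous_filt_bounded\<close>.\<close>

definition filt_bounded ::
    "(nat \<Rightarrow> 'a set) \<Rightarrow> (nat \<Rightarrow> 'b set) \<Rightarrow> ('a \<Rightarrow> 'b) \<Rightarrow> bool" where
  "filt_bounded N N' f \<longleftrightarrow> (\<forall>m. \<exists>k. \<forall>x\<in>N k. f x \<in> N' m)"

lemma filt_boundedI: "(\<And>m x. x \<in> N (k m) \<Longrightarrow> f x \<in> N' m) \<Longrightarrow> filt_bounded N N' f"
  unfolding filt_bounded_def by blast

lemma filt_bounded_comp:
  "filt_bounded N' N'' g \<Longrightarrow> filt_bounded N N' f \<Longrightarrow> filt_bounded N N'' (\<lambda>x. g (f x))"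
  unfolding filt_bounded_def by metis

lemma filt_bounded_id: "filt_bounded N N (\<lambda>x. x)"
  unfolding filt_bounded_def by blast

lemma filt_bounded_add:
  assumes "filtration N" "filtration N'" "filt_bounded N N' f" "filt_bounded N N' g"
  shows "filt_bounded N N' (\<lambda>x. f x + g x)"
  unfolding filt_bounded_def
proof
  fix m
  obtain k l where "\<forall>x\<in>N k. f x \<in> N' m" "\<forall>x\<in>N l. g x \<in> N' m"
    using assms(3,4) unfolding filt_bounded_def by meson
  moreover have "N (max k l) \<subseteq> N k" "N (max k l) \<subseteq> N l"
    using filtration.antimono[OF assms(1)] by auto
  ultimately show "\<exists>k. \<forall>x\<in>N k. f x + g x \<in> N' m"
    using filtration.add_mem[OF assms(2)] by (intro exI[of _ "max k l"]) blast
qed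

lemma filt_bounded_uminus:
  "filtration N' \<Longrightarrow> filt_bounded N N' f \<Longrightarrow> filt_bounded N N' (\<lambda>x. - f x)"
  unfolding filt_bounded_def using filtration.uminus_mem by metis

lemma filt_bounded_cauchy:
  assumes "filt_bounded N N' f" "\<And>x y. f (x - y) = f x - f y" "filt_cauchy N X"
  shows "filt_cauchy N' (\<lambda>i. f (X i))"
  using assms unfolding filt_bounded_def filt_cauchy_def by metis

lemma filt_bounded_null:
  assumes "filt_bounded N N' f" "filt_null N X"
  shows "filt_null N' (\<lambda>i. f (X i))"
  using assms unfolding filt_bounded_def filt_null_def by metis

lemma (in filtration) mem_cong: "x - y \<in> N m \<Longrightarrow> x \<in> N m \<longleftrightarrow> y \<in> N m"
  using add_mem[of "x - y" m y] diff_mem[of x m "x - y"] by auto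

text \<open>The common structure of \<open>cga\<close>, \<open>cga2\<close> and \<open>cyc2\<close>,
  so that density, separation and extension by continuity are proved once.\<close>

locale completion = filtration N for N :: "nat \<Rightarrow> 'a::ab_group_add set" +
  fixes lim :: "(nat \<Rightarrow> 'a) \<Rightarrow> 'q::ab_group_add" and rep :: "'q \<Rightarrow> nat \<Rightarrow> 'a"
  assumes quotient: "Quotient3 (filt_rel N) lim rep"
    and lim_add: "filt_cauchy N X \<Longrightarrow> filt_cauchy N Y \<Longrightarrow> lim X + lim Y = lim (\<lambda>i. X i + Y i)"
begin

definition hat :: "nat \<Rightarrow> 'q set" where
  "hat m = {lim X | X. filt_cauchy N X \<and> (\<forall>i. X i \<in> N m)}"

lemma lim_eq_iff:
  "filt_cauchy N X \<Longrightarrow> filt_cauchy N Y \<Longrightarrow> lim X = lim Y \<longleftrightarrow> filt_null N (\<lambda>i. X i - Y i)"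
  using Quotient3_rel[OF quotient, of X Y]
  by (auto simp: filt_rel_def filt_rel_refl filt_null_def zero_mem)

lemma lim_eqI:
  "filt_cauchy N X \<Longrightarrow> filt_cauchy N Y \<Longrightarrow> filt_null N (\<lambda>i. X i - Y i) \<Longrightarrow> lim X = lim Y"
  using lim_eq_iff by blast

lemma cauchy_rep: "filt_cauchy N (rep x)"
  using Quotient3_rep_reflp[OF quotient, of x] by (simp add: filt_rel_refl)

lemma lim_rep: "lim (rep x) = x"
  by (rule Quotient3_abs_rep[OF quotient])

lemma lim_cases [case_names lim]:
  obtains X where "x = lim X" "filt_cauchy N X"
  using lim_rep cauchy_rep by metis

lemma rep_lim_null: "filt_cauchy N X \<Longrightarrow> filt_null N (\<lambda>i. rep (lim X) i - X i)"
  using lim_eq_iff[OF cauchy_rep] lim_rep by blast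

lemma filt_cauchy_shift: "filt_cauchy N X \<Longrightarrow> filt_cauchy N (\<lambda>i. X (i + k))"
  unfolding filt_cauchy_def by (meson trans_le_add1)

lemma lim_shift: "filt_cauchy N X \<Longrightarrow> lim (\<lambda>i. X (i + k)) = lim X"
  by (rule lim_eqI[OF filt_cauchy_shift])
    (auto simp: filt_null_def filt_cauchy_def, meson trans_le_add1)

text \<open>\<open>hat m\<close> asks for a representative that lies in \<open>N m\<close> from the
  start; dropping finitely many terms or adding a null sequence does not change the limit.\<close>

lemma lim_mem_hat_iff:
  assumes X: "filt_cauchy N X"
  shows "lim X \<in> hat m \<longleftrightarrow> (\<exists>M. \<forall>i\<ge>M. X i \<in> N m)"
proof
  assume "lim X \<in> hat m"
  then obtain Y where Y: "lim X = lim Y" "filt_cauchy N Y" "\<forall>i. Y i \<in> N m"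
    unfolding hat_def by blast
  then have "filt_null N (\<lambda>i. X i - Y i)"
    using lim_eq_iff[OF X] by blast
  with Y(3) show "\<exists>M. \<forall>i\<ge>M. X i \<in> N m"
    unfolding filt_null_def using mem_cong by blast
next
  assume "\<exists>M. \<forall>i\<ge>M. X i \<in> N m"
  then obtain M where "\<forall>i. X (i + M) \<in> N m"
    using le_add2 by blast
  then show "lim X \<in> hat m"
    unfolding hat_def mem_Collect_eq
    by (intro exI[of _ "\<lambda>i. X (i + M)"]) (simp add: lim_shift X filt_cauchy_shift)
qed

lemma lim_0 [simp]: "lim (\<lambda>_. 0) = 0"
  using lim_add[OF filt_cauchy_const filt_cauchy_const, of 0 0] by simp

lemma filt_cauchy_diff:
  "filt_cauchy N X \<Longrightarrow> filt_cauchy N Y \<Longrightarrow> filt_cauchy N (\<lambda>i. X i - Y i)"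
  using filt_cauchy_add[of X "\<lambda>i. - Y i"] filt_cauchy_uminus[of Y] by simp

lemma lim_diff:
  assumes "filt_cauchy N X" "filt_cauchy N Y"
  shows "lim X - lim Y = lim (\<lambda>i. X i - Y i)"
  using lim_add[OF filt_cauchy_diff[OF assms] assms(2)] by (simp add: algebra_simps)

lemma hat_hausdorff:
  assumes "\<And>m. x \<in> hat m"
  shows "x = 0"
proof (cases x rule: lim_cases)
  case (lim X)
  then have "filt_null N (\<lambda>i. X i - 0)"
    using assms by (simp add: lim_mem_hat_iff filt_null_def)
  then show ?thesis
    using lim lim_eqI[OF lim(2) filt_cauchy_const, of 0] by simp
qed

lemma hat_dense: "\<exists>a. x - lim (\<lambda>_. a) \<in> hat m"
proof (cases x rule: lim_cases)
  case (lim X)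
  then obtain M where "\<forall>i\<ge>M. \<forall>j\<ge>M. X i - X j \<in> N m"
    unfolding filt_cauchy_def by blast
  then have "\<forall>i\<ge>M. X i - X M \<in> N m" by blast
  then show ?thesis
    using lim by (auto simp: lim_diff filt_cauchy_const lim_mem_hat_iff filt_cauchy_diff)
qed

text \<open>Evaluation on a chosen representative, in the form in which \<open>cga2_map\<close>,
  \<open>cyc2_map\<close> and \<open>cyc2_class\<close> are defined, so that these become instances.
  Independence of the choice is \<open>extend_lim\<close>.\<close>

definition extend :: "((nat \<Rightarrow> 'b) \<Rightarrow> 'r) \<Rightarrow> ('a \<Rightarrow> 'b) \<Rightarrow> 'q \<Rightarrow> 'r" where
  "extend lim' f x = lim' (\<lambda>i. f (rep x i))"

end

locale completion_map = dom: completion N lim rep + cod: completion N' lim' rep'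
  for N :: "nat \<Rightarrow> 'a::ab_group_add set" and lim :: "_ \<Rightarrow> 'q::ab_group_add" and rep
    and N' :: "nat \<Rightarrow> 'b::ab_group_add set" and lim' :: "_ \<Rightarrow> 'r::ab_group_add" and rep' +
  fixes f :: "'a \<Rightarrow> 'b"
  assumes f_add: "f (x + y) = f x + f y" and bounded: "filt_bounded N N' f"
begin

lemma f_diff: "f (x - y) = f x - f y"
  using f_add[of "x - y" y] by (simp add: algebra_simps)

lemma cauchy: "filt_cauchy N X \<Longrightarrow> filt_cauchy N' (\<lambda>i. f (X i))"
  by (rule filt_bounded_cauchy[OF bounded f_diff])

lemma extend_lim: "filt_cauchy N X \<Longrightarrow> dom.extend lim' f (lim X) = lim' (\<lambda>i. f (X i))"
  unfolding dom.extend_def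
  using filt_bounded_null[OF bounded dom.rep_lim_null]
  by (intro cod.lim_eqI cauchy dom.cauchy_rep) (simp_all add: f_diff)

lemma extend_add: "dom.extend lim' f (x + y) = dom.extend lim' f x + dom.extend lim' f y"
  by (cases x rule: dom.lim_cases; cases y rule: dom.lim_cases)
    (simp add: dom.lim_add dom.filt_cauchy_add extend_lim f_add cod.lim_add cauchy)

lemma extend_bounded: "filt_bounded dom.hat cod.hat (dom.extend lim' f)"
  unfolding filt_bounded_def
proof
  fix m
  obtain k where k: "\<forall>x\<in>N k. f x \<in> N' m" using bounded unfolding filt_bounded_def by blast
  show "\<exists>k. \<forall>x\<in>dom.hat k. dom.extend lim' f x \<in> cod.hat m"
  proof (intro exI ballI)
    fix x assume "x \<in> dom.hat k"
    then obtain X where "x = lim X" "filt_cauchy N X" "\<forall>i. X i \<in> N k"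
      unfolding dom.hat_def by blast
    with k show "dom.extend lim' f x \<in> cod.hat m"
      by (simp add: extend_lim cod.lim_mem_hat_iff cauchy)
  qed
qed

end

lemma filt_bounded_continuous:
  fixes f :: "'a::{ab_group_add,topological_space} \<Rightarrow> 'b::{ab_group_add,topological_space}"
  assumes "open = filt_open F" "open = filt_open G"
    and f: "\<And>x y. f (x - y) = f x - f y" "filt_bounded F G f"
  shows "continuous_on UNIV f"
proof (subst continuous_on_open_vimage[OF open_UNIV], intro allI impI)
  fix B :: "'b set" assume "open B"
  then have B: "filt_open G B" using assms(2) by simp
  have "filt_open F (f -` B)"
    unfolding filt_open_def
  proof
    fix x assume "x \<in> f -` B"
    then obtain m where m: "\<forall>y. y - f x \<in> G m \<longrightarrow> y \<in> B"
      using B unfolding filt_open_def by blast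
    obtain k where "\<forall>x\<in>F k. f x \<in> G m" using f(2) unfolding filt_bounded_def by blast
    with m show "\<exists>k. \<forall>y. y - x \<in> F k \<longrightarrow> y \<in> f -` B"
      by (metis f(1) vimage_eq)
  qed
  then show "open (f -` B \<inter> UNIV)" using assms(1) by simp
qed

lemma continuous_filt_bounded:
  fixes f :: "'a::{ab_group_add,topological_space} \<Rightarrow> 'b::{ab_group_add,topological_space}"
  assumes "open = filt_open F" "open = filt_open G" "filtration G"
    and f: "\<And>x y. f (x - y) = f x - f y" "continuous_on UNIV f"
  shows "filt_bounded F G f"
  unfolding filt_bounded_def
proof
  fix m
  interpret G: filtration G by fact
  have f0: "f 0 = 0" using f(1)[of 0 0] by simp
  have "open {y. y - 0 \<in> G m}"
    unfolding assms(2) by (rule G.filt_open_coset)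
  then have "open (f -` {y. y - 0 \<in> G m})"
    using f(2) by (simp add: continuous_on_open_vimage[OF open_UNIV])
  then have "filt_open F (f -` {y. y - 0 \<in> G m})" unfolding assms(1) .
  moreover have "0 \<in> f -` {y. y - 0 \<in> G m}" by (simp add: f0 G.zero_mem)
  ultimately obtain k where "\<forall>y. y - 0 \<in> F k \<longrightarrow> y \<in> f -` {y. y - 0 \<in> G m}"
    unfolding filt_open_def by blast
  then show "\<exists>k. \<forall>x\<in>F k. f x \<in> G m" by auto
qed

section \<open>Formal tensors\<close>

lemma formal_tensor_map_superset:
  assumes "finite A" "Poly_Mapping.keys x \<subseteq> A"
  shows "formal_tensor_map f g x =
    (\<Sum>(v, w)\<in>A. Poly_Mapping.single (f v, g w) (Poly_Mapping.lookup x (v, w)))"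
  unfolding formal_tensor_map_def
  by (rule sum.mono_neutral_left) (use assms in \<open>auto simp: in_keys_iff\<close>)

lemma formal_tensor_map_single [simp]:
  "formal_tensor_map f g (Poly_Mapping.single (v, w) c) = Poly_Mapping.single (f v, g w) c"
  by (subst formal_tensor_map_superset[of "{(v, w)}"]) auto

lemma formal_tensor_map_add:
  "formal_tensor_map f g (x + y) = formal_tensor_map f g x + formal_tensor_map f g y"
proof -
  let ?A = "Poly_Mapping.keys x \<union> Poly_Mapping.keys y"
  have "finite ?A" by simp
  with keys_add[of x y] show ?thesis
    by (simp add: formal_tensor_map_superset[of ?A] lookup_add single_add sum.distrib
        case_prod_unfold)
qed

lemma pm_scale_single [simp]:
  "pm_scale c (Poly_Mapping.single a d) = Poly_Mapping.single a (c * d)"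
  by (rule poly_mapping_eqI) (simp add: lookup_pm_scale lookup_single when_def)

lemma formal_tensor_map_scale:
  "formal_tensor_map f g (pm_scale c x) = pm_scale c (formal_tensor_map f g x)"
proof -
  have "Poly_Mapping.keys (pm_scale c x) \<subseteq> Poly_Mapping.keys x"
    by (auto simp: in_keys_iff lookup_pm_scale)
  then show ?thesis
    by (simp add: formal_tensor_map_superset[of "Poly_Mapping.keys x"] lookup_pm_scale
        pm.scale_sum_right case_prod_unfold)
qed

lemma formal_tensor_map_diff:
  "formal_tensor_map f g (x - y) = formal_tensor_map f g x - formal_tensor_map f g y"
  using formal_tensor_map_add[of f g "x - y" y] by (simp add: algebra_simps)

lemma formal_tensor_map_0 [simp]: "formal_tensor_map f g 0 = 0"
  by (simp add: formal_tensor_map_def)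

lemma pm_induct [case_names zero add]:
  fixes x :: "'a \<Rightarrow>\<^sub>0 'k::field"
  assumes "P 0" "\<And>a c x. P x \<Longrightarrow> P (Poly_Mapping.single a c + x)"
  shows "P x"
proof -
  have "P (\<Sum>a\<in>A. Poly_Mapping.single a (Poly_Mapping.lookup x a))" if "finite A" for A
    using that by (induction A) (auto intro: assms)
  from this[of "Poly_Mapping.keys x"] show ?thesis by (simp add: pm_sum_single)
qed

lemma formal_tensor_map_comp:
  "formal_tensor_map f g (formal_tensor_map f' g' x) =
    formal_tensor_map (\<lambda>v. f (f' v)) (\<lambda>w. g (g' w)) x"
proof (induction x rule: pm_induct)
  case zero
  show ?case by (simp add: formal_tensor_map_def)
next
  case (add a c x)
  then show ?case by (cases a) (simp add: formal_tensor_map_add)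
qed

lemma formal_tensor_map_id: "formal_tensor_map (\<lambda>v. v) (\<lambda>w. w) x = x"
  by (simp add: formal_tensor_map_def pm_sum_single case_prod_unfold)

lemma tensor_nbhd_simps:
  "Poly_Mapping.single (v + v', w) 1 - Poly_Mapping.single (v, w) 1 - Poly_Mapping.single (v', w) 1 \<in> tensor_nbhd s t F G m"
  "Poly_Mapping.single (v, w + w') 1 - Poly_Mapping.single (v, w) 1 - Poly_Mapping.single (v, w') 1 \<in> tensor_nbhd s t F G m"
  "Poly_Mapping.single (s c v, w) 1 - Poly_Mapping.single (v, w) c \<in> tensor_nbhd s t F G m"
  "Poly_Mapping.single (v, t c w) 1 - Poly_Mapping.single (v, w) c \<in> tensor_nbhd s t F G m"
  "v \<in> F m \<or> w \<in> G m \<Longrightarrow> Poly_Mapping.single (v, w) 1 \<in> tensor_nbhd s t F G m"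
  unfolding tensor_nbhd_def Let_def
  by (rule pm.span_base, force)+

lemma tensor_nbhd_subspace: "pm.subspace (tensor_nbhd s t F G m)"
  unfolding tensor_nbhd_def by (rule pm.subspace_span)

lemmas tensor_nbhd_0 = pm.subspace_0[OF tensor_nbhd_subspace]
lemmas tensor_nbhd_add = pm.subspace_add[OF tensor_nbhd_subspace]
lemmas tensor_nbhd_diff = pm.subspace_diff[OF tensor_nbhd_subspace]
lemmas tensor_nbhd_uminus = pm.subspace_neg[OF tensor_nbhd_subspace]
lemmas tensor_nbhd_scale = pm.subspace_scale[OF tensor_nbhd_subspace]

lemma tensor_nbhd_induct [consumes 1, case_names zero add add_left add_right scale_left scale_right small]:
  assumes "x \<in> tensor_nbhd s t F G m" and "P 0" "\<And>x y c. P x \<Longrightarrow> P y \<Longrightarrow> P (pm_scale c x + y)"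
    and "\<And>v v' w. P (Poly_Mapping.single (v + v', w) 1 - Poly_Mapping.single (v, w) 1
      - Poly_Mapping.single (v', w) 1)"
    and "\<And>v w w'. P (Poly_Mapping.single (v, w + w') 1 - Poly_Mapping.single (v, w) 1
      - Poly_Mapping.single (v, w') 1)"
    and "\<And>c v w. P (Poly_Mapping.single (s c v, w) 1 - Poly_Mapping.single (v, w) c)"
    and "\<And>c v w. P (Poly_Mapping.single (v, t c w) 1 - Poly_Mapping.single (v, w) c)"
    and "\<And>v w. v \<in> F m \<or> w \<in> G m \<Longrightarrow> P (Poly_Mapping.single (v, w) 1)"
  shows "P x"
  using assms(1) unfolding tensor_nbhd_def Let_def
proof (induction rule: pm.span_induct_alt)
  case base
  show ?case by fact
next
  case (step c x y)
  have "P x"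
    using step(1) by (auto intro: assms)
  with step show ?case by (intro assms)
qed

lemma tensor_nbhd_single:
  "v \<in> F m \<or> w \<in> G m \<Longrightarrow> Poly_Mapping.single (v, w) c \<in> tensor_nbhd s t F G m"
  using tensor_nbhd_scale[OF tensor_nbhd_simps(5), where c = c] by simp

lemma formal_tensor_map_nbhd:
  assumes f: "\<And>v v'. f (v + v') = f v + f v'" "\<And>c v. f (s c v) = s' c (f v)"
    and g: "\<And>w w'. g (w + w') = g w + g w'" "\<And>c w. g (t c w) = t' c (g w)"
    and fF: "\<And>v. v \<in> F m \<Longrightarrow> f v \<in> F' m'" and gG: "\<And>w. w \<in> G m \<Longrightarrow> g w \<in> G' m'"
    and x: "x \<in> tensor_nbhd s t F G m"
  shows "formal_tensor_map f g x \<in> tensor_nbhd s' t' F' G' m'"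
  using x
proof (induction rule: tensor_nbhd_induct)
  case zero
  show ?case using tensor_nbhd_0 by (simp add: formal_tensor_map_def)
next
  case (add x y c)
  then show ?case
    by (simp add: formal_tensor_map_add formal_tensor_map_scale tensor_nbhd_add tensor_nbhd_scale)
next
  case (small v w)
  then show ?case using fF gG by (auto intro!: tensor_nbhd_single)
qed (simp_all add: formal_tensor_map_diff f g tensor_nbhd_simps)

text \<open>Formal tensors are additive in a factor only up to the tensor relations. These lie in
  every neighbourhood, so the error disappears in the completion.\<close>

lemma formal_tensor_map_add_left:
  "formal_tensor_map (\<lambda>v. f v + f' v) g x - (formal_tensor_map f g x + formal_tensor_map f' g x) \<in> tensor_nbhd s t F G m"
proof (induction x rule: pm_induct)
  case zero
  show ?case by (simp add: formal_tensor_map_def tensor_nbhd_0)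
next
  case (add a c x)
  obtain v w where a: "a = (v, w)" by (cases a)
  have "Poly_Mapping.single (f v + f' v, g w) c - (Poly_Mapping.single (f v, g w) c + Poly_Mapping.single (f' v, g w) c) \<in> tensor_nbhd s t F G m"
    using tensor_nbhd_scale[OF tensor_nbhd_simps(1)[of "f v" "f' v" "g w" s t F G m], of c]
    by (simp add: pm.scale_right_diff_distrib pm.scale_right_distrib diff_diff_eq)
  from tensor_nbhd_add[OF this add] show ?case
    by (simp add: a formal_tensor_map_add algebra_simps)
qed

lemma formal_tensor_map_add_right:
  "formal_tensor_map f (\<lambda>v. g v + g' v) x - (formal_tensor_map f g x + formal_tensor_map f g' x) \<in> tensor_nbhd s t F G m"
proof (induction x rule: pm_induct)
  case zero
  show ?case by (simp add: formal_tensor_map_def tensor_nbhd_0)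
next
  case (add a c x)
  obtain v w where a: "a = (v, w)" by (cases a)
  have "Poly_Mapping.single (f v, g w + g' w) c - (Poly_Mapping.single (f v, g w) c + Poly_Mapping.single (f v, g' w) c) \<in> tensor_nbhd s t F G m"
    using tensor_nbhd_scale[OF tensor_nbhd_simps(2)[of "f v" "g w" "g' w" s t F G m], of c]
    by (simp add: pm.scale_right_diff_distrib pm.scale_right_distrib diff_diff_eq)
  from tensor_nbhd_add[OF this add] show ?case
    by (simp add: a formal_tensor_map_add algebra_simps)
qed

lemma formal_tensor_map_scale_left:
  "formal_tensor_map (\<lambda>v. s c (f v)) g x - pm_scale c (formal_tensor_map f g x) \<in> tensor_nbhd s t F G m"
proof (induction x rule: pm_induct)
  case zero
  show ?case by (simp add: formal_tensor_map_def tensor_nbhd_0)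
next
  case (add a d x)
  obtain v w where a: "a = (v, w)" by (cases a)
  have "Poly_Mapping.single (s c (f v), g w) d - Poly_Mapping.single (f v, g w) (c * d) \<in> tensor_nbhd s t F G m"
    using tensor_nbhd_scale[OF tensor_nbhd_simps(3)[of s c "f v" "g w" t F G m], of d]
    by (simp add: pm.scale_right_diff_distrib mult.commute)
  from tensor_nbhd_add[OF this add] show ?case
    by (simp add: a formal_tensor_map_add pm.scale_right_distrib algebra_simps)
qed

lemma formal_tensor_map_scale_right:
  "formal_tensor_map f (\<lambda>w. t c (g w)) x - pm_scale c (formal_tensor_map f g x) \<in> tensor_nbhd s t F G m"
proof (induction x rule: pm_induct)
  case zero
  show ?case by (simp add: formal_tensor_map_def tensor_nbhd_0)
next
  case (add a d x)
  obtain v w where a: "a = (v, w)" by (cases a)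
  have "Poly_Mapping.single (f v, t c (g w)) d - Poly_Mapping.single (f v, g w) (c * d) \<in> tensor_nbhd s t F G m"
    using tensor_nbhd_scale[OF tensor_nbhd_simps(4)[of "f v" t c "g w" s F G m], of d]
    by (simp add: pm.scale_right_diff_distrib mult.commute)
  from tensor_nbhd_add[OF this add] show ?case
    by (simp add: a formal_tensor_map_add pm.scale_right_distrib algebra_simps)
qed

lemma filt_null_all: "(\<And>i m. X i \<in> N m) \<Longrightarrow> filt_null N X"
  by (auto simp: filt_null_def)

lemma formal_tensor_map_bounded:
  assumes F: "filtration F" "filtration G"
    and f: "\<And>v v'. f (v + v') = f v + f v'" "\<And>c v. f (s c v) = s' c (f v)" "filt_bounded F F' f"
    and g: "\<And>w w'. g (w + w') = g w + g w'" "\<And>c w. g (t c w) = t' c (g w)" "filt_bounded G G' g"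
  shows "filt_bounded (tensor_nbhd s t F G) (tensor_nbhd s' t' F' G') (formal_tensor_map f g)"
  unfolding filt_bounded_def
proof
  fix m
  obtain k l where kl: "\<forall>v\<in>F k. f v \<in> F' m" "\<forall>w\<in>G l. g w \<in> G' m"
    using f(3) g(3) unfolding filt_bounded_def by meson
  have sub: "F (max k l) \<subseteq> F k" "G (max k l) \<subseteq> G l"
    using F filtration.antimono by (metis max.cobounded1 max.cobounded2)+
  show "\<exists>k. \<forall>x\<in>tensor_nbhd s t F G k. formal_tensor_map f g x \<in> tensor_nbhd s' t' F' G' m"
  proof (intro exI ballI)
    fix x assume "x \<in> tensor_nbhd s t F G (max k l)"
    then show "formal_tensor_map f g x \<in> tensor_nbhd s' t' F' G' m"
      by (rule formal_tensor_map_nbhd[rotated -1]) (use f g kl sub in auto)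
  qed
qed

section \<open>The completed group algebra\<close>

interpretation cga_c: completion
  "aug_pow :: nat \<Rightarrow> ('g::group_add \<Rightarrow>\<^sub>0 'k::field) set" cga_lim rep_cga
  by unfold_locales (rule Quotient3_cga, rule cga_lim_add)

interpretation cga2_c: completion
  "tensor_nbhd cga_scale cga_scale cga_filt cga_filt ::
    nat \<Rightarrow> (('g::group_add, 'k::field) cga \<times> ('g, 'k) cga \<Rightarrow>\<^sub>0 'k) set" cga2_lim rep_cga2
  by unfold_locales (rule Quotient3_cga2, simp add: plus_cga2.abs_eq cga2.filt_rel_refl)

interpretation cyc2_c: completion
  "tensor_nbhd cyc_scale cyc_scale cyc_filt cyc_filt ::
    nat \<Rightarrow> (('g::group_add, 'k::field) cyc \<times> ('g, 'k) cyc \<Rightarrow>\<^sub>0 'k) set" cyc2_lim rep_cyc2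
  by unfold_locales (rule Quotient3_cyc2, simp add: plus_cyc2.abs_eq cyc2.filt_rel_refl)

lemma hat_cga: "cga_c.hat = cga_filt"
  by (simp add: fun_eq_iff cga_c.hat_def cga_filt_def)

lemma hat_cga2: "cga2_c.hat = cga2_filt"
  by (simp add: fun_eq_iff cga2_c.hat_def cga2_filt_def)

lemmas cga_hausdorff = cga_c.hat_hausdorff[unfolded hat_cga]
lemmas cga2_hausdorff = cga2_c.hat_hausdorff[unfolded hat_cga2]
lemmas cga_dense = cga_c.hat_dense[unfolded hat_cga, folded cga_of_def]
lemmas cga_lim_mem_filt_iff = cga_c.lim_mem_hat_iff[unfolded hat_cga]

lemma cga_of_add: "cga_of (x + y) = cga_of x + cga_of y"
  and cga_of_diff: "cga_of (x - y) = cga_of x - cga_of y"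
  and cga_of_mult: "cga_of (x * y) = cga_of x * cga_of y"
  and cga_of_scale: "cga_of (pm_scale c x) = cga_scale c (cga_of x)"
  by (simp_all add: cga_of_def cga_lim_add cga_lim_diff cga_lim_mult cga_scale_lim aug.filt_cauchy_const)

lemma cga_of_0: "cga_of 0 = 0" and cga_of_1: "cga_of 1 = 1"
  by (simp_all add: cga_of_def one_cga_def)

lemma cga_of_mem_filt_iff: "cga_of x \<in> cga_filt m \<longleftrightarrow> x \<in> aug_pow m"
  unfolding cga_of_def cga_lim_mem_filt_iff[OF aug.filt_cauchy_const] by auto

lemma cga_group_add: "cga_group (g + h) = cga_group g * cga_group h"
  by (simp add: cga_group_def mult_single flip: cga_of_mult)

lemma cga_group_0: "cga_group 0 = 1"
  by (simp add: cga_group_def cga_of_1)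

lemma cga_group_inverse [simp]:
  "cga_group g * cga_group (- g) = 1" "cga_group (- g) * cga_group g = 1"
  by (simp_all add: cga_group_0 flip: cga_group_add)

lemma cga_group_inverse_mult [simp]:
  "cga_group g * (cga_group (- g) * a) = a" "cga_group (- g) * (cga_group g * a) = a"
  by (simp_all flip: mult.assoc)

lemma cga_scale_mult: "cga_scale c (x * y) = cga_scale c x * y"
  by (simp add: cga_scale_def mult.assoc)

lemma cga_mult_scale: "x * cga_scale c y = cga_scale c (x * y)"
proof (cases x rule: cga_c.lim_cases; cases y rule: cga_c.lim_cases)
  fix X Y assume *: "x = cga_lim X" "filt_cauchy aug_pow X" "y = cga_lim Y" "filt_cauchy aug_pow Y"
  have "filt_cauchy aug_pow (\<lambda>i. pm_scale c (Y i))"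
    using *(4) unfolding filt_cauchy_def
    by (metis pm.scale_right_diff_distrib pm.subspace_scale subspace_aug_pow)
  with * show ?thesis
    by (simp add: cga_scale_lim cga_lim_mult filt_cauchy_mult pm_scale_mult_right)
qed

lemma cga_filt_mult_left: "y \<in> cga_filt m \<Longrightarrow> x * y \<in> cga_filt m"
  and cga_filt_mult_right: "y \<in> cga_filt m \<Longrightarrow> y * x \<in> cga_filt m"
proof -
  assume "y \<in> cga_filt m"
  then obtain Y where Y: "y = cga_lim Y" "filt_cauchy aug_pow Y" "\<forall>i. Y i \<in> aug_pow m"
    unfolding cga_filt_def by blast
  obtain X where X: "x = cga_lim X" "filt_cauchy aug_pow X" by (rule cga_c.lim_cases)
  show "x * y \<in> cga_filt m" "y * x \<in> cga_filt m"
    using X Y by (simp_all add: cga_lim_mult cga_lim_mem_filt_iff filt_cauchy_mult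
        aug_pow_mult_left aug_pow_mult_right)
qed

lemma cga_filt_mult_aug:
  assumes "x \<in> augmentation_ideal" "y \<in> cga_filt m"
  shows "cga_of x * y \<in> cga_filt (Suc m)"
proof -
  obtain Y where Y: "y = cga_lim Y" "filt_cauchy aug_pow Y" "\<forall>i. Y i \<in> aug_pow m"
    using assms(2) unfolding cga_filt_def by blast
  have "x * Y i \<in> aug_pow (Suc m)" for i
    using assms(1) Y(3) by (auto intro: pm.span_base)
  with Y show ?thesis
    by (simp add: cga_of_def cga_lim_mult cga_lim_mem_filt_iff filt_cauchy_mult aug.filt_cauchy_const
        del: aug_pow.simps)
qed

text \<open>Continuity is expressed by the filtrations so that \<open>cyc\<close>, given only by its
  quotient filtration, is covered as well.\<close>

definition cont_linear :: "('k::field \<Rightarrow> 'v::ab_group_add \<Rightarrow> 'v) \<Rightarrow> ('k \<Rightarrow> 'w::ab_group_add \<Rightarrow> 'w) \<Rightarrow>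
    (nat \<Rightarrow> 'v set) \<Rightarrow> (nat \<Rightarrow> 'w set) \<Rightarrow> ('v \<Rightarrow> 'w) \<Rightarrow> bool" where
  "cont_linear s t F G f \<longleftrightarrow> (\<forall>x y. f (x + y) = f x + f y) \<and> (\<forall>c x. f (s c x) = t c (f x)) \<and>
     filt_bounded F G f"

lemma cont_linear_add: "cont_linear s t F G f \<Longrightarrow> f (x + y) = f x + f y"
  and cont_linear_scale: "cont_linear s t F G f \<Longrightarrow> f (s c x) = t c (f x)"
  and cont_linear_bounded: "cont_linear s t F G f \<Longrightarrow> filt_bounded F G f"
  by (simp_all add: cont_linear_def)

lemma cont_linear_id: "cont_linear s s F F (\<lambda>x. x)"
  by (simp add: cont_linear_def filt_bounded_id)

lemma cont_linear_comp:
  "cont_linear t r G H g \<Longrightarrow> cont_linear s t F G f \<Longrightarrow> cont_linear s r F H (\<lambda>x. g (f x))"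
  by (auto simp: cont_linear_def intro: filt_bounded_comp)

lemma cont_linear_diff:
  "cont_linear s t F G f \<Longrightarrow> f (x - y) = f x - f y"
  using cont_linear_add[of s t F G f "x - y" y] by (simp add: algebra_simps)

lemma cont_linear_0: "cont_linear s t F G f \<Longrightarrow> f 0 = 0"
  using cont_linear_diff[of s t F G f 0 0] by simp

abbreviation cga_end :: "(('g::group_add, 'k::field) cga \<Rightarrow> ('g, 'k) cga) \<Rightarrow> bool" where
  "cga_end \<equiv> cont_linear cga_scale cga_scale cga_filt cga_filt"

abbreviation cyc_end :: "(('g::group_add, 'k::field) cyc \<Rightarrow> ('g, 'k) cyc) \<Rightarrow> bool" where
  "cyc_end \<equiv> cont_linear cyc_scale cyc_scale cyc_filt cyc_filt"

abbreviation cga2_end :: "(('g::group_add, 'k::field) cga2 \<Rightarrow> ('g, 'k) cga2) \<Rightarrow> bool" where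
  "cga2_end \<equiv> cont_linear cga2_scale cga2_scale cga2_filt cga2_filt"

lemma cga_end_lmult: "cga_end (\<lambda>x. a * x)"
  by (auto simp: cont_linear_def distrib_left cga_mult_scale intro!: filt_boundedI cga_filt_mult_left)

lemma cga_end_rmult: "cga_end (\<lambda>x. x * a)"
  by (auto simp: cont_linear_def distrib_right cga_scale_mult intro!: filt_boundedI cga_filt_mult_right)

lemma cont_linear_cyc_class:
  "cont_linear cga_scale cyc_scale cga_filt cyc_filt
    (cyc_class :: ('g::group_add, 'k::field) cga \<Rightarrow> _)"
  unfolding cont_linear_def
proof (intro conjI allI)
  show "filt_bounded cga_filt cyc_filt cyc_class"
    by (rule filt_boundedI) (auto simp: cyc_filt_def)
  show "cyc_class (cga_scale c x) = cyc_scale c (cyc_class x)" for c and x :: "('g, 'k) cga"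
  proof -
    have "rep_cyc (cyc_class x) - x \<in> cga_commutators"
      using Quotient3_rep_abs[OF Quotient3_cyc, of x] by (simp add: cga.subspace_0[OF subspace_cga_commutators])
    then have "cga_scale c (rep_cyc (cyc_class x) - x) \<in> cga_commutators"
      by (rule cga.subspace_scale[OF subspace_cga_commutators])
    then show ?thesis
      unfolding cyc_scale_def cyc_map_def
      by (subst eq_commute) (simp add: cyc.abs_eq_iff cga.scale_right_diff_distrib)
  qed
qed (simp add: plus_cyc.abs_eq)

lemmas cyc_class_add = cont_linear_add[OF cont_linear_cyc_class]
  and cyc_class_diff = cont_linear_diff[OF cont_linear_cyc_class]
  and cyc_class_scale = cont_linear_scale[OF cont_linear_cyc_class]
  and cyc_class_0 = cont_linear_0[OF cont_linear_cyc_class]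

lemma cyc_class_eq_iff: "cyc_class x = cyc_class y \<longleftrightarrow> x - y \<in> cga_commutators"
  by (simp add: cyc.abs_eq_iff)

lemma cyc_class_mult_commute: "cyc_class (a * b) = cyc_class (b * a)"
  unfolding cyc_class_eq_iff cga_commutators_def
  by (rule subsetD[OF closure_subset], rule cga.span_base) blast

lemma cyc_class_rep: "cyc_class (rep_cyc x) = x"
  by (rule Quotient3_abs_rep[OF Quotient3_cyc])

text \<open>This uses that the span of commutators has been closed: an element approximated by that
  span to every order belongs to it.\<close>

lemma cyc_hausdorff:
  assumes "\<And>m. x \<in> cyc_filt m"
  shows "x = (0 :: ('g::group_add, 'k::field) cyc)"
proof -
  obtain a where a: "x = cyc_class a" using cyc_class_rep by metis
  let ?S = "cga.span {a * b - b * a | a b :: ('g, 'k) cga. True}"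
  have "\<exists>s\<in>?S. s - a \<in> cga_filt m" for m
  proof -
    obtain y where y: "y \<in> cga_filt m" "x = cyc_class y"
      using assms[of m] unfolding cyc_filt_def by blast
    then have "a - y \<in> closure ?S"
      using a by (simp add: cyc_class_eq_iff cga_commutators_def)
    then obtain s where s: "s \<in> ?S" "s - (a - y) \<in> cga_filt m"
      unfolding closure_cga_iff by blast
    have "s - (a - y) - y \<in> cga_filt m" by (rule cga.diff_mem[OF s(2) y(1)])
    with s(1) show ?thesis by (intro bexI[of _ s]) simp_all
  qed
  then have "a \<in> cga_commutators" unfolding cga_commutators_def closure_cga_iff by blast
  then show ?thesis by (simp add: a cyc_class_eq_iff flip: cyc_class_0)
qed

section \<open>Maps between completed tensor products\<close>

lemma cga2_map_locale:
  "cga_end f \<Longrightarrow> cga_end g \<Longrightarrow>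
    completion_map (tensor_nbhd cga_scale cga_scale cga_filt cga_filt) cga2_lim rep_cga2
      (tensor_nbhd cga_scale cga_scale cga_filt cga_filt) cga2_lim rep_cga2 (formal_tensor_map f g)"
  by (intro completion_map.intro completion_map_axioms.intro cga2_c.completion_axioms
      formal_tensor_map_add formal_tensor_map_bounded cga.filtration_axioms)
    (simp_all add: cont_linear_def)

lemma cyc2_map_locale:
  "cyc_end f \<Longrightarrow> cyc_end g \<Longrightarrow>
    completion_map (tensor_nbhd cyc_scale cyc_scale cyc_filt cyc_filt) cyc2_lim rep_cyc2
      (tensor_nbhd cyc_scale cyc_scale cyc_filt cyc_filt) cyc2_lim rep_cyc2 (formal_tensor_map f g)"
  by (intro completion_map.intro completion_map_axioms.intro cyc2_c.completion_axioms
      formal_tensor_map_add formal_tensor_map_bounded cyc.filtration_axioms)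
    (simp_all add: cont_linear_def)

interpretation cyc2_class: completion_map
  "tensor_nbhd cga_scale cga_scale cga_filt cga_filt ::
    nat \<Rightarrow> (('g::group_add, 'k::field) cga \<times> ('g, 'k) cga \<Rightarrow>\<^sub>0 'k) set" cga2_lim rep_cga2
  "tensor_nbhd cyc_scale cyc_scale cyc_filt cyc_filt ::
    nat \<Rightarrow> (('g, 'k) cyc \<times> ('g, 'k) cyc \<Rightarrow>\<^sub>0 'k) set" cyc2_lim rep_cyc2
  "formal_tensor_map cyc_class cyc_class"
  by (intro completion_map.intro completion_map_axioms.intro cyc2_c.completion_axioms
      cga2_c.completion_axioms formal_tensor_map_add formal_tensor_map_bounded cga.filtration_axioms)
    (simp_all add: cyc_class_add cyc_class_scale cont_linear_bounded[OF cont_linear_cyc_class])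

lemma cga2_map_extend: "cga2_map f g = cga2_c.extend cga2_lim (formal_tensor_map f g)"
  by (simp add: fun_eq_iff cga2_map_def cga2_c.extend_def)

lemma cyc2_map_extend: "cyc2_map f g = cyc2_c.extend cyc2_lim (formal_tensor_map f g)"
  by (simp add: fun_eq_iff cyc2_map_def cyc2_c.extend_def)

lemma cyc2_class_extend: "cyc2_class = cga2_c.extend cyc2_lim (formal_tensor_map cyc_class cyc_class)"
  by (simp add: fun_eq_iff cyc2_class_def cga2_c.extend_def)

lemmas cga2_map_lim = completion_map.extend_lim[OF cga2_map_locale, folded cga2_map_extend]
  and cga2_map_cauchy = completion_map.cauchy[OF cga2_map_locale]
  and cga2_map_add = completion_map.extend_add[OF cga2_map_locale, folded cga2_map_extend]
  and cga2_map_bounded = completion_map.extend_bounded[OF cga2_map_locale, folded cga2_map_extend,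
    unfolded hat_cga2]

lemmas cyc2_map_lim = completion_map.extend_lim[OF cyc2_map_locale, folded cyc2_map_extend]

lemmas cyc2_class_lim = cyc2_class.extend_lim[folded cyc2_class_extend]
  and cyc2_class_add = cyc2_class.extend_add[folded cyc2_class_extend]

lemma cyc2_class_0: "cyc2_class 0 = 0"
  using cyc2_class_add[of 0 0] by simp

lemma cyc2_class_diff: "cyc2_class (x - y) = cyc2_class x - cyc2_class y"
  using cyc2_class_add[of "x - y" y] by (simp add: algebra_simps)

lemma cyc2_class_uminus: "cyc2_class (- x) = - cyc2_class x"
  using cyc2_class_diff[of 0 x] by (simp add: cyc2_class_0)

lemma cga2_scale_lim:
  assumes X: "filt_cauchy (tensor_nbhd cga_scale cga_scale cga_filt cga_filt) X"
  shows "cga2_scale c (cga2_lim X) = cga2_lim (\<lambda>i. pm_scale c (X i))"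
    and "filt_cauchy (tensor_nbhd cga_scale cga_scale cga_filt cga_filt) (\<lambda>i. pm_scale c (X i))"
proof -
  interpret completion_map "tensor_nbhd cga_scale cga_scale cga_filt cga_filt" cga2_lim rep_cga2
    "tensor_nbhd cga_scale cga_scale cga_filt cga_filt" cga2_lim rep_cga2 "pm_scale c"
    by (intro completion_map.intro completion_map_axioms.intro cga2_c.completion_axioms
        pm.scale_right_distrib filt_boundedI tensor_nbhd_scale)
  show "cga2_scale c (cga2_lim X) = cga2_lim (\<lambda>i. pm_scale c (X i))"
    using extend_lim[OF X] by (simp add: cga2_scale_def cga2_c.extend_def)
  show "filt_cauchy (tensor_nbhd cga_scale cga_scale cga_filt cga_filt) (\<lambda>i. pm_scale c (X i))"
    by (rule cauchy[OF X])
qed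

interpretation cga2: vector_space "cga2_scale :: 'k::field \<Rightarrow> ('g::group_add, 'k) cga2 \<Rightarrow> _"
proof
  fix a b :: 'k and x y :: "('g, 'k) cga2"
  obtain X where X: "x = cga2_lim X" "filt_cauchy (tensor_nbhd cga_scale cga_scale cga_filt cga_filt) X"
    by (rule cga2_c.lim_cases)
  obtain Y where Y: "y = cga2_lim Y" "filt_cauchy (tensor_nbhd cga_scale cga_scale cga_filt cga_filt) Y"
    by (rule cga2_c.lim_cases)
  note simps = X Y cga2_scale_lim cga2_c.lim_add cga2.filt_cauchy_add
  show "cga2_scale a (x + y) = cga2_scale a x + cga2_scale a y"
    by (simp add: simps pm.scale_right_distrib)
  show "cga2_scale (a + b) x = cga2_scale a x + cga2_scale b x"
    by (simp add: simps pm.scale_left_distrib)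
  show "cga2_scale a (cga2_scale b x) = cga2_scale (a * b) x" "cga2_scale 1 x = x"
    by (simp_all add: simps)
qed

lemma cga2_map_cont_linear:
  fixes f g :: "('g::group_add, 'k::field) cga \<Rightarrow> ('g, 'k) cga"
  assumes "cga_end f" "cga_end g"
  shows "cga2_end (cga2_map f g)"
  unfolding cont_linear_def
proof (intro conjI allI)
  fix c and x :: "('g, 'k) cga2"
  obtain X where X: "x = cga2_lim X" "filt_cauchy (tensor_nbhd cga_scale cga_scale cga_filt cga_filt) X"
    by (rule cga2_c.lim_cases)
  then show "cga2_map f g (cga2_scale c x) = cga2_scale c (cga2_map f g x)"
    by (simp add: cga2_scale_lim cga2_map_lim assms cga2_map_cauchy formal_tensor_map_scale)
qed (simp_all add: cga2_map_add cga2_map_bounded assms)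

lemma cga2_map_comp:
  assumes "cga_end f" "cga_end g" "cga_end f'" "cga_end g'"
  shows "cga2_map f g (cga2_map f' g' x) = cga2_map (\<lambda>v. f (f' v)) (\<lambda>w. g (g' w)) x"
proof -
  obtain X where X: "x = cga2_lim X" "filt_cauchy (tensor_nbhd cga_scale cga_scale cga_filt cga_filt) X"
    by (rule cga2_c.lim_cases)
  moreover have "cga_end (\<lambda>v. f (f' v))" "cga_end (\<lambda>w. g (g' w))"
    using assms by (auto intro: cont_linear_comp)
  ultimately show ?thesis
    by (simp add: cga2_map_lim assms cga2_map_cauchy formal_tensor_map_comp)
qed

lemma cga2_map_id: "cga2_map (\<lambda>v. v) (\<lambda>w. w) x = x"
  by (simp add: cga2_map_def formal_tensor_map_id cga2_c.lim_rep)

lemma cga2_map_tensor [simp]: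
  "cga_end f \<Longrightarrow> cga_end g \<Longrightarrow> cga2_map f g (cga_tensor a b) = cga_tensor (f a) (g b)"
  by (simp add: cga_tensor_def cga2_map_lim cga2.filt_cauchy_const)

lemma cyc2_map_tensor:
  "cyc_end f \<Longrightarrow> cyc_end g \<Longrightarrow> cyc2_map f g (cyc_tensor a b) = cyc_tensor (f a) (g b)"
  by (simp add: cyc_tensor_def cyc2_map_lim cyc2.filt_cauchy_const)

lemma cyc2_map_diff:
  assumes "cyc_end f" "cyc_end g"
  shows "cyc2_map f g (x - y) = cyc2_map f g x - cyc2_map f g y"
  using completion_map.extend_add[OF cyc2_map_locale[OF assms], of "x - y" y, folded cyc2_map_extend]
  by (simp add: algebra_simps)

lemma cyc2_class_tensor [simp]: "cyc2_class (cga_tensor a b) = cyc_tensor (cyc_class a) (cyc_class b)"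
  by (simp add: cga_tensor_def cyc_tensor_def cyc2_class_lim cga2.filt_cauchy_const)

text \<open>Cyclicity: only the compositions with the projections to cyclic words matter.\<close>

lemma cyc2_class_map_cong:
  assumes "cga_end f" "cga_end g" "cga_end f'" "cga_end g'"
    and "\<And>v. cyc_class (f v) = cyc_class (f' v)" "\<And>w. cyc_class (g w) = cyc_class (g' w)"
  shows "cyc2_class (cga2_map f g x) = cyc2_class (cga2_map f' g' x)"
proof -
  obtain X where X: "x = cga2_lim X" "filt_cauchy (tensor_nbhd cga_scale cga_scale cga_filt cga_filt) X"
    by (rule cga2_c.lim_cases)
  then show ?thesis
    by (simp add: cga2_map_lim cyc2_class_lim assms cga2_map_cauchy formal_tensor_map_comp)
qed

lemma cyc_tensor_add_left: "cyc_tensor (x + x') y = cyc_tensor x y + cyc_tensor x' y"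
  unfolding cyc_tensor_def cyc2_c.lim_add[OF cyc2.filt_cauchy_const cyc2.filt_cauchy_const]
  using tensor_nbhd_simps(1)
  by (intro cyc2_c.lim_eqI cyc2.filt_cauchy_const filt_null_all) (simp add: diff_diff_eq)

lemma cyc_tensor_add_right: "cyc_tensor x (y + y') = cyc_tensor x y + cyc_tensor x y'"
  unfolding cyc_tensor_def cyc2_c.lim_add[OF cyc2.filt_cauchy_const cyc2.filt_cauchy_const]
  using tensor_nbhd_simps(2)
  by (intro cyc2_c.lim_eqI cyc2.filt_cauchy_const filt_null_all) (simp add: diff_diff_eq)

section \<open>Double derivations\<close>

definition pm_extend :: "('a \<Rightarrow> 'b \<Rightarrow>\<^sub>0 'k::field) \<Rightarrow> ('a \<Rightarrow>\<^sub>0 'k) \<Rightarrow> ('b \<Rightarrow>\<^sub>0 'k)" where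
  "pm_extend f x = (\<Sum>a\<in>Poly_Mapping.keys x. pm_scale (Poly_Mapping.lookup x a) (f a))"

lemma pm_extend_superset:
  assumes "finite A" "Poly_Mapping.keys x \<subseteq> A"
  shows "pm_extend f x = (\<Sum>a\<in>A. pm_scale (Poly_Mapping.lookup x a) (f a))"
  unfolding pm_extend_def
  by (rule sum.mono_neutral_left) (use assms in \<open>auto simp: in_keys_iff\<close>)

lemma pm_extend_single [simp]: "pm_extend f (Poly_Mapping.single a c) = pm_scale c (f a)"
  by (subst pm_extend_superset[of "{a}"]) auto

lemma pm_extend_0 [simp]: "pm_extend f 0 = 0"
  by (simp add: pm_extend_def)

lemma pm_extend_add: "pm_extend f (x + y) = pm_extend f x + pm_extend f y"
  using keys_add[of x y]
  by (simp add: pm_extend_superset[of "Poly_Mapping.keys x \<union> Poly_Mapping.keys y"] lookup_add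
      pm.scale_left_distrib sum.distrib)

lemma pm_extend_scale: "pm_extend f (pm_scale c x) = pm_scale c (pm_extend f x)"
proof -
  have "Poly_Mapping.keys (pm_scale c x) \<subseteq> Poly_Mapping.keys x"
    by (auto simp: in_keys_iff lookup_pm_scale)
  then show ?thesis
    by (simp add: pm_extend_superset[of "Poly_Mapping.keys x"] lookup_pm_scale pm.scale_sum_right)
qed

lemma cga_filt_0: "x \<in> cga_filt 0"
  by (cases x rule: cga_c.lim_cases) (simp add: cga_lim_mem_filt_iff)

lemma formal_tensor_map_small:
  assumes "(\<forall>v. f v \<in> F m) \<or> (\<forall>w. g w \<in> G m)"
  shows "formal_tensor_map f g x \<in> tensor_nbhd s t F G m"
proof (induction x rule: pm_induct)
  case zero
  show ?case by (simp add: tensor_nbhd_0)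
next
  case (add a c x)
  then show ?case
    using assms by (cases a) (auto simp: formal_tensor_map_add intro!: tensor_nbhd_add tensor_nbhd_single)
qed

abbreviation cga2_nbhd :: "nat \<Rightarrow> (('g::group_add, 'k::field) cga \<times> ('g, 'k) cga \<Rightarrow>\<^sub>0 'k) set" where
  "cga2_nbhd \<equiv> tensor_nbhd cga_scale cga_scale cga_filt cga_filt"

definition formal_lmult ::
    "('g::group_add, 'k::field) cga \<Rightarrow> (('g, 'k) cga \<times> ('g, 'k) cga \<Rightarrow>\<^sub>0 'k) \<Rightarrow> _" where
  "formal_lmult a = formal_tensor_map (\<lambda>v. a * v) (\<lambda>w. w)"

definition formal_rmult ::
    "(('g, 'k) cga \<times> ('g, 'k) cga \<Rightarrow>\<^sub>0 'k) \<Rightarrow> ('g::group_add, 'k::field) cga \<Rightarrow> _" where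
  "formal_rmult x b = formal_tensor_map (\<lambda>v. v) (\<lambda>w. w * b) x"

lemma formal_lmult_add_left:
  "formal_lmult (a + a') x - (formal_lmult a x + formal_lmult a' x) \<in> tensor_nbhd s t F G m"
  unfolding formal_lmult_def distrib_right by (rule formal_tensor_map_add_left)

lemma formal_rmult_add_right:
  "formal_rmult x (b + b') - (formal_rmult x b + formal_rmult x b') \<in> tensor_nbhd s t F G m"
  unfolding formal_rmult_def distrib_left by (rule formal_tensor_map_add_right)

lemma formal_lmult_scale:
  "formal_lmult (cga_scale c a) x - pm_scale c (formal_lmult a x) \<in> tensor_nbhd cga_scale t F G m"
  unfolding formal_lmult_def cga_scale_mult[symmetric] by (rule formal_tensor_map_scale_left)

lemma formal_rmult_scale:
  "formal_rmult x (cga_scale c b) - pm_scale c (formal_rmult x b) \<in> tensor_nbhd s cga_scale F G m"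
  unfolding formal_rmult_def cga_mult_scale by (rule formal_tensor_map_scale_right)

lemma cga_of_single: "cga_of (Poly_Mapping.single g c) = cga_scale c (cga_group g)"
  by (simp add: cga_group_def flip: cga_of_scale)

lemma tensor_nbhd_cong:
  "x - y \<in> tensor_nbhd s t F G m \<Longrightarrow> y \<in> tensor_nbhd s t F G m \<Longrightarrow> x \<in> tensor_nbhd s t F G m"
  using tensor_nbhd_add by fastforce

lemma cga_lim_approx:
  assumes "filt_cauchy aug_pow X"
  shows "\<exists>M. \<forall>i\<ge>M. cga_lim X - cga_of (X i) \<in> cga_filt m"
proof -
  obtain M where M: "\<forall>i\<ge>M. \<forall>j\<ge>M. X i - X j \<in> aug_pow m"
    using assms unfolding filt_cauchy_def by blast
  have "cga_lim X - cga_of (X i) \<in> cga_filt m" if "i \<ge> M" for i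
    using M that assms unfolding cga_of_def
    by (auto simp: cga_lim_diff aug.filt_cauchy_const cga_lim_mem_filt_iff cga_c.filt_cauchy_diff)
  then show ?thesis by blast
qed

text \<open>On group elements the Leibniz rule is required exactly, among formal tensors.
  Multiplication is linear in the multiplying element only modulo the tensor relations, so the
  linear extension satisfies the rule only modulo these.\<close>

locale formal_double_derivation =
  fixes \<delta> :: "'g::group_add \<Rightarrow> ('g, 'k::field) cga \<times> ('g, 'k) cga \<Rightarrow>\<^sub>0 'k"
  assumes \<delta>_add: "\<delta> (g + h) = formal_lmult (cga_group g) (\<delta> h) + formal_rmult (\<delta> g) (cga_group h)"
begin

abbreviation "D \<equiv> pm_extend \<delta>"

text \<open>The failure of the Leibniz rule. It is biadditive modulo the relations, so it has to be
  controlled on multiples of single group elements only.\<close>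

definition defect where
  "defect x y = D (x * y) - (formal_lmult (cga_of x) (D y) + formal_rmult (D x) (cga_of y))"

lemma defect_add_left:
  "defect (x + x') y - (defect x y + defect x' y) \<in> tensor_nbhd s t F G m"
proof -
  have "defect (x + x') y - (defect x y + defect x' y) =
      - (formal_lmult (cga_of x + cga_of x') (D y) -
        (formal_lmult (cga_of x) (D y) + formal_lmult (cga_of x') (D y)))"
    by (simp add: defect_def distrib_right pm_extend_add cga_of_add formal_rmult_def
        formal_tensor_map_add algebra_simps)
  then show ?thesis using tensor_nbhd_uminus[OF formal_lmult_add_left] by simp
qed

lemma defect_add_right:
  "defect x (y + y') - (defect x y + defect x y') \<in> tensor_nbhd s t F G m"
proof -
  have "defect x (y + y') - (defect x y + defect x y') =
      - (formal_rmult (D x) (cga_of y + cga_of y') -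
        (formal_rmult (D x) (cga_of y) + formal_rmult (D x) (cga_of y')))"
    by (simp add: defect_def distrib_left pm_extend_add cga_of_add formal_lmult_def
        formal_tensor_map_add algebra_simps)
  then show ?thesis using tensor_nbhd_uminus[OF formal_rmult_add_right] by simp
qed

lemma defect_single:
  "defect (Poly_Mapping.single g c) (Poly_Mapping.single h d) \<in>
    tensor_nbhd cga_scale cga_scale F G m"
proof -
  let ?l = "formal_lmult (cga_scale c (cga_group g)) (\<delta> h) -
    pm_scale c (formal_lmult (cga_group g) (\<delta> h))"
  let ?r = "formal_rmult (\<delta> g) (cga_scale d (cga_group h)) -
    pm_scale d (formal_rmult (\<delta> g) (cga_group h))"
  have "defect (Poly_Mapping.single g c) (Poly_Mapping.single h d) =
      - (pm_scale d ?l + pm_scale c ?r)"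
    by (simp add: defect_def mult_single \<delta>_add cga_of_single formal_lmult_def formal_rmult_def
        formal_tensor_map_scale pm.scale_right_distrib pm.scale_right_diff_distrib mult.commute
        algebra_simps)
  moreover have "?l \<in> tensor_nbhd cga_scale cga_scale F G m"
    "?r \<in> tensor_nbhd cga_scale cga_scale F G m"
    by (rule formal_lmult_scale, rule formal_rmult_scale)
  ultimately show ?thesis
    by (simp only:) (intro tensor_nbhd_uminus tensor_nbhd_add tensor_nbhd_scale)
qed

lemma defect: "defect x y \<in> tensor_nbhd cga_scale cga_scale F G m"
proof (induction x rule: pm_induct)
  case zero
  have "formal_lmult 0 z \<in> tensor_nbhd cga_scale cga_scale F G m" for z
    using tensor_nbhd_uminus[OF formal_lmult_add_left[of 0 0 z]] by simp
  then show ?case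
    by (simp add: defect_def cga_of_0 formal_rmult_def tensor_nbhd_uminus)
next
  case (add g c x)
  have "defect (Poly_Mapping.single g c) y \<in> tensor_nbhd cga_scale cga_scale F G m"
  proof (induction y rule: pm_induct)
    case zero
    have "formal_rmult z 0 \<in> tensor_nbhd cga_scale cga_scale F G m" for z
      using tensor_nbhd_uminus[OF formal_rmult_add_right[of z 0 0]] by simp
    then show ?case
      by (simp add: defect_def cga_of_0 formal_lmult_def tensor_nbhd_uminus)
  next
    case (add h d y)
    show ?case
      by (rule tensor_nbhd_cong[OF defect_add_right tensor_nbhd_add[OF defect_single add]])
  qed
  from tensor_nbhd_cong[OF defect_add_left tensor_nbhd_add[OF this add]] show ?case .
qed

text \<open>
  Applied to a product of \<open>j\<close> elements of the augmentation ideal, the Leibniz rule yields terms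
  with \<open>j - 1\<close> factors distributed over the two sides.
\<close>

lemma D_filt:
  "x \<in> aug_pow j \<Longrightarrow> p + q < j \<Longrightarrow>
    D x \<in> tensor_nbhd cga_scale cga_scale (\<lambda>_. cga_filt p) (\<lambda>_. cga_filt q) 0"
proof (induction j arbitrary: x p q)
  case (Suc j)
  \<comment> \<open>Constant filtrations allow a different order on each side; the index is then
    immaterial.\<close>
  let ?T = "tensor_nbhd cga_scale cga_scale (\<lambda>_. cga_filt p) (\<lambda>_. cga_filt q) 0"
  have "x \<in> pm.span {x * y |x y. x \<in> augmentation_ideal \<and> y \<in> aug_pow j}"
    using Suc.prems(1) by simp
  then show ?case
  proof (induction rule: pm.span_induct_alt)
    case base
    then show ?case by (simp add: tensor_nbhd_0)
  next
    case (step c a b)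
    then obtain y z where a: "a = y * z" and y: "y \<in> augmentation_ideal" and z: "z \<in> aug_pow j"
      by blast
    \<comment> \<open>The factor \<open>y\<close> raises the order on the left by one, so the
      induction hypothesis is needed for \<open>p - 1\<close> only. In the other Leibniz term,
      \<open>z\<close> supplies the order \<open>q\<close> on the right, as \<open>q\<close> is at
      most \<open>j\<close>.\<close>
    have "formal_lmult (cga_of y) (D z) \<in> ?T"
    proof (cases p)
      case 0
      then show ?thesis
        unfolding formal_lmult_def by (intro formal_tensor_map_small) (simp add: cga_filt_0)
    next
      case (Suc p')
      then have "D z \<in> tensor_nbhd cga_scale cga_scale (\<lambda>_. cga_filt p') (\<lambda>_. cga_filt q) 0"
        using Suc.prems Suc.IH[OF z, of p' q] by simp
      then show ?thesis
        unfolding formal_lmult_def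
        by (rule formal_tensor_map_nbhd[rotated -1])
          (simp_all add: Suc distrib_left cga_mult_scale cga_filt_mult_aug y)
    qed
    moreover have "w * cga_of z \<in> cga_filt q" for w
      using Suc.prems(2) z cga.antimono[of q j] by (auto simp: cga_of_mem_filt_iff intro!: cga_filt_mult_left)
    then have "formal_rmult (D y) (cga_of z) \<in> ?T"
      unfolding formal_rmult_def by (intro formal_tensor_map_small) simp
    ultimately have "D a \<in> ?T"
      using defect[of y z] tensor_nbhd_add unfolding a defect_def by (metis (no_types, lifting) tensor_nbhd_cong)
    with step show ?case
      by (simp add: pm_extend_add pm_extend_scale tensor_nbhd_add tensor_nbhd_scale)
  qed
qed simp

lemma D_bounded: "filt_bounded aug_pow cga2_nbhd D"
proof (rule filt_boundedI)
  \<comment> \<open>Order \<open>m\<close> on both sides costs \<open>m + m\<close> factors, and one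
    more is differentiated.\<close>
  fix m x assume "x \<in> (aug_pow (Suc (m + m)) :: ('g \<Rightarrow>\<^sub>0 'k) set)"
  then have "D x \<in> tensor_nbhd cga_scale cga_scale (\<lambda>_. cga_filt m) (\<lambda>_. cga_filt m) 0"
    by (rule D_filt) simp
  then show "D x \<in> cga2_nbhd m"
    by (simp add: tensor_nbhd_def)
qed

sublocale completion_map aug_pow cga_lim rep_cga cga2_nbhd cga2_lim rep_cga2 D
  by (intro completion_map.intro completion_map_axioms.intro cga_c.completion_axioms
      cga2_c.completion_axioms pm_extend_add D_bounded)

definition D_hat :: "('g, 'k) cga \<Rightarrow> ('g, 'k) cga2" where
  "D_hat = cga_c.extend cga2_lim D"

lemmas D_hat_lim = extend_lim[folded D_hat_def]

lemma D_hat_group: "D_hat (cga_group g) = cga2_lim (\<lambda>_. \<delta> g)"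
  by (simp add: cga_group_def cga_of_def D_hat_lim aug.filt_cauchy_const)

lemma D_hat_cont_linear: "cont_linear cga_scale cga2_scale cga_filt cga2_filt D_hat"
  unfolding cont_linear_def
proof (intro conjI allI)
  show "D_hat (x + y) = D_hat x + D_hat y" for x y
    unfolding D_hat_def by (rule extend_add)
  show "filt_bounded cga_filt cga2_filt D_hat"
    using extend_bounded unfolding hat_cga hat_cga2 D_hat_def .
  fix c and x :: "('g, 'k) cga"
  obtain X where X: "x = cga_lim X" "filt_cauchy aug_pow X" by (rule cga_c.lim_cases)
  have "filt_cauchy aug_pow (\<lambda>i. pm_scale c (X i))"
    using X(2) unfolding filt_cauchy_def
    by (metis pm.scale_right_diff_distrib pm.subspace_scale subspace_aug_pow)
  with X show "D_hat (cga_scale c x) = cga2_scale c (D_hat x)"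
    by (simp add: cga_scale_lim D_hat_lim pm_extend_scale cga2_scale_lim cauchy)
qed

text \<open>\<open>x\<close> and \<open>y\<close> multiply tensors as elements of the completion,
  whereas \<open>defect\<close> concerns their approximations in the group algebra. The difference
  is harmless because multiplying by an element of \<open>cga_filt m\<close> makes every formal
  tensor small.\<close>

lemma D_hat_mult: "D_hat (x * y) = cga2_lmult x (D_hat y) + cga2_rmult (D_hat x) y"
proof -
  obtain X where X: "x = cga_lim X" "filt_cauchy aug_pow X" by (rule cga_c.lim_cases)
  obtain Y where Y: "y = cga_lim Y" "filt_cauchy aug_pow Y" by (rule cga_c.lim_cases)
  let ?L = "\<lambda>i. formal_lmult x (D (Y i))" and ?R = "\<lambda>i. formal_rmult (D (X i)) y"
  have L: "filt_cauchy cga2_nbhd ?L"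
    unfolding formal_lmult_def by (intro cga2_map_cauchy cga_end_lmult cont_linear_id cauchy Y)
  have R: "filt_cauchy cga2_nbhd ?R"
    unfolding formal_rmult_def by (intro cga2_map_cauchy cga_end_rmult cont_linear_id cauchy X)
  have XY: "filt_cauchy aug_pow (\<lambda>i. X i * Y i)"
    by (intro filt_cauchy_mult X Y)
  have "cga2_lmult x (D_hat y) = cga2_lim ?L"
    unfolding cga2_lmult_def id_def formal_lmult_def
    by (simp add: Y D_hat_lim cga2_map_lim cga_end_lmult cont_linear_id cauchy)
  moreover have "cga2_rmult (D_hat x) y = cga2_lim ?R"
    unfolding cga2_rmult_def id_def formal_rmult_def
    by (simp add: X D_hat_lim cga2_map_lim cga_end_rmult cont_linear_id cauchy)
  moreover have "D_hat (x * y) = cga2_lim (\<lambda>i. D (X i * Y i))"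
    unfolding X(1) Y(1) cga_lim_mult[OF X(2) Y(2)] by (rule D_hat_lim[OF XY])
  moreover have "cga2_lim (\<lambda>i. D (X i * Y i)) = cga2_lim (\<lambda>i. ?L i + ?R i)"
  proof (rule cga2_c.lim_eqI[OF cauchy[OF XY] cga2.filt_cauchy_add[OF L R]])
    show "filt_null cga2_nbhd (\<lambda>i. D (X i * Y i) - (?L i + ?R i))"
      unfolding filt_null_def
    proof
      fix m
      obtain A B where A: "\<forall>i\<ge>A. x - cga_of (X i) \<in> cga_filt m"
        and B: "\<forall>i\<ge>B. y - cga_of (Y i) \<in> cga_filt m"
        using cga_lim_approx[OF X(2)] cga_lim_approx[OF Y(2)] X(1) Y(1) by meson
      have "D (X i * Y i) - (?L i + ?R i) \<in> cga2_nbhd m" if i: "i \<ge> max A B" for i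
      proof -
        let ?x = "cga_of (X i)" and ?y = "cga_of (Y i)"
        have "(x - ?x) * v \<in> cga_filt m" "w * (y - ?y) \<in> cga_filt m" for v w
          using A B i by (simp_all add: cga_filt_mult_left cga_filt_mult_right)
        then have small: "formal_lmult (x - ?x) (D (Y i)) \<in> cga2_nbhd m"
          "formal_rmult (D (X i)) (y - ?y) \<in> cga2_nbhd m"
          unfolding formal_lmult_def formal_rmult_def by (simp_all add: formal_tensor_map_small)
        have l: "?L i - (formal_lmult (x - ?x) (D (Y i)) + formal_lmult ?x (D (Y i))) \<in> cga2_nbhd m"
          using formal_lmult_add_left[of "x - ?x" ?x "D (Y i)" cga_scale cga_scale cga_filt cga_filt m] by simp
        have r: "?R i - (formal_rmult (D (X i)) (y - ?y) + formal_rmult (D (X i)) ?y) \<in> cga2_nbhd m"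
          using formal_rmult_add_right[of "D (X i)" "y - ?y" ?y cga_scale cga_scale cga_filt cga_filt m] by simp
        \<comment> \<open>Five small errors add up: the Leibniz defect, the failure of additivity in
          the left and in the right multiplier, and the two remainders of the approximation.\<close>
        have "defect (X i) (Y i)
            - (?L i - (formal_lmult (x - ?x) (D (Y i)) + formal_lmult ?x (D (Y i))))
            - (?R i - (formal_rmult (D (X i)) (y - ?y) + formal_rmult (D (X i)) ?y))
            - formal_lmult (x - ?x) (D (Y i)) - formal_rmult (D (X i)) (y - ?y) \<in> cga2_nbhd m"
          by (rule tensor_nbhd_diff[OF tensor_nbhd_diff[OF tensor_nbhd_diff[OF
                  tensor_nbhd_diff[OF defect l] r] small(1)] small(2)])
        then show ?thesis by (simp add: defect_def algebra_simps)
      qed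
      then show "\<exists>M. \<forall>i\<ge>M. D (X i * Y i) - (?L i + ?R i) \<in> cga2_nbhd m" by blast
    qed
  qed
  ultimately show ?thesis
    using L R by (simp add: cga2_c.lim_add)
qed

end

definition double_derivation :: "(('g::group_add, 'k::field) cga \<Rightarrow> ('g, 'k) cga2) \<Rightarrow> bool" where
  "double_derivation D \<longleftrightarrow> cont_linear cga_scale cga2_scale cga_filt cga2_filt D \<and>
     (\<forall>a b. D (a * b) = cga2_lmult a (D b) + cga2_rmult (D a) b)"

text \<open>The conditions defining \<open>cga_partial\<close>, on \<open>cga_group h\<close>
  instead of \<open>cga_group h - 1\<close>; the two agree because a double derivation kills
  1.\<close>

definition is_partial :: "'g::group_add set \<Rightarrow> 'g \<Rightarrow> (('g, 'k::field) cga \<Rightarrow> ('g, 'k) cga2) \<Rightarrow> bool" where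
  "is_partial S g D \<longleftrightarrow> double_derivation D \<and>
     (\<forall>h\<in>S. D (cga_group h) = (if h = g then cga_tensor 1 1 else 0))"

lemma double_derivation_cont_linear:
  "double_derivation D \<Longrightarrow> cont_linear cga_scale cga2_scale cga_filt cga2_filt D"
  by (simp add: double_derivation_def)

lemmas double_derivation_linear =
  cont_linear_add[OF double_derivation_cont_linear] cont_linear_diff[OF double_derivation_cont_linear]
  cont_linear_scale[OF double_derivation_cont_linear] cont_linear_0[OF double_derivation_cont_linear]

lemma double_derivation_uminus: "double_derivation D \<Longrightarrow> D (- a) = - D a"
  using double_derivation_linear(2)[of D 0 a] double_derivation_linear(4)[of D] by simp

lemma double_derivation_mult:
  "double_derivation D \<Longrightarrow> D (a * b) = cga2_lmult a (D b) + cga2_rmult (D a) b"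
  by (simp add: double_derivation_def)

lemma cga2_lmult_1 [simp]: "cga2_lmult 1 x = x" and cga2_rmult_1 [simp]: "cga2_rmult x 1 = x"
  by (simp_all add: cga2_lmult_def cga2_rmult_def id_def cga2_map_id)

lemma double_derivation_1: "double_derivation D \<Longrightarrow> D 1 = 0"
  using double_derivation_mult[of D 1 1] by simp

lemma cga2_lmult_lmult: "cga2_lmult a (cga2_lmult b x) = cga2_lmult (a * b) x"
  unfolding cga2_lmult_def id_def
  by (simp add: cga2_map_comp cga_end_lmult cont_linear_id flip: mult.assoc)

lemma cga2_lmult_add: "cga2_lmult a (x + y) = cga2_lmult a x + cga2_lmult a y"
  unfolding cga2_lmult_def id_def by (simp add: cga2_map_add cga_end_lmult cont_linear_id)

lemma cga2_rmult_add: "cga2_rmult (x + y) a = cga2_rmult x a + cga2_rmult y a"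
  unfolding cga2_rmult_def id_def by (simp add: cga2_map_add cga_end_rmult cont_linear_id)

lemma cga2_lmult_0 [simp]: "cga2_lmult a 0 = 0" and cga2_rmult_0 [simp]: "cga2_rmult 0 a = 0"
  using cga2_lmult_add[of a 0 0] cga2_rmult_add[of 0 0 a] by simp_all

lemma cga2_lmult_uminus: "cga2_lmult a (- x) = - cga2_lmult a x"
  and cga2_rmult_uminus: "cga2_rmult (- x) a = - cga2_rmult x a"
  using cga2_lmult_add[of a x "- x"] cga2_rmult_add[of x "- x" a] by (simp_all add: eq_neg_iff_add_eq_0 add.commute)

lemma cga2_lmult_tensor [simp]: "cga2_lmult c (cga_tensor a b) = cga_tensor (c * a) b"
  and cga2_rmult_tensor [simp]: "cga2_rmult (cga_tensor a b) c = cga_tensor a (b * c)"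
  by (simp_all add: cga2_lmult_def cga2_rmult_def id_def cga_end_lmult cga_end_rmult cont_linear_id)

lemma double_derivation_group_inverse:
  assumes D: "double_derivation D"
  shows "D (cga_group (- g)) = - cga2_lmult (cga_group (- g)) (cga2_rmult (D (cga_group g)) (cga_group (- g)))"
proof -
  have "cga2_lmult (cga_group g) (D (cga_group (- g))) + cga2_rmult (D (cga_group g)) (cga_group (- g)) = 0"
    using double_derivation_mult[OF D, of "cga_group g" "cga_group (- g)"] double_derivation_1[OF D]
    by simp
  then have "cga2_lmult (cga_group g) (D (cga_group (- g))) = - cga2_rmult (D (cga_group g)) (cga_group (- g))"
    by (simp add: eq_neg_iff_add_eq_0)
  then have "cga2_lmult (cga_group (- g)) (cga2_lmult (cga_group g) (D (cga_group (- g)))) =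
      cga2_lmult (cga_group (- g)) (- cga2_rmult (D (cga_group g)) (cga_group (- g)))"
    by simp
  then show ?thesis by (simp add: cga2_lmult_lmult cga2_lmult_uminus)
qed

text \<open>The Leibniz rule passes from \<open>S\<close> to all group elements, linearity to the
  group algebra, and density together with separation to the completion.\<close>

lemma double_derivation_eqI:
  assumes S: "generates S" and D: "double_derivation D" and D': "double_derivation D'"
    and eq: "\<And>s. s \<in> S \<Longrightarrow> D (cga_group s) = D' (cga_group s)"
  shows "D = D'"
proof
  fix x
  note lin = double_derivation_linear[OF D] double_derivation_linear[OF D']
  have group: "D (cga_group g) = D' (cga_group g)" for g
    using S
  proof (induction g rule: generates_induct)
    case zero
    then show ?case by (simp add: cga_group_0 double_derivation_1 D D')
  next
    case (letter l g)
    then have "D (cga_group (letter_value l)) = D' (cga_group (letter_value l))"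
      by (auto simp: letter_value_def eq double_derivation_group_inverse D D')
    with letter show ?case
      by (simp add: cga_group_add double_derivation_mult D D')
  qed
  have dense: "D (cga_of a) = D' (cga_of a)" for a
    by (induction a rule: pm_induct) (simp_all add: cga_of_0 cga_of_add cga_of_single lin group)
  have "D x - D' x \<in> cga2_filt m" for m
  proof -
    obtain k k' where k: "\<forall>x\<in>cga_filt k. D x \<in> cga2_filt m" "\<forall>x\<in>cga_filt k'. D' x \<in> cga2_filt m"
      using D D' unfolding double_derivation_def cont_linear_def filt_bounded_def by meson
    obtain a where a: "x - cga_of a \<in> cga_filt (max k k')" using cga_dense by blast
    then have "x - cga_of a \<in> cga_filt k" "x - cga_of a \<in> cga_filt k'"
      using cga.antimono[of k "max k k'"] cga.antimono[of k' "max k k'"] by auto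
    with k have "D (x - cga_of a) - D' (x - cga_of a) \<in> cga2_filt m"
      by (blast intro: filtration.diff_mem[OF filtration_cga2_filt])
    then show ?thesis by (simp add: lin dense)
  qed
  then show "D x = D' x" using cga2_hausdorff[of "D x - D' x"] by simp
qed

lemma is_partial_iff:
  "is_partial S g D \<longleftrightarrow> continuous_on UNIV D \<and> Vector_Spaces.linear cga_scale cga2_scale D \<and>
     (\<forall>h\<in>S. D (cga_group h - 1) = (if h = g then cga_tensor 1 1 else 0)) \<and>
     (\<forall>a b. D (a * b) = cga2_lmult a (D b) + cga2_rmult (D a) b)" (is "_ \<longleftrightarrow> ?R")
proof
  assume D: "is_partial S g D"
  then have dd: "double_derivation D" by (simp add: is_partial_def)
  have "continuous_on UNIV D"
    by (rule filt_bounded_continuous[OF open_cga_def open_cga2_def double_derivation_linear(2)[OF dd]])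
      (rule cont_linear_bounded[OF double_derivation_cont_linear[OF dd]])
  moreover have "Vector_Spaces.linear cga_scale cga2_scale D"
    by unfold_locales (simp_all add: double_derivation_linear[OF dd])
  ultimately show ?R
    using D double_derivation_1[OF dd]
    by (simp add: is_partial_def double_derivation_linear[OF dd] double_derivation_mult[OF dd])
next
  assume R: ?R
  then interpret D: Vector_Spaces.linear cga_scale cga2_scale D by blast
  have "filt_bounded cga_filt cga2_filt D"
    by (rule continuous_filt_bounded[OF open_cga_def open_cga2_def filtration_cga2_filt D.diff])
      (use R in blast)
  then have dd: "double_derivation D"
    using R by (auto simp: double_derivation_def cont_linear_def D.add D.scale)
  with R show "is_partial S g D"
    by (simp add: is_partial_def D.diff double_derivation_1)
qed

lemma cga_partial_eq:
  fixes D :: "('g::group_add, 'k::field) cga \<Rightarrow> ('g, 'k) cga2"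
  assumes "generates S" "is_partial S g D"
  shows "cga_partial S g = D"
  unfolding cga_partial_def is_partial_iff[symmetric]
proof (rule the_equality)
  fix D' :: "('g, 'k) cga \<Rightarrow> ('g, 'k) cga2"
  assume "is_partial S g D'"
  with assms show "D' = D"
    by (intro double_derivation_eqI[of S]) (auto simp: is_partial_def)
qed fact

lemma is_partial_cga_partial:
  assumes free: "free_generating_set S"
  shows "is_partial S g (cga_partial S g :: ('g::group_add, 'k::field) cga \<Rightarrow> ('g, 'k) cga2)"
proof -
  \<comment> \<open>Multiplying a derivative of \<open>h\<close> on the right by \<open>h\<close>
    inverse turns the Leibniz rule into a crossed homomorphism for this action. The prescribed value
    1 tensor 1 at \<open>g\<close> becomes 1 tensor \<open>g\<close> inverse.\<close>
  define act :: "'g \<Rightarrow> (('g, 'k) cga \<times> ('g, 'k) cga \<Rightarrow>\<^sub>0 'k) \<Rightarrow> _" where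
    "act h = formal_tensor_map (\<lambda>v. cga_group h * v) (\<lambda>w. w * cga_group (- h))" for h
  obtain d where d: "\<And>h k. d (h + k) = d h + act h (d k)"
    "\<And>s. s \<in> S \<Longrightarrow> d s = (if s = g then Poly_Mapping.single (1, cga_group (- g)) 1 else 0)"
    by (rule free_crossed_hom[OF free, of act
          "\<lambda>s. if s = g then Poly_Mapping.single (1, cga_group (- g)) 1 else 0"])
      (auto simp: act_def formal_tensor_map_add formal_tensor_map_comp cga_group_add cga_group_0
        formal_tensor_map_id minus_add mult.assoc simp del: add_uminus_conv_diff)
  define \<delta> where "\<delta> h = formal_rmult (d h) (cga_group h)" for h
  interpret formal_double_derivation \<delta>
  proof
    show "\<delta> (h + k) = formal_lmult (cga_group h) (\<delta> k) + formal_rmult (\<delta> h) (cga_group k)" for h k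
      by (simp add: \<delta>_def d(1) act_def formal_lmult_def formal_rmult_def formal_tensor_map_add
          formal_tensor_map_comp cga_group_add mult.assoc)
  qed
  have "is_partial S g D_hat"
    unfolding is_partial_def double_derivation_def
    by (auto simp: D_hat_cont_linear D_hat_mult D_hat_group \<delta>_def d(2) formal_rmult_def cga_tensor_def)
  with cga_partial_eq[OF free_generates[OF free] this] show ?thesis by simp
qed

section \<open>Derivations and logarithms\<close>

lemma cga_derivation_cont_linear: "u \<in> cga_derivations \<Longrightarrow> cga_end u"
proof -
  assume u: "u \<in> cga_derivations"
  then interpret u: Vector_Spaces.linear cga_scale cga_scale u
    by (simp add: cga_derivations_def)
  have "filt_bounded cga_filt cga_filt u"
    by (rule continuous_filt_bounded[OF open_cga_def open_cga_def cga.filtration_axioms u.diff])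
      (use u in \<open>simp add: cga_derivations_def\<close>)
  then show ?thesis by (simp add: cont_linear_def u.add u.scale)
qed

lemma cga_derivationI:
  fixes u :: "('g::group_add, 'k::field) cga \<Rightarrow> ('g, 'k) cga"
  assumes "cga_end u" "\<And>a b. u (a * b) = u a * b + a * u b"
  shows "u \<in> cga_derivations"
proof -
  have "continuous_on UNIV u"
    by (rule filt_bounded_continuous[OF open_cga_def open_cga_def cont_linear_diff[OF assms(1)]
          cont_linear_bounded[OF assms(1)]])
  moreover have "Vector_Spaces.linear cga_scale cga_scale u"
    by unfold_locales (simp_all add: cont_linear_add[OF assms(1)] cont_linear_scale[OF assms(1)])
  ultimately show ?thesis using assms(2) by (simp add: cga_derivations_def)
qed

locale derivation =
  fixes u :: "('g::group_add, 'k::field) cga \<Rightarrow> ('g, 'k) cga"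
  assumes u: "u \<in> cga_derivations"
begin

lemmas u_end = cga_derivation_cont_linear[OF u]
  and u_add = cont_linear_add[OF cga_derivation_cont_linear[OF u]]
  and u_diff = cont_linear_diff[OF cga_derivation_cont_linear[OF u]]
  and u_scale = cont_linear_scale[OF cga_derivation_cont_linear[OF u]]
  and u_0 = cont_linear_0[OF cga_derivation_cont_linear[OF u]]

lemma u_mult: "u (a * b) = u a * b + a * u b"
  using u by (simp add: cga_derivations_def)

lemma u_1: "u 1 = 0"
  using u_mult[of 1 1] by simp

lemma u_group_inverse: "u (cga_group (- g)) = - (cga_group (- g) * u (cga_group g) * cga_group (- g))"
proof -
  have "cga_group g * u (cga_group (- g)) = - (u (cga_group g) * cga_group (- g))"
    using u_mult[of "cga_group g" "cga_group (- g)"] u_1 by (simp add: eq_neg_iff_add_eq_0 add.commute)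
  then have "cga_group (- g) * (cga_group g * u (cga_group (- g))) =
      cga_group (- g) * - (u (cga_group g) * cga_group (- g))" by simp
  then show ?thesis by (simp add: mult.assoc)
qed

text \<open>The value of \<open>u\<close> on \<open>\<bar>log g\<bar>\<close>, see \<open>cyc_map_log\<close> below.\<close>

definition dlog :: "'g \<Rightarrow> ('g, 'k) cyc" where
  "dlog g = cyc_class (u (cga_group g) * cga_group (- g))"

text \<open>The logarithmic derivative is a crossed homomorphism for conjugation, and conjugation is
  invisible in cyclic words.\<close>

lemma dlog_add: "dlog (g + h) = dlog g + dlog h"
proof -
  have "u (cga_group (g + h)) * cga_group (- (g + h)) =
      u (cga_group g) * cga_group (- g) + cga_group g * (u (cga_group h) * cga_group (- h)) * cga_group (- g)"
    by (simp add: cga_group_add u_mult minus_add distrib_right mult.assoc del: add_uminus_conv_diff)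
  moreover have "cyc_class (cga_group g * (u (cga_group h) * cga_group (- h)) * cga_group (- g)) = dlog h"
    by (subst cyc_class_mult_commute) (simp add: dlog_def)
  ultimately show ?thesis by (simp add: dlog_def cyc_class_add)
qed

lemma dlog_0: "dlog 0 = 0" and dlog_uminus: "dlog (- g) = - dlog g"
  using hom_zero[of dlog, OF dlog_add] by blast+

lemma dlog_diff: "dlog (g - h) = dlog g - dlog h"
  using dlog_add[of g "- h"] by (simp add: dlog_uminus)

lemma dlog_commute: "cyc_class (cga_group (- g) * u (cga_group g)) = dlog g"
  unfolding dlog_def by (rule cyc_class_mult_commute)

lemma dlog_commutator_subgroup: "x \<in> commutator_subgroup \<Longrightarrow> dlog x = 0"
  by (induction rule: commutator_subgroup.induct)
    (simp_all add: dlog_0 dlog_add dlog_uminus dlog_diff)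

lemma dlog_rep_H1: "dlog (rep_H1 (H1_class g)) = dlog g"
proof -
  have "rep_H1 (H1_class g) - g \<in> commutator_subgroup"
    by (simp add: H1_class_rep flip: H1_class_eq_iff)
  then have "dlog (rep_H1 (H1_class g) - g) = 0"
    by (rule dlog_commutator_subgroup)
  then show ?thesis
    by (simp add: dlog_diff)
qed

lemma u_commutators: "a \<in> cga_commutators \<Longrightarrow> u a \<in> cga_commutators"
proof -
  let ?S = "cga.span {a * b - b * a | a b :: ('g, 'k) cga. True}"
  assume a: "a \<in> cga_commutators"
  have span: "u s \<in> ?S" if "s \<in> ?S" for s
    using that
  proof (induction rule: cga.span_induct_alt)
    case base
    then show ?case by (simp add: u_0 cga.span_zero)
  next
    case (step c x y)
    then obtain a b where x: "x = a * b - b * a" by blast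
    have "u x = (u a * b - b * u a) + (a * u b - u b * a)"
      by (simp add: x u_diff u_mult)
    moreover have "u a * b - b * u a \<in> ?S" "a * u b - u b * a \<in> ?S"
      by (rule cga.span_base, blast)+
    ultimately have "u x \<in> ?S" by (simp add: cga.span_add)
    with step show ?case by (simp add: u_add u_scale cga.span_add cga.span_scale)
  qed
  show ?thesis
    unfolding cga_commutators_def closure_cga_iff
  proof
    fix m
    obtain k where k: "\<forall>x\<in>cga_filt k. u x \<in> cga_filt m"
      using cont_linear_bounded[OF u_end] unfolding filt_bounded_def by blast
    obtain s where "s \<in> ?S" "s - a \<in> cga_filt k"
      using a unfolding cga_commutators_def closure_cga_iff by blast
    then show "\<exists>s\<in>?S. s - u a \<in> cga_filt m"
      using k span by (intro bexI[of _ "u s"]) (auto simp flip: u_diff)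
  qed
qed

lemma cyc_map_class: "cyc_map u (cyc_class a) = cyc_class (u a)"
proof -
  have "u (rep_cyc (cyc_class a) - a) \<in> cga_commutators"
    by (rule u_commutators) (simp add: cyc_class_rep flip: cyc_class_eq_iff)
  then show ?thesis by (simp add: cyc_map_def cyc_class_eq_iff u_diff)
qed

lemma cyc_induct: "(\<And>a. P (cyc_class a)) \<Longrightarrow> P x"
  by (metis cyc_class_rep)

lemma cyc_map_end: "cyc_end (cyc_map u)"
  unfolding cont_linear_def
proof (intro conjI allI)
  show "cyc_map u (x + y) = cyc_map u x + cyc_map u y" for x y
    by (induction x rule: cyc_induct; induction y rule: cyc_induct)
      (simp add: cyc_map_class u_add flip: cyc_class_add)
  show "cyc_map u (cyc_scale c x) = cyc_scale c (cyc_map u x)" for c x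
    by (induction x rule: cyc_induct) (simp add: cyc_map_class u_scale flip: cyc_class_scale)
  show "filt_bounded cyc_filt cyc_filt (cyc_map u)"
    using cont_linear_bounded[OF u_end] unfolding filt_bounded_def cyc_filt_def
    by (fastforce simp: cyc_map_class)
qed

lemma cyc_tensor_0: "cyc_tensor x 0 = 0" "cyc_tensor 0 x = 0"
  using cyc_tensor_add_right[of x 0 0] cyc_tensor_add_left[of 0 0 x] by simp_all

lemma der_act_tensor:
  "der_act u (cyc_tensor x y - cyc_tensor z w) =
    cyc_tensor (cyc_map u x) y + cyc_tensor x (cyc_map u y)
    - (cyc_tensor (cyc_map u z) w + cyc_tensor z (cyc_map u w))"
  by (simp add: der_act_def id_def cyc2_map_diff cyc2_map_tensor cyc_map_end cont_linear_id)

lemma der_act_twisted_coproduct: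
  "der_act u (twisted_coproduct x) =
    cyc_tensor (cyc_map u x) (cyc_class 1) - cyc_tensor (cyc_class 1) (cyc_map u x)"
  by (simp add: twisted_coproduct_def der_act_tensor cyc_map_class u_1 cyc_class_0 cyc_tensor_0)

text \<open>The power rule holds modulo commutators only. The prefix \<open>z ^ i\<close> is there
  for the induction: it absorbs the trailing \<open>z\<close> when that is rotated to the
  front.\<close>

lemma cyc_class_power:
  "cyc_class (z ^ i * u (z ^ Suc k)) = cyc_class (cga_scale (of_nat (Suc k)) (z ^ (i + k) * u z))"
proof (induction k arbitrary: i)
  case (Suc k)
  have "z ^ i * u (z ^ Suc (Suc k)) = (z ^ i * u (z ^ Suc k)) * z + z ^ (i + Suc k) * u z"
    by (subst power_Suc2) (simp only: u_mult distrib_left mult.assoc power_add)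
  moreover have "cyc_class ((z ^ i * u (z ^ Suc k)) * z) = cyc_class (z ^ Suc i * u (z ^ Suc k))"
    by (subst cyc_class_mult_commute) (simp only: power_Suc mult.assoc)
  ultimately have "cyc_class (z ^ i * u (z ^ Suc (Suc k))) =
      cyc_class (cga_scale (of_nat (Suc k)) (z ^ (Suc i + k) * u z)) + cyc_class (z ^ (i + Suc k) * u z)"
    by (simp only: cyc_class_add Suc.IH)
  moreover have "cga_scale (of_nat (Suc (Suc k))) w = cga_scale (of_nat (Suc k)) w + w"
    for w :: "('g, 'k) cga"
    by (subst of_nat_Suc) (simp add: cga.scale_left_distrib add.commute del: of_nat_Suc)
  ultimately show ?case
    by (simp only: add_Suc add_Suc_right cyc_class_add)
qed simp

end

definition log_sum :: "('g::group_add, 'k::field_char_0) cga \<Rightarrow> nat \<Rightarrow> ('g, 'k) cga" where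
  "log_sum z n = (\<Sum>k<n. cga_scale ((- 1) ^ k / of_nat (Suc k)) (z ^ Suc k))"

lemma cga_group_minus_1: "cga_group g - 1 = cga_of (Poly_Mapping.single g 1 - 1)"
  by (simp add: cga_group_def cga_of_diff cga_of_1)

lemma single_minus_1_mem: "Poly_Mapping.single g 1 - 1 \<in> augmentation_ideal"
proof -
  have "augmentation (Poly_Mapping.single g 1 - 1 + 1 :: 'a \<Rightarrow>\<^sub>0 'b) = 1"
    by (simp add: augmentation_single)
  then have "augmentation (Poly_Mapping.single g 1 - 1 :: 'a \<Rightarrow>\<^sub>0 'b) + augmentation (1 :: 'a \<Rightarrow>\<^sub>0 'b) = 1"
    by (simp only: augmentation_add)
  then show ?thesis
    by (simp add: augmentation_ideal_def augmentation_single flip: single_one)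
qed

lemma aug_pow_power: "z \<in> augmentation_ideal \<Longrightarrow> z ^ n \<in> aug_pow n"
  by (induction n) (auto intro: pm.span_base)

lemma cga_power_mem: "(cga_group g - 1) ^ n \<in> cga_filt n"
proof (induction n)
  case (Suc n)
  then show ?case
    using cga_filt_mult_aug[OF single_minus_1_mem] by (simp add: cga_group_minus_1)
qed (simp add: cga_filt_0)

lemma cga_of_power: "cga_of (z ^ n) = cga_of z ^ n"
  by (induction n) (simp_all add: cga_of_1 cga_of_mult)

lemma cga_of_sum: "cga_of (\<Sum>i\<in>A. f i) = (\<Sum>i\<in>A. cga_of (f i))"
  by (induction A rule: infinite_finite_induct) (simp_all add: cga_of_0 cga_of_add)

lemma cga_tendsto_iff:
  fixes X :: "nat \<Rightarrow> ('g::group_add, 'k::field) cga"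
  shows "X \<longlonglongrightarrow> l \<longleftrightarrow> (\<forall>m. \<exists>M. \<forall>n\<ge>M. X n - l \<in> cga_filt m)"
proof
  assume X: "X \<longlonglongrightarrow> l"
  show "\<forall>m. \<exists>M. \<forall>n\<ge>M. X n - l \<in> cga_filt m"
  proof
    fix m
    have "open {y. y - l \<in> cga_filt m}" "l \<in> {y. y - l \<in> cga_filt m}"
      by (simp_all add: open_cga_def cga.filt_open_coset cga.zero_mem)
    from topological_tendstoD[OF X this] show "\<exists>M. \<forall>n\<ge>M. X n - l \<in> cga_filt m"
      by (simp add: eventually_sequentially)
  qed
next
  assume X: "\<forall>m. \<exists>M. \<forall>n\<ge>M. X n - l \<in> cga_filt m"
  show "X \<longlonglongrightarrow> l"
  proof (rule topological_tendstoI)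
    fix U assume "open U" "l \<in> U"
    then obtain m where "\<forall>y. y - l \<in> cga_filt m \<longrightarrow> y \<in> U"
      unfolding open_cga_def filt_open_def by blast
    with X show "\<forall>\<^sub>F n in sequentially. X n \<in> U"
      unfolding eventually_sequentially by meson
  qed
qed

text \<open>\<open>suminf\<close> is a definite description, so both convergence and, through
  \<open>cga_hausdorff\<close>, uniqueness of the limit have to be established before its value can
  be used.\<close>

lemma log_sum_tendsto: "\<exists>m0. \<forall>n\<ge>m0. log_sum (cga_group g - 1) n - cga_log g \<in> cga_filt m"
proof -
  let ?z = "Poly_Mapping.single g 1 - 1 :: 'a \<Rightarrow>\<^sub>0 'b"
  let ?Z = "cga_group g - 1 :: ('a, 'b) cga"
  define X where "X n = (\<Sum>k<n. pm_scale ((- 1) ^ k / of_nat (Suc k)) (?z ^ Suc k))" for n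
  have X_diff: "X (M + i) - X M \<in> aug_pow M" for M i
  proof (induction i)
    case (Suc i)
    have "?z ^ Suc (M + i) \<in> aug_pow M"
      using aug_pow_power[OF single_minus_1_mem[of g], of "Suc (M + i)"] aug.antimono[of M "Suc (M + i)"]
      by (auto simp del: aug_pow.simps)
    then have "pm_scale ((- 1) ^ (M + i) / of_nat (Suc (M + i))) (?z ^ Suc (M + i)) \<in> aug_pow M"
      by (rule pm.subspace_scale[OF subspace_aug_pow])
    from aug.add_mem[OF Suc this] show ?case
      by (simp add: X_def algebra_simps del: power_Suc of_nat_Suc)
  qed (simp add: aug.zero_mem)
  have X: "filt_cauchy aug_pow X"
    unfolding filt_cauchy_def
  proof (intro allI exI impI)
    fix m i j :: nat assume "i \<ge> m" "j \<ge> m"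
    then show "X i - X j \<in> aug_pow m"
      using aug.diff_mem[OF X_diff[of m "i - m"] X_diff[of m "j - m"]] by simp
  qed
  have cga_of_X: "cga_of (X n) = log_sum ?Z n" for n
    by (simp add: X_def log_sum_def cga_of_sum cga_of_scale cga_of_power cga_group_minus_1 del: power_Suc)
  have lim: "log_sum ?Z \<longlonglongrightarrow> cga_lim X"
    unfolding cga_tendsto_iff
  proof
    fix m
    obtain M where "\<forall>n\<ge>M. cga_lim X - cga_of (X n) \<in> cga_filt m"
      using cga_lim_approx[OF X] by blast
    then have "\<forall>n\<ge>M. - (cga_lim X - cga_of (X n)) \<in> cga_filt m"
      using cga.uminus_mem by blast
    then show "\<exists>M. \<forall>n\<ge>M. log_sum ?Z n - cga_lim X \<in> cga_filt m"
      by (auto simp: cga_of_X)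
  qed
  have "cga_log g = cga_lim X"
    unfolding cga_log_def suminf_def
  proof (rule the_equality)
    show "(\<lambda>k. cga_scale ((- 1) ^ k / of_nat (Suc k)) (?Z ^ Suc k)) sums cga_lim X"
      using lim unfolding sums_def log_sum_def[abs_def] .
    fix l assume "(\<lambda>k. cga_scale ((- 1) ^ k / of_nat (Suc k)) (?Z ^ Suc k)) sums l"
    then have l: "log_sum ?Z \<longlonglongrightarrow> l"
      unfolding sums_def log_sum_def[abs_def] .
    have "l - cga_lim X \<in> cga_filt m" for m
    proof -
      obtain A B where "\<forall>n\<ge>A. log_sum ?Z n - l \<in> cga_filt m"
          "\<forall>n\<ge>B. log_sum ?Z n - cga_lim X \<in> cga_filt m"
        using l lim unfolding cga_tendsto_iff by meson
      then have "(log_sum ?Z (max A B) - cga_lim X) - (log_sum ?Z (max A B) - l) \<in> cga_filt m"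
        by - (rule cga.diff_mem; simp)
      then show ?thesis by simp
    qed
    then show "l = cga_lim X" using cga_hausdorff[of "l - cga_lim X"] by simp
  qed
  with lim show ?thesis by (simp add: cga_tendsto_iff)
qed

lemma cyc_class_sum: "cyc_class (\<Sum>i\<in>A. f i) = (\<Sum>i\<in>A. cyc_class (f i))"
  by (induction A rule: infinite_finite_induct) (simp_all add: cyc_class_0 cyc_class_add)

lemma cyc_class_mem: "a \<in> cga_filt m \<Longrightarrow> cyc_class a \<in> cyc_filt m"
  by (simp add: cyc_filt_def)

locale derivation_char_0 = derivation u
  for u :: "('g::group_add, 'k::field_char_0) cga \<Rightarrow> ('g, 'k) cga"
begin

lemma u_sum: "u (\<Sum>i\<in>A. f i) = (\<Sum>i\<in>A. u (f i))"
  by (induction A rule: infinite_finite_induct) (simp_all add: u_0 u_add)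

text \<open>Modulo commutators, \<open>u\<close> maps the logarithm series to a geometric series.\<close>

lemma cyc_map_log: "cyc_map u (cyc_class (cga_log g)) = dlog g"
proof -
  let ?G = "cga_group g :: ('g, 'k) cga" and ?H = "cga_group (- g) :: ('g, 'k) cga"
  define z where "z = ?G - 1"
  define P where "P n = (\<Sum>k<n. cga_scale ((- 1) ^ k) (z ^ k))" for n
  have uz: "u z = u ?G" by (simp add: z_def u_diff u_1)
  have "cyc_class (u (cga_scale ((- 1) ^ k / of_nat (Suc k)) (z ^ Suc k))) =
      cyc_class (cga_scale ((- 1) ^ k) (z ^ k) * u z)" for k
    using cyc_class_power[of z 0 k] unfolding u_scale cyc_class_scale
    by (simp add: cga_scale_mult del: power_Suc of_nat_Suc flip: cyc_class_scale)
  then have u_log_sum: "cyc_class (u (log_sum z n)) = cyc_class (P n * u z)" for n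
    unfolding log_sum_def P_def u_sum cyc_class_sum sum_distrib_right by simp
  \<comment> \<open>\<open>P n\<close> is a partial sum of the geometric series for the inverse of
    \<open>1 + z\<close>, and \<open>?G\<close> is \<open>1 + z\<close>.\<close>
  have "P n * ?G = 1 - cga_scale ((- 1) ^ n) (z ^ n)" for n
  proof (induction n)
    case (Suc n)
    have "z ^ n * ?G = z ^ n + z ^ Suc n"
      by (simp only: power_Suc2) (simp add: z_def algebra_simps)
    then show ?case
      by (simp add: P_def distrib_right Suc[unfolded P_def] cga.scale_right_distrib
          flip: cga_scale_mult del: power_Suc) simp
  qed (simp add: P_def)
  then have "P n * ?G * ?H = (1 - cga_scale ((- 1) ^ n) (z ^ n)) * ?H" for n
    by simp
  then have P: "P n = ?H - cga_scale ((- 1) ^ n) (z ^ n) * ?H" for n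
    by (simp add: mult.assoc left_diff_distrib)
  have "cyc_class (u (cga_log g)) - dlog g \<in> cyc_filt m" for m
  proof -
    obtain k where k: "\<forall>x\<in>cga_filt k. u x \<in> cga_filt m"
      using cont_linear_bounded[OF u_end] unfolding filt_bounded_def by blast
    obtain M where M: "\<forall>n\<ge>M. log_sum z n - cga_log g \<in> cga_filt k"
      using log_sum_tendsto unfolding z_def by blast
    \<comment> \<open>\<open>M\<close> makes the truncation error of the logarithm small after
      applying \<open>u\<close>; \<open>m\<close> makes the remainder of the geometric series
      small.\<close>
    define n where "n = max M m"
    have "cga_scale ((- 1) ^ n) (z ^ n) \<in> cga_filt m"
      using cga_power_mem[of g n] cga.antimono[of m n] unfolding z_def n_def
      by (auto intro: cga_filt_scale)
    then have "cyc_class (cga_scale ((- 1) ^ n) (z ^ n) * (?H * u z)) \<in> cyc_filt m"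
      by (intro cyc_class_mem cga_filt_mult_right)
    moreover have "cyc_class (u (log_sum z n - cga_log g)) \<in> cyc_filt m"
      using k M by (intro cyc_class_mem) (simp add: n_def)
    ultimately have "- (cyc_class (cga_scale ((- 1) ^ n) (z ^ n) * (?H * u z)) +
        cyc_class (u (log_sum z n - cga_log g))) \<in> cyc_filt m"
      by (intro cyc.uminus_mem cyc.add_mem)
    moreover have "dlog g = cyc_class (?H * u z)"
      by (simp add: uz dlog_commute)
    ultimately show ?thesis
      by (simp add: u_diff u_log_sum P cyc_class_diff left_diff_distrib mult.assoc algebra_simps)
  qed
  then have "cyc_class (u (cga_log g)) - dlog g = 0" by (rule cyc_hausdorff)
  then show ?thesis by (simp add: cyc_map_class)
qed

lemma der_act_H1_log:
  "der_act u (twisted_coproduct (H1_log (H1_class g))) =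
    cyc_tensor (dlog g) (cyc_class 1) - cyc_tensor (cyc_class 1) (dlog g)"
  by (simp add: der_act_twisted_coproduct H1_log_def cyc_map_log dlog_rep_H1)

lemma der_act_H1_log_add:
  "der_act u (twisted_coproduct (H1_log (h + k))) =
    der_act u (twisted_coproduct (H1_log h)) + der_act u (twisted_coproduct (H1_log k))"
  by (induction h rule: H1_induct; induction k rule: H1_induct)
    (simp add: der_act_H1_log dlog_add cyc_tensor_add_left cyc_tensor_add_right flip: H1_class_add)

lemma der_act_H1_log_0: "der_act u (twisted_coproduct (H1_log 0)) = 0"
  and der_act_H1_log_uminus: "der_act u (twisted_coproduct (H1_log (- h))) =
    - der_act u (twisted_coproduct (H1_log h))"
  using hom_zero[of "\<lambda>h. der_act u (twisted_coproduct (H1_log h))", OF der_act_H1_log_add] by blast+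

end

section \<open>The divergence under Nielsen moves\<close>

text \<open>The inner bimodule action on the tensor square. It commutes with the outer action in the
  Leibniz rule, so composing a double derivation with it gives a double derivation.\<close>

definition cga2_inner :: "('g::group_add, 'k::field) cga \<Rightarrow> ('g, 'k) cga \<Rightarrow> ('g, 'k) cga2 \<Rightarrow> ('g, 'k) cga2" where
  "cga2_inner p q = cga2_map (\<lambda>v. v * p) (\<lambda>w. q * w)"

lemma cga2_inner_end: "cga2_end (cga2_inner p q)"
  unfolding cga2_inner_def by (intro cga2_map_cont_linear cga_end_lmult cga_end_rmult)

lemma cga2_inner_tensor [simp]: "cga2_inner p q (cga_tensor a b) = cga_tensor (a * p) (q * b)"
  by (simp add: cga2_inner_def cga_end_lmult cga_end_rmult)

lemmas cga2_inner_add = cont_linear_add[OF cga2_inner_end]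
  and cga2_inner_diff = cont_linear_diff[OF cga2_inner_end]
  and cga2_inner_0 = cont_linear_0[OF cga2_inner_end]

lemma cga2_inner_uminus: "cga2_inner p q (- x) = - cga2_inner p q x"
  using cga2_inner_diff[of p q 0 x] by (simp add: cga2_inner_0)

lemma cga2_inner_lmult: "cga2_inner p q (cga2_lmult a x) = cga2_lmult a (cga2_inner p q x)"
  and cga2_inner_rmult: "cga2_inner p q (cga2_rmult x a) = cga2_rmult (cga2_inner p q x) a"
  by (simp_all add: cga2_inner_def cga2_lmult_def cga2_rmult_def id_def cga2_map_comp
      cga_end_lmult cga_end_rmult cont_linear_id mult.assoc)

lemma cont_linear_cga2_uminus:
  "cont_linear cga_scale cga2_scale cga_filt cga2_filt D \<Longrightarrow>
    cont_linear cga_scale cga2_scale cga_filt cga2_filt (\<lambda>a. - D a)"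
  by (simp add: cont_linear_def filt_bounded_uminus[OF filtration_cga2_filt])

lemma cont_linear_cga2_diff:
  assumes "cont_linear cga_scale cga2_scale cga_filt cga2_filt D"
    "cont_linear cga_scale cga2_scale cga_filt cga2_filt D'"
  shows "cont_linear cga_scale cga2_scale cga_filt cga2_filt (\<lambda>a. D a - D' a)"
proof -
  have "filt_bounded cga_filt cga2_filt (\<lambda>a. D a + - D' a)"
    using assms unfolding cont_linear_def
    by (intro filt_bounded_add filt_bounded_uminus cga.filtration_axioms filtration_cga2_filt) auto
  then show ?thesis
    using assms by (simp add: cont_linear_def cga2.scale_right_diff_distrib)
qed

lemma double_derivation_inner:
  assumes "double_derivation D"
  shows "double_derivation (\<lambda>a. cga2_inner p q (D a))"
  unfolding double_derivation_def
  by (auto intro: cont_linear_comp[OF cga2_inner_end] double_derivation_cont_linear assms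
      simp: double_derivation_mult[OF assms] cga2_inner_add cga2_inner_lmult cga2_inner_rmult)

lemma double_derivation_neg:
  assumes "double_derivation D"
  shows "double_derivation (\<lambda>a. - D a)"
  unfolding double_derivation_def
  by (auto intro: cont_linear_cga2_uminus double_derivation_cont_linear assms
      simp: double_derivation_mult[OF assms] cga2_lmult_uminus cga2_rmult_uminus)

lemma cga2_lmult_diff: "cga2_lmult a (x - y) = cga2_lmult a x - cga2_lmult a y"
  and cga2_rmult_diff: "cga2_rmult (x - y) a = cga2_rmult x a - cga2_rmult y a"
  using cga2_lmult_add[of a x "- y"] cga2_rmult_add[of x "- y" a]
  by (simp_all add: cga2_lmult_uminus cga2_rmult_uminus)

lemma double_derivation_diff:
  assumes "double_derivation D" "double_derivation D'"
  shows "double_derivation (\<lambda>a. D a - D' a)"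
  unfolding double_derivation_def
  by (auto intro: cont_linear_cga2_diff double_derivation_cont_linear assms
      simp: double_derivation_mult[OF assms(1)] double_derivation_mult[OF assms(2)]
        cga2_lmult_diff cga2_rmult_diff)

lemma is_partialD:
  "is_partial S g D \<Longrightarrow> double_derivation D"
  "is_partial S g D \<Longrightarrow> h \<in> S \<Longrightarrow> D (cga_group h) = (if h = g then cga_tensor 1 1 else 0)"
  by (simp_all add: is_partial_def)

lemma is_partial_group_uminus:
  assumes "is_partial S g D" "h \<in> S"
  shows "D (cga_group (- h)) = (if h = g then - cga_tensor (cga_group (- h)) (cga_group (- h)) else 0)"
  using is_partialD(2)[OF assms]
  by (simp add: double_derivation_group_inverse[OF is_partialD(1)[OF assms(1)]])

text \<open>Cyclic rotation carries an outer left factor of the first leg to its inner right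
  side.\<close>

lemma cyc2_class_inner_lmult:
  "cyc2_class (cga2_inner p q (cga2_lmult a x)) = cyc2_class (cga2_inner (p * a) q x)"
proof -
  have eq: "cga2_inner p q (cga2_lmult a x) = cga2_map (\<lambda>v. a * v * p) (\<lambda>w. q * w) x"
    by (simp add: cga2_inner_def cga2_lmult_def id_def cga2_map_comp cga_end_lmult cga_end_rmult
        cont_linear_id)
  have cyc: "cyc_class (a * v * p) = cyc_class (v * (p * a))" for v
    using cyc_class_mult_commute[of a "v * p"] by (simp add: mult.assoc)
  show ?thesis
    unfolding eq unfolding cga2_inner_def
    by (rule cyc2_class_map_cong[OF cont_linear_comp[OF cga_end_rmult cga_end_lmult] cga_end_lmult
        cga_end_rmult cga_end_lmult]) (simp_all only: cyc)
qed

lemma cyc2_class_inner_rmult: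
  "cyc2_class (cga2_inner p q (cga2_rmult x a)) = cyc2_class (cga2_inner p (a * q) x)"
proof -
  have eq: "cga2_inner p q (cga2_rmult x a) = cga2_map (\<lambda>v. v * p) (\<lambda>w. q * (w * a)) x"
    by (simp add: cga2_inner_def cga2_rmult_def id_def cga2_map_comp cga_end_lmult cga_end_rmult
        cont_linear_id)
  have cyc: "cyc_class (q * (w * a)) = cyc_class (a * q * w)" for w
    using cyc_class_mult_commute[of "q * w" a] by (simp add: mult.assoc)
  show ?thesis
    unfolding eq unfolding cga2_inner_def
    by (rule cyc2_class_map_cong[OF cga_end_rmult cont_linear_comp[OF cga_end_lmult cga_end_rmult]
        cga_end_rmult cga_end_lmult]) (simp_all only: cyc)
qed

lemma cga2_inner_1: "cga2_inner 1 1 x = x"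
  by (simp add: cga2_inner_def cga2_map_id)

context derivation_char_0
begin

definition div_term :: "'g set \<Rightarrow> 'g \<Rightarrow> ('g, 'k) cyc2" where
  "div_term S g = cyc2_class (cga_partial S g (u (cga_group g)))"

abbreviation one_cyc :: "('g, 'k) cyc" where "one_cyc \<equiv> cyc_class 1"

lemma Div_eq: "Div S u = (\<Sum>g\<in>S. div_term S g) - cyc_tensor one_cyc (\<Sum>g\<in>S. dlog g)"
  by (simp add: Div_def div_term_def dlog_def u_diff u_1)

lemma cyc_tensor_uminus: "cyc_tensor x (- y) = - cyc_tensor x y"
  using cyc_tensor_add_right[of x y "- y"] by (simp add: cyc_tensor_0 eq_neg_iff_add_eq_0 add.commute)

lemma cyc_tensor_diff: "cyc_tensor x (y - z) = cyc_tensor x y - cyc_tensor x z"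
  using cyc_tensor_add_right[of x "y - z" z] by (simp add: algebra_simps)

text \<open>The derivative along \<open>x\<close> sends the inverse of \<open>x\<close> to minus its
  tensor square, so inserting \<open>x\<close> on both inner sides, with a sign, gives the new
  derivative; the others stay. The first sum in \<open>Div\<close> drops by \<open>dlog x\<close>
  tensor 1 plus 1 tensor \<open>dlog x\<close>, and the correction term returns 1 tensor
  \<open>dlog x\<close> twice.\<close>

lemma Div_uminus_move:
  assumes free: "free_generating_set (insert x B)" and x: "x \<notin> B" and B: "finite B"
  shows "Div (insert (- x) B) u - Div (insert x B) u =
    cyc_tensor one_cyc (dlog x) - cyc_tensor (dlog x) one_cyc"
proof -
  let ?S = "insert x B" and ?T = "insert (- x) B"
  let ?X = "cga_group x :: ('g, 'k) cga" and ?Y = "cga_group (- x) :: ('g, 'k) cga"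
  note T = free_replace_uminus[OF free x]
  let ?D = "cga_partial ?S x :: ('g, 'k) cga \<Rightarrow> _"
  have D: "is_partial ?S x ?D" by (rule is_partial_cga_partial[OF free])
  note dd = is_partialD(1)[OF D]
  have DX: "?D ?X = cga_tensor 1 1" and DY: "?D ?Y = - cga_tensor ?Y ?Y"
    using is_partialD(2)[OF D, of x] is_partial_group_uminus[OF D, of x] by simp_all
  have "is_partial ?T (- x) (\<lambda>a. - cga2_inner ?X ?X (?D a))"
    unfolding is_partial_def
  proof (intro conjI ballI)
    show "double_derivation (\<lambda>a. - cga2_inner ?X ?X (?D a))"
      by (intro double_derivation_neg double_derivation_inner dd)
    fix h assume "h \<in> ?T"
    then consider "h = - x" | "h \<in> B" "h \<noteq> - x" "h \<noteq> x" using T x by blast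
    then show "- cga2_inner ?X ?X (?D (cga_group h)) = (if h = - x then cga_tensor 1 1 else 0)"
      by cases (use is_partialD(2)[OF D] in \<open>simp_all add: DY cga2_inner_uminus cga2_inner_0\<close>)
  qed
  then have x_eq: "cga_partial ?T (- x) = (\<lambda>a. - cga2_inner ?X ?X (?D a))"
    by (rule cga_partial_eq[OF free_generates[OF T(1)]])
  have h_eq: "cga_partial ?T h = (cga_partial ?S h :: ('g, 'k) cga \<Rightarrow> _)" if h: "h \<in> B" for h
  proof (rule cga_partial_eq[OF free_generates[OF T(1)]])
    let ?E = "cga_partial ?S h :: ('g, 'k) cga \<Rightarrow> _"
    have E: "is_partial ?S h ?E" by (rule is_partial_cga_partial[OF free])
    have "h \<noteq> x" "h \<noteq> - x" using h x T by auto
    then have "?E (cga_group (- x)) = 0"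
      using is_partial_group_uminus[OF E, of x] by simp
    then show "is_partial ?T h ?E"
      using is_partialD[OF E] \<open>h \<noteq> - x\<close> unfolding is_partial_def by auto
  qed
  let ?U = "u ?X"
  have "?D (u ?Y) = - (cga2_lmult ?Y (cga2_lmult ?U (?D ?Y) + cga2_rmult (?D ?U) ?Y)
      + cga2_rmult (?D ?Y) (?U * ?Y))"
    by (simp add: u_group_inverse mult.assoc double_derivation_uminus[OF dd] double_derivation_mult[OF dd])
  then have DuY: "?D (u ?Y) = cga_tensor (?Y * ?U * ?Y) ?Y - cga2_lmult ?Y (cga2_rmult (?D ?U) ?Y)
      + cga_tensor ?Y (?Y * ?U * ?Y)"
    by (simp add: DY cga2_lmult_add cga2_lmult_diff cga2_lmult_uminus cga2_rmult_uminus mult.assoc)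
  have "cyc2_class (cga2_inner ?X ?X (cga2_lmult ?Y (cga2_rmult (?D ?U) ?Y))) = cyc2_class (?D ?U)"
    by (simp add: cyc2_class_inner_lmult cyc2_class_inner_rmult cga2_inner_1)
  then have "div_term ?T (- x) = div_term ?S x
      - cyc_tensor (cyc_class (?Y * ?U)) one_cyc - cyc_tensor one_cyc (cyc_class (?U * ?Y))"
    unfolding div_term_def x_eq DuY
    by (simp add: cga2_inner_add cga2_inner_diff cyc2_class_uminus cyc2_class_add cyc2_class_diff
        mult.assoc)
  then have "div_term ?T (- x) = div_term ?S x
      - cyc_tensor (dlog x) one_cyc - cyc_tensor one_cyc (dlog x)"
    unfolding dlog_commute by (simp only: dlog_def)
  moreover have "div_term ?T h = div_term ?S h" if "h \<in> B" for h
    using h_eq[OF that] by (simp add: div_term_def)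
  ultimately show ?thesis
    unfolding Div_eq using x T(2) B
    by (simp add: dlog_uminus cyc_tensor_uminus cyc_tensor_add_right cyc_tensor_diff algebra_simps)
qed

text \<open>Only the derivatives along \<open>x\<close> and \<open>y\<close> change. The one along
  \<open>y\<close> loses an inner multiple of the one along \<open>x\<close>, and the same term
  reappears in the derivative of the new element. What remains is 1 tensor \<open>dlog y\<close>,
  which the correction term cancels.\<close>

lemma Div_add_move:
  assumes free: "free_generating_set (insert x B)" and x: "x \<notin> B" and B: "finite B" and y: "y \<in> B"
  shows "Div (insert (x + y) B) u = Div (insert x B) u"
proof -
  let ?S = "insert x B" and ?T = "insert (x + y) B"
  let ?X = "cga_group x :: ('g, 'k) cga" and ?Y = "cga_group y :: ('g, 'k) cga"
  let ?Y' = "cga_group (- y) :: ('g, 'k) cga"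
  note T = free_replace_add[OF free x y]
  have xy: "x \<noteq> y" using x y by blast
  let ?D = "cga_partial ?S x :: ('g, 'k) cga \<Rightarrow> _" and ?E = "cga_partial ?S y :: ('g, 'k) cga \<Rightarrow> _"
  have D: "is_partial ?S x ?D" and E: "is_partial ?S y ?E"
    by (rule is_partial_cga_partial[OF free])+
  note dd = is_partialD(1)[OF D] and ee = is_partialD(1)[OF E]
  have D': "?D ?X = cga_tensor 1 1" "?D ?Y = 0" and E': "?E ?X = 0" "?E ?Y = cga_tensor 1 1"
    using is_partialD(2)[OF D] is_partialD(2)[OF E] y xy by auto
  have "is_partial ?T (x + y) (\<lambda>a. cga2_inner 1 ?Y' (?D a))"
    unfolding is_partial_def
  proof (intro conjI ballI)
    show "double_derivation (\<lambda>a. cga2_inner 1 ?Y' (?D a))"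
      by (intro double_derivation_inner dd)
    fix h assume "h \<in> ?T"
    then consider "h = x + y" | "h \<in> B" "h \<noteq> x + y" "h \<noteq> x" using T x by blast
    then show "cga2_inner 1 ?Y' (?D (cga_group h)) = (if h = x + y then cga_tensor 1 1 else 0)"
      by cases (use is_partialD(2)[OF D] in \<open>simp_all add: D' cga_group_add
          double_derivation_mult[OF dd] cga2_inner_0\<close>)
  qed
  then have x_eq: "cga_partial ?T (x + y) = (\<lambda>a. cga2_inner 1 ?Y' (?D a))"
    by (rule cga_partial_eq[OF free_generates[OF T(1)]])
  have "is_partial ?T y (\<lambda>a. ?E a - cga2_inner ?X ?Y' (?D a))"
    unfolding is_partial_def
  proof (intro conjI ballI)
    show "double_derivation (\<lambda>a. ?E a - cga2_inner ?X ?Y' (?D a))"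
      by (intro double_derivation_diff double_derivation_inner dd ee)
    fix h assume "h \<in> ?T"
    then consider "h = x + y" "h \<noteq> y" | "h \<in> B" "h \<noteq> x" using T x y by blast
    then show "?E (cga_group h) - cga2_inner ?X ?Y' (?D (cga_group h)) = (if h = y then cga_tensor 1 1 else 0)"
      by cases (use is_partialD(2)[OF D] is_partialD(2)[OF E] in \<open>simp_all add: D' E' cga_group_add
          double_derivation_mult[OF dd] double_derivation_mult[OF ee] cga2_inner_0\<close>)
  qed
  then have y_eq: "cga_partial ?T y = (\<lambda>a. ?E a - cga2_inner ?X ?Y' (?D a))"
    by (rule cga_partial_eq[OF free_generates[OF T(1)]])
  have h_eq: "cga_partial ?T h = (cga_partial ?S h :: ('g, 'k) cga \<Rightarrow> _)" if h: "h \<in> B" "h \<noteq> y" for h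
  proof (rule cga_partial_eq[OF free_generates[OF T(1)]])
    let ?F = "cga_partial ?S h :: ('g, 'k) cga \<Rightarrow> _"
    have F: "is_partial ?S h ?F" by (rule is_partial_cga_partial[OF free])
    have "h \<noteq> x" "h \<noteq> x + y" using h x T by auto
    then have "?F (cga_group (x + y)) = 0"
      using is_partialD(2)[OF F] y h by (simp add: cga_group_add double_derivation_mult[OF is_partialD(1)[OF F]])
    then show "is_partial ?T h ?F"
      using is_partialD[OF F] \<open>h \<noteq> x + y\<close> unfolding is_partial_def by auto
  qed
  have "?D (u (cga_group (x + y))) =
      cga2_rmult (?D (u ?X)) ?Y + (cga2_lmult ?X (?D (u ?Y)) + cga_tensor 1 (u ?Y))"
    by (simp add: cga_group_add u_mult double_derivation_linear[OF dd] double_derivation_mult[OF dd] D')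
  then have "div_term ?T (x + y) = div_term ?S x
      + cyc2_class (cga2_inner ?X ?Y' (?D (u ?Y))) + cyc_tensor one_cyc (cyc_class (?Y' * u ?Y))"
    unfolding div_term_def x_eq
    by (simp add: cga2_inner_add cyc2_class_add cyc2_class_inner_rmult cyc2_class_inner_lmult cga2_inner_1)
  then have 1: "div_term ?T (x + y) = div_term ?S x
      + cyc2_class (cga2_inner ?X ?Y' (?D (u ?Y))) + cyc_tensor one_cyc (dlog y)"
    unfolding dlog_commute .
  have 2: "div_term ?T y = div_term ?S y - cyc2_class (cga2_inner ?X ?Y' (?D (u ?Y)))"
    unfolding div_term_def y_eq by (simp add: cyc2_class_diff)
  define C where "C = B - {y}"
  have C: "B = insert y C" "y \<notin> C" "finite C" using y B by (auto simp: C_def)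
  have "div_term ?T h = div_term ?S h" if "h \<in> C" for h
    using h_eq[of h] that by (simp add: div_term_def C_def)
  then have "(\<Sum>h\<in>C. div_term ?T h) = (\<Sum>h\<in>C. div_term ?S h)" by simp
  moreover have "(\<Sum>h\<in>?T. div_term ?T h) = div_term ?T (x + y) + (div_term ?T y + (\<Sum>h\<in>C. div_term ?T h))"
    "(\<Sum>h\<in>?S. div_term ?S h) = div_term ?S x + (div_term ?S y + (\<Sum>h\<in>C. div_term ?S h))"
    using T(2) x C B by (simp_all del: insert_iff)
  moreover have "(\<Sum>h\<in>?T. dlog h) = dlog y + (\<Sum>h\<in>?S. dlog h)"
    using T(2) x B by (simp add: dlog_add algebra_simps)
  ultimately show ?thesis
    unfolding Div_eq 1 2 by (simp add: 1 2 cyc_tensor_add_right algebra_simps)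
qed

text \<open>Finiteness has to travel along the path, because the formulas for the two moves are
  available for finite bases only.\<close>

lemma Div_nielsen_path:
  assumes "nielsen_path S T h"
  shows "finite S \<longleftrightarrow> finite T"
    and "finite S \<Longrightarrow> Div T u - Div S u = der_act u (twisted_coproduct (H1_log h))"
proof -
  have "(finite S \<longleftrightarrow> finite T) \<and>
    (finite S \<longrightarrow> Div T u - Div S u = der_act u (twisted_coproduct (H1_log h)))"
    using assms
  proof induction
    case (inv x B)
    have "cyc_tensor (- dlog x) one_cyc = - cyc_tensor (dlog x) one_cyc"
      using cyc_tensor_add_left[of "dlog x" "- dlog x" one_cyc]
      by (simp add: cyc_tensor_0 eq_neg_iff_add_eq_0 add.commute)
    then show ?case
      using Div_uminus_move[OF inv] by (simp add: der_act_H1_log dlog_uminus cyc_tensor_uminus)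
  next
    case (mult x B y)
    then show ?case by (simp add: der_act_H1_log_0 Div_add_move)
  next
    case (sym S T h)
    have "Div S u - Div T u = - (Div T u - Div S u)" by simp
    with sym show ?case by (simp only: der_act_H1_log_uminus) simp
  next
    case (trans S T h U k)
    have "Div U u - Div S u = (Div T u - Div S u) + (Div U u - Div T u)" by simp
    with trans show ?case by (simp only: der_act_H1_log_add) simp
  qed (simp add: der_act_H1_log_0)
  then show "finite S \<longleftrightarrow> finite T"
    and "finite S \<Longrightarrow> Div T u - Div S u = der_act u (twisted_coproduct (H1_log h))"
    by blast+
qed

end

section \<open>Derivations separate homology classes\<close>

text \<open>The inner sums are natural multiples of \<open>H1_class s\<close>.\<close>

lemma H1_class_word_value:
  assumes "finite S" "set w \<subseteq> letters S"
  shows "H1_class (word_value w) = (\<Sum>s\<in>S. (\<Sum>i<count_list w (s, True). H1_class s) -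
    (\<Sum>i<count_list w (s, False). H1_class s))"
  using assms(2)
proof (induction w)
  case Nil
  then show ?case by (simp add: H1_class_0)
next
  case (Cons l w)
  obtain t b where l: "l = (t, b)" by (cases l)
  with Cons.prems have t: "t \<in> S" by simp
  let ?f = "\<lambda>w s. (\<Sum>i<count_list w (s, True). H1_class s) - (\<Sum>i<count_list w (s, False). H1_class s)"
  have "?f (l # w) s = ?f w s + (if s = t then H1_class (letter_value l) else 0)" for s
    by (cases b) (auto simp: l H1_class_uminus)
  then have "(\<Sum>s\<in>S. ?f (l # w) s) = (\<Sum>s\<in>S. ?f w s) + H1_class (letter_value l)"
    using assms(1) t by (simp add: sum.distrib)
  with Cons show ?case by (simp add: H1_class_add add.commute)
qed

lemma exponent_word_value:
  fixes e :: "'g::group_add \<Rightarrow> int"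
  assumes e: "\<And>g h. e (g + h) = e g + e h" "\<And>t. t \<in> S \<Longrightarrow> e t = (if t = s then 1 else 0)"
    and "set w \<subseteq> letters S"
  shows "e (word_value w) = int (count_list w (s, True)) - int (count_list w (s, False))"
  using assms(3)
proof (induction w)
  case (Cons l w)
  then show ?case
    by (cases l; cases "snd l") (auto simp: e hom_zero[of e, OF e(1)])
qed (simp add: hom_zero[of e, OF e(1)])

text \<open>In the abelianization a word is determined by its exponent sums, and these are the
  values of the homomorphisms \<open>e\<close>.\<close>

lemma H1_class_eq_0I:
  assumes free: "free_generating_set (S :: 'g::group_add set)" and fin: "finite S"
    and "\<And>s e. s \<in> S \<Longrightarrow> (\<And>g h. e (g + h) = e g + e h) \<Longrightarrow>
      (\<And>t. t \<in> S \<Longrightarrow> e t = (if t = s then 1 else 0)) \<Longrightarrow> e g = (0 :: int)"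
  shows "H1_class g = 0"
proof -
  define w where "w = word_of S g"
  have w: "set w \<subseteq> letters S" "word_value w = g"
    using word_of_mem[OF free, of g] free by (simp_all add: w_def mem_reduced_words)
  have "count_list w (s, True) = count_list w (s, False)" if s: "s \<in> S" for s
  proof -
    obtain e :: "'g \<Rightarrow> int" where e: "\<And>g h. e (g + h) = e g + e h"
        "\<And>t. t \<in> S \<Longrightarrow> e t = (if t = s then 1 else 0)"
      using free_exponent[OF free s] by blast
    then show ?thesis
      using assms(3)[OF s e] exponent_word_value[of e S s w, OF e w(1)] w(2) by simp
  qed
  then show ?thesis
    using H1_class_word_value[OF fin w(1)] by (simp add: w(2))
qed

section \<open>Traces on cyclic words\<close>

definition pm_functional :: "('a \<Rightarrow> 'k::field) \<Rightarrow> ('a \<Rightarrow>\<^sub>0 'k) \<Rightarrow> 'k" where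
  "pm_functional f x = (\<Sum>a\<in>Poly_Mapping.keys x. Poly_Mapping.lookup x a * f a)"

lemma pm_functional_superset:
  assumes "finite A" "Poly_Mapping.keys x \<subseteq> A"
  shows "pm_functional f x = (\<Sum>a\<in>A. Poly_Mapping.lookup x a * f a)"
  unfolding pm_functional_def
  by (rule sum.mono_neutral_left) (use assms in \<open>auto simp: in_keys_iff\<close>)

lemma pm_functional_single [simp]: "pm_functional f (Poly_Mapping.single a c) = c * f a"
  by (subst pm_functional_superset[of "{a}"]) auto

lemma pm_functional_0 [simp]: "pm_functional f 0 = 0"
  by (simp add: pm_functional_def)

lemma pm_functional_add: "pm_functional f (x + y) = pm_functional f x + pm_functional f y"
  using keys_add[of x y]
  by (simp add: pm_functional_superset[of "Poly_Mapping.keys x \<union> Poly_Mapping.keys y"] lookup_add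
      distrib_right sum.distrib)

lemma pm_functional_diff: "pm_functional f (x - y) = pm_functional f x - pm_functional f y"
  using pm_functional_add[of f "x - y" y] by (simp add: algebra_simps)

lemma pm_functional_scale: "pm_functional f (pm_scale c x) = c * pm_functional f x"
proof -
  have "Poly_Mapping.keys (pm_scale c x) \<subseteq> Poly_Mapping.keys x"
    by (auto simp: in_keys_iff lookup_pm_scale)
  then show ?thesis
    by (simp add: pm_functional_superset[of "Poly_Mapping.keys x"] lookup_pm_scale
        sum_distrib_left mult.assoc)
qed

lemma augmentation_eq_functional: "augmentation x = pm_functional (\<lambda>_. 1) x"
  by (simp add: augmentation_def pm_functional_def)

lemma cyc_filt_scale: "x \<in> cyc_filt m \<Longrightarrow> cyc_scale c x \<in> cyc_filt m"
  unfolding cyc_filt_def using cga_filt_scale by (fastforce simp flip: cyc_class_scale)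

text \<open>A trace on the group algebra vanishing on a power of the augmentation ideal extends to cyclic words.\<close>

locale trace_functional =
  fixes f :: "'g::group_add \<Rightarrow> 'k::field" and m :: nat
  assumes trace: "pm_functional f (x * y) = pm_functional f (y * x)"
    and vanish: "x \<in> aug_pow m \<Longrightarrow> pm_functional f x = 0"
begin

abbreviation \<tau> :: "('g \<Rightarrow>\<^sub>0 'k) \<Rightarrow> 'k" where "\<tau> \<equiv> pm_functional f"

lemma \<tau>_cong:
  assumes "cga_of a - cga_of b \<in> cga_filt m"
  shows "\<tau> a = \<tau> b"
  using vanish[of "a - b"] assms by (simp add: cga_of_mem_filt_iff pm_functional_diff flip: cga_of_diff)

text \<open>Commutators of the completion are approximated by commutators of the group algebra, on
  which a trace vanishes.\<close>

lemma approx_span: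
  assumes "s \<in> cga.span {a * b - b * a | a b :: ('g, 'k) cga. True}"
  shows "\<exists>b. \<tau> b = 0 \<and> s - cga_of b \<in> cga_filt m"
  using assms
proof (induction rule: cga.span_induct_alt)
  case base
  show ?case by (rule exI[of _ 0]) (simp add: cga_of_0 cga.zero_mem)
next
  case (step c s t)
  then obtain x y b where s: "s = x * y - y * x" and b: "\<tau> b = 0" "t - cga_of b \<in> cga_filt m" by blast
  obtain x' y' where xy: "x - cga_of x' \<in> cga_filt m" "y - cga_of y' \<in> cga_filt m"
    using cga_dense by blast
  let ?X = "cga_of x'" and ?Y = "cga_of y'"
  define p where "p = x' * y' - y' * x'"
  have "(x - ?X) * y + ?X * (y - ?Y) - ((y - ?Y) * x + ?Y * (x - ?X)) \<in> cga_filt m"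
    by (intro cga.add_mem cga.diff_mem cga_filt_mult_left cga_filt_mult_right xy)
  then have "s - cga_of p \<in> cga_filt m"
    by (simp add: p_def s cga_of_diff cga_of_mult algebra_simps)
  from cga.add_mem[OF cga_filt_scale[OF this, of c] b(2)]
  have "cga_scale c s + t - cga_of (pm_scale c p + b) \<in> cga_filt m"
    by (simp add: cga_of_add cga_of_scale cga.scale_right_diff_distrib algebra_simps)
  moreover have "\<tau> (pm_scale c p + b) = 0"
    by (simp add: p_def b(1) pm_functional_add pm_functional_scale pm_functional_diff trace[of x' y'])
  ultimately show ?case by blast
qed

lemma \<tau>_cyc_0:
  assumes "cyc_class (cga_of a) \<in> cyc_filt m"
  shows "\<tau> a = 0"
proof -
  obtain y where y: "y \<in> cga_filt m" "cyc_class (cga_of a) = cyc_class y"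
    using assms unfolding cyc_filt_def by blast
  then have "cga_of a - y \<in> closure (cga.span {a * b - b * a | a b :: ('g, 'k) cga. True})"
    by (simp add: cyc_class_eq_iff cga_commutators_def)
  then obtain s where s: "s \<in> cga.span {a * b - b * a | a b :: ('g, 'k) cga. True}"
      "s - (cga_of a - y) \<in> cga_filt m"
    unfolding closure_cga_iff by blast
  obtain b where b: "\<tau> b = 0" "s - cga_of b \<in> cga_filt m"
    using approx_span[OF s(1)] by blast
  have "(s - cga_of b) - (s - (cga_of a - y)) + y \<in> cga_filt m"
    by (intro cga.add_mem cga.diff_mem s b y)
  then have "\<tau> a = \<tau> b" by (intro \<tau>_cong) simp
  with b show ?thesis by simp
qed

text \<open>Evaluated on any group algebra element congruent to \<open>x\<close> at order
  \<open>m\<close>; by \<open>\<tau>_cyc_0\<close> the choice does not matter.\<close>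

definition \<tau>_hat :: "('g, 'k) cyc \<Rightarrow> 'k" where
  "\<tau>_hat x = \<tau> (SOME a. x - cyc_class (cga_of a) \<in> cyc_filt m)"

lemma \<tau>_hat_eqI:
  assumes "x - cyc_class (cga_of a) \<in> cyc_filt m"
  shows "\<tau>_hat x = \<tau> a"
proof -
  let ?b = "SOME a. x - cyc_class (cga_of a) \<in> cyc_filt m"
  have "x - cyc_class (cga_of ?b) \<in> cyc_filt m" using assms by (rule someI)
  from cyc.diff_mem[OF assms this] have "cyc_class (cga_of (?b - a)) \<in> cyc_filt m"
    by (simp add: cga_of_diff cyc_class_diff)
  from \<tau>_cyc_0[OF this] show ?thesis by (simp add: \<tau>_hat_def pm_functional_diff)
qed

lemma \<tau>_hat_class [simp]: "\<tau>_hat (cyc_class (cga_of a)) = \<tau> a"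
  by (rule \<tau>_hat_eqI) (simp add: cyc.zero_mem)

lemma \<tau>_hat_small: "x \<in> cyc_filt m \<Longrightarrow> \<tau>_hat x = 0"
  using \<tau>_hat_eqI[of x 0] by (simp add: cga_of_0 cyc_class_0)

lemma approx: obtains a where "x - cyc_class (cga_of a) \<in> cyc_filt m"
proof -
  obtain y where y: "x = cyc_class y" using cyc_class_rep by metis
  obtain a where "y - cga_of a \<in> cga_filt m" using cga_dense by blast
  from cyc_class_mem[OF this] show thesis by (intro that[of a]) (simp add: y cyc_class_diff)
qed

lemma \<tau>_hat_add: "\<tau>_hat (x + y) = \<tau>_hat x + \<tau>_hat y"
proof -
  obtain a b where ab: "x - cyc_class (cga_of a) \<in> cyc_filt m" "y - cyc_class (cga_of b) \<in> cyc_filt m"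
    using approx by metis
  from cyc.add_mem[OF this] have "x + y - cyc_class (cga_of (a + b)) \<in> cyc_filt m"
    by (simp add: cga_of_add cyc_class_add algebra_simps)
  with ab show ?thesis by (simp add: \<tau>_hat_eqI pm_functional_add)
qed

lemma \<tau>_hat_scale: "\<tau>_hat (cyc_scale c x) = c * \<tau>_hat x"
proof -
  obtain a where a: "x - cyc_class (cga_of a) \<in> cyc_filt m" using approx by metis
  obtain y where y: "x = cyc_class y" using cyc_class_rep by metis
  have "cyc_scale c x - cyc_class (cga_of (pm_scale c a)) \<in> cyc_filt m"
    using cyc_filt_scale[OF a, of c]
    by (simp add: y cga_of_scale cga.scale_right_diff_distrib flip: cyc_class_diff cyc_class_scale)
  with a show ?thesis by (simp add: \<tau>_hat_eqI pm_functional_scale)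
qed

end

text \<open>The order 2 matches \<open>\<phi>_trace\<close>, since
  \<open>tensor_functional_vanishes\<close> takes a common order for both factors.\<close>

lemma augmentation_trace: "trace_functional (\<lambda>_ :: 'g::group_add. 1 :: 'k::field) 2"
proof
  show "pm_functional (\<lambda>_. 1) (x * y) = pm_functional (\<lambda>_. 1) (y * x)" for x y :: "'g \<Rightarrow>\<^sub>0 'k"
    by (simp add: augmentation_mult mult.commute flip: augmentation_eq_functional)
  show "pm_functional (\<lambda>_. 1) x = 0" if "x \<in> aug_pow 2" for x :: "'g \<Rightarrow>\<^sub>0 'k"
  proof -
    have "x \<in> aug_pow (Suc 0)" using that aug.antimono[of "Suc 0" 2] by auto
    then show ?thesis
      using aug_pow_1 by (auto simp: augmentation_ideal_def simp flip: augmentation_eq_functional)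
  qed
qed

locale exponent =
  fixes e :: "'g::group_add \<Rightarrow> 'k::field"
  assumes e_add: "e (g + h) = e g + e h"
begin

abbreviation \<phi> :: "('g \<Rightarrow>\<^sub>0 'k) \<Rightarrow> 'k" where "\<phi> \<equiv> pm_functional e"

text \<open>The linear extension of an additive function is a derivation along the augmentation.
  Hence it is a trace and kills products of two elements of the augmentation ideal.\<close>

lemma \<phi>_mult: "\<phi> (x * y) = \<phi> x * augmentation y + augmentation x * \<phi> y"
proof (induction x rule: pm_induct)
  case (add a c x)
  have "\<phi> (Poly_Mapping.single a c * y) = c * e a * augmentation y + c * \<phi> y"
  proof (induction y rule: pm_induct)
    case (add b d y)
    then show ?case
      by (simp add: distrib_left pm_functional_add mult_single e_add augmentation_add
          augmentation_single algebra_simps)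
  qed (simp add: augmentation_0)
  with add show ?case
    by (simp add: distrib_right pm_functional_add augmentation_add augmentation_single algebra_simps)
qed (simp add: augmentation_0)

lemma \<phi>_conj: "\<phi> (Poly_Mapping.single g 1 * x * Poly_Mapping.single (- g) 1) = \<phi> x"
  by (simp add: \<phi>_mult augmentation_mult augmentation_single hom_zero[of e, OF e_add] algebra_simps)

lemma \<phi>_trace: "trace_functional e 2"
proof
  show "\<phi> (x * y) = \<phi> (y * x)" for x y
    by (simp add: \<phi>_mult mult.commute add.commute)
  fix x :: "'g \<Rightarrow>\<^sub>0 'k" assume "x \<in> aug_pow 2"
  then have "x \<in> pm.span {x * y |x y. x \<in> augmentation_ideal \<and> y \<in> aug_pow (Suc 0)}"
    by (simp add: numeral_2_eq_2)
  then show "\<phi> x = 0"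
  proof (induction rule: pm.span_induct_alt)
    case (step c x y)
    then obtain a b where "x = a * b" "a \<in> augmentation_ideal" "b \<in> aug_pow (Suc 0)" by blast
    moreover from this have "b \<in> augmentation_ideal" using aug_pow_1 by blast
    ultimately show ?case
      using step by (simp add: pm_functional_add pm_functional_scale \<phi>_mult augmentation_ideal_def)
  qed simp
qed

end

text \<open>\<open>d\<close> plays the role of the logarithmic derivative. As a crossed homomorphism
  for conjugation it can be prescribed freely on a basis, which is how derivations with given values
  on the generators are obtained.\<close>

locale group_algebra_derivation =
  fixes d :: "'g::group_add \<Rightarrow> 'g \<Rightarrow>\<^sub>0 'k::field"
  assumes d_add: "d (g + h) = d g + Poly_Mapping.single g 1 * d h * Poly_Mapping.single (- g) 1"
begin

definition D :: "('g \<Rightarrow>\<^sub>0 'k) \<Rightarrow> ('g \<Rightarrow>\<^sub>0 'k)" where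
  "D = pm_extend (\<lambda>g. d g * Poly_Mapping.single g 1)"

lemma D_single: "D (Poly_Mapping.single g c) = pm_scale c (d g * Poly_Mapping.single g 1)"
  by (simp add: D_def)

lemma D_add: "D (x + y) = D x + D y"
  by (simp add: D_def pm_extend_add)

lemma D_0: "D 0 = 0"
  by (simp add: D_def)

lemma single_scale: "Poly_Mapping.single g c = pm_scale c (Poly_Mapping.single g 1)"
  by simp

lemma D_mult: "D (x * y) = D x * y + x * D y"
proof (induction x rule: pm_induct)
  case (add g c x)
  have "D (Poly_Mapping.single g c * y) = D (Poly_Mapping.single g c) * y + Poly_Mapping.single g c * D y"
  proof (induction y rule: pm_induct)
    case (add h b y)
    have "d (g + h) * Poly_Mapping.single (g + h) 1 =
        d g * Poly_Mapping.single (g + h) 1 + Poly_Mapping.single g 1 * (d h * Poly_Mapping.single h 1)"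
      by (simp add: d_add distrib_right mult_single mult.assoc flip: add.assoc)
    then have "D (Poly_Mapping.single g c * Poly_Mapping.single h b) =
        D (Poly_Mapping.single g c) * Poly_Mapping.single h b +
        Poly_Mapping.single g c * D (Poly_Mapping.single h b)"
      unfolding single_scale[of g c] single_scale[of h b] pm_scale_mult_left pm_scale_mult_right
      by (simp add: mult_single D_single pm_scale_mult_left pm_scale_mult_right pm.scale_right_distrib
          mult.assoc mult.commute[of b c] del: pm_scale_single)
        (simp add: D_single pm_scale_mult_left pm_scale_mult_right pm.scale_right_distrib mult_single
          mult.assoc mult.commute)
    with add show ?case by (simp add: distrib_left D_add algebra_simps)
  qed (simp add: D_0)
  with add show ?case by (simp add: distrib_right D_add algebra_simps)
qed (simp add: D_0)

lemma D_scale: "D (pm_scale c x) = pm_scale c (D x)"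
  by (simp add: D_def pm_extend_scale)

text \<open>On a product of \<open>Suc m\<close> elements of the augmentation ideal, every Leibniz
  term leaves \<open>m\<close> of them untouched.\<close>

lemma D_filt: "x \<in> aug_pow (Suc m) \<Longrightarrow> D x \<in> aug_pow m"
proof (induction m arbitrary: x)
  case (Suc m)
  then have "x \<in> pm.span {x * y |x y. x \<in> augmentation_ideal \<and> y \<in> aug_pow (Suc m)}"
    by simp
  then show ?case
  proof (induction rule: pm.span_induct_alt)
    case base
    then show ?case by (simp add: D_0 aug.zero_mem del: aug_pow.simps)
  next
    case (step c a b)
    then obtain y z where a: "a = y * z" and y: "y \<in> augmentation_ideal" and z: "z \<in> aug_pow (Suc m)"
      by blast
    have "D y * z \<in> aug_pow (Suc m)" using z by (rule aug_pow_mult_left)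
    moreover have "y * D z \<in> aug_pow (Suc m)"
      using y Suc.IH[OF z] by (auto intro: pm.span_base)
    ultimately have "D a \<in> aug_pow (Suc m)" by (simp only: a D_mult aug.add_mem)
    with step show ?case
      by (simp only: D_add D_scale aug.add_mem pm.subspace_scale[OF subspace_aug_pow])
  qed
qed simp

sublocale completion_map aug_pow cga_lim rep_cga aug_pow cga_lim rep_cga D
  by (intro completion_map.intro completion_map_axioms.intro cga_c.completion_axioms D_add
      filt_boundedI[where k = Suc] D_filt)

definition D_hat :: "('g, 'k) cga \<Rightarrow> ('g, 'k) cga" where
  "D_hat = cga_c.extend cga_lim D"

lemmas D_hat_lim = extend_lim[folded D_hat_def]

lemma D_hat_derivation: "D_hat \<in> cga_derivations"
proof (rule cga_derivationI)
  show "cga_end D_hat"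
    unfolding cont_linear_def
  proof (intro conjI allI)
    show "D_hat (x + y) = D_hat x + D_hat y" for x y
      unfolding D_hat_def by (rule extend_add)
    show "filt_bounded cga_filt cga_filt D_hat"
      using extend_bounded unfolding hat_cga D_hat_def .
    fix c and x :: "('g, 'k) cga"
    obtain X where X: "x = cga_lim X" "filt_cauchy aug_pow X" by (rule cga_c.lim_cases)
    have "filt_cauchy aug_pow (\<lambda>i. pm_scale c (X i))"
      using X(2) unfolding filt_cauchy_def
      by (metis pm.scale_right_diff_distrib pm.subspace_scale subspace_aug_pow)
    with X show "D_hat (cga_scale c x) = cga_scale c (D_hat x)"
      by (simp add: cga_scale_lim D_hat_lim D_scale cauchy)
  qed
  fix x y :: "('g, 'k) cga"
  obtain X where X: "x = cga_lim X" "filt_cauchy aug_pow X" by (rule cga_c.lim_cases)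
  obtain Y where Y: "y = cga_lim Y" "filt_cauchy aug_pow Y" by (rule cga_c.lim_cases)
  show "D_hat (x * y) = D_hat x * y + x * D_hat y"
    by (simp add: X Y cga_lim_mult filt_cauchy_mult D_hat_lim D_mult cga_lim_add cauchy)
qed

lemma D_hat_group: "D_hat (cga_group g) = cga_of (d g) * cga_group g"
  by (simp add: cga_group_def cga_of_def D_hat_lim aug.filt_cauchy_const D_single cga_lim_mult)

end

text \<open>A product of two linear functionals respects the tensor relations, and each of the two
  kills \<open>cyc_filt m\<close>.\<close>

lemma tensor_functional_vanishes:
  fixes f g :: "'g::group_add \<Rightarrow> 'k::field"
  assumes "trace_functional f m" "trace_functional g m"
    and "x \<in> tensor_nbhd cyc_scale cyc_scale cyc_filt cyc_filt m"
  shows "pm_functional (\<lambda>(v, w). trace_functional.\<tau>_hat f m v * trace_functional.\<tau>_hat g m w) x = 0"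
proof -
  interpret f: trace_functional f m by fact
  interpret g: trace_functional g m by fact
  show ?thesis
    using assms(3)
    by (induction rule: tensor_nbhd_induct)
      (auto simp: pm_functional_add pm_functional_diff pm_functional_scale f.\<tau>_hat_add g.\<tau>_hat_add
        f.\<tau>_hat_scale g.\<tau>_hat_scale f.\<tau>_hat_small g.\<tau>_hat_small algebra_simps)
qed

lemma der_act_H1_log_injective:
  fixes S :: "'g::group_add set"
  assumes free: "free_generating_set S" "finite S"
    and eq: "\<And>u :: ('g, 'k::field_char_0) cga \<Rightarrow> ('g, 'k) cga. u \<in> cga_derivations \<Longrightarrow>
      der_act u (twisted_coproduct (H1_log h)) = der_act u (twisted_coproduct (H1_log k))"
  shows "h = k"
proof -
  \<comment> \<open>Since the pairing with derivations is additive, injectivity reduces to a trivial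
    kernel.\<close>
  obtain g where g: "h - k = H1_class g" using H1_class_rep by metis
  have zero: "der_act u (twisted_coproduct (H1_log (H1_class g))) = 0"
    if u: "u \<in> cga_derivations" for u :: "('g, 'k) cga \<Rightarrow> ('g, 'k) cga"
  proof -
    interpret derivation_char_0 u by unfold_locales fact
    have "H1_class g + k = h" using g by (metis diff_add_cancel)
    then show ?thesis
      using eq[OF u] der_act_H1_log_add[of "H1_class g" k] by simp
  qed
  have "H1_class g = 0"
  proof (rule H1_class_eq_0I[OF free])
    fix s and e :: "'g \<Rightarrow> int"
    assume s: "s \<in> S" and e: "\<And>g h. e (g + h) = e g + e h"
      "\<And>t. t \<in> S \<Longrightarrow> e t = (if t = s then 1 else 0)"
    define E :: "'g \<Rightarrow> 'k" where "E x = of_int (e x)" for x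
    interpret exponent E by unfold_locales (simp add: E_def e)
    define act :: "'g \<Rightarrow> ('g \<Rightarrow>\<^sub>0 'k) \<Rightarrow> ('g \<Rightarrow>\<^sub>0 'k)" where
      "act h x = Poly_Mapping.single h 1 * x * Poly_Mapping.single (- h) 1" for h x
    have single: "Poly_Mapping.single (g + h) (1 :: 'k) = Poly_Mapping.single g 1 * Poly_Mapping.single h 1"
      for g h :: 'g by (simp add: mult_single)
    \<comment> \<open>The logarithmic derivative \<open>s\<close> at \<open>s\<close> corresponds to
      a derivation sending \<open>s\<close> to its square. Its value at \<open>s\<close> has
      exponent one, and the other basis elements contribute nothing.\<close>
    obtain d where d: "\<And>h k. d (h + k) = d h + act h (d k)"
      "\<And>t. t \<in> S \<Longrightarrow> d t = (if t = s then Poly_Mapping.single s 1 else 0)"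
      by (rule free_crossed_hom[OF free(1), of act "\<lambda>t. if t = s then Poly_Mapping.single s 1 else 0"])
        (auto simp: act_def distrib_left distrib_right minus_add single mult.assoc
          simp del: add_uminus_conv_diff)
    interpret group_algebra_derivation d
      by unfold_locales (simp add: d(1) act_def)
    interpret derivation_char_0 D_hat
      by unfold_locales (rule D_hat_derivation)
    \<comment> \<open>Both sides are additive in the group element, the right one because
      \<open>\<phi>\<close> is invariant under conjugation, so it suffices to compare them on
      \<open>S\<close>.\<close>
    have "E g = \<phi> (d g)"
    proof (rule generates_hom_eq[OF free_generates[OF free(1)], of E "\<lambda>x. \<phi> (d x)"])
      show "\<phi> (d (x + y)) = \<phi> (d x) + \<phi> (d y)" for x y
        by (simp add: d(1) act_def pm_functional_add \<phi>_conj)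
      show "E t = \<phi> (d t)" if "t \<in> S" for t
        using that e(2)[OF that] by (cases "t = s") (simp_all add: E_def d(2))
    qed (rule e_add)
    let ?x = "cyc_class (cga_of (d g))"
    have dlog: "dlog g = ?x"
      by (simp add: dlog_def D_hat_group mult.assoc)
    have "cyc_tensor ?x (cyc_class 1) = cyc_tensor (cyc_class 1) ?x"
      using zero[OF D_hat_derivation] by (simp add: der_act_H1_log dlog)
    then have "Poly_Mapping.single (?x, cyc_class 1) 1 - Poly_Mapping.single (cyc_class 1, ?x) 1
        \<in> tensor_nbhd cyc_scale cyc_scale cyc_filt cyc_filt 2"
      unfolding cyc_tensor_def cyc2_c.lim_eq_iff[OF cyc2.filt_cauchy_const cyc2.filt_cauchy_const]
      by (auto simp: filt_null_def)
    \<comment> \<open>Evaluating with the exponent on the first leg and the augmentation on the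
      second breaks the symmetry of the two tensors: the second one vanishes since
      \<open>\<phi> 1 = 0\<close>.\<close>
    from tensor_functional_vanishes[OF \<phi>_trace augmentation_trace this]
    have "\<phi> (d g) * augmentation (1 :: 'g \<Rightarrow>\<^sub>0 'k) - \<phi> 1 * augmentation (d g) = 0"
      using trace_functional.\<tau>_hat_class[OF \<phi>_trace]
        trace_functional.\<tau>_hat_class[OF augmentation_trace[where 'g = 'g and 'k = 'k]]
      by (simp add: pm_functional_diff augmentation_eq_functional flip: cga_of_1)
    moreover have "\<phi> 1 = 0" "augmentation (1 :: 'g \<Rightarrow>\<^sub>0 'k) = 1"
      by (simp_all add: augmentation_single hom_zero[of E, OF e_add] flip: single_one)
    ultimately have "E g = 0" using \<open>E g = \<phi> (d g)\<close> by simp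
    \<comment> \<open>The integer exponent is recovered because the field has characteristic
      zero.\<close>
    then show "e g = 0" by (simp add: E_def)
  qed
  with g show ?thesis by simp
qed

section \<open>The cocycle\<close>

text \<open>The labels do not involve a ground field, so the derivations over one field of
  characteristic zero, here \<open>rat\<close>, are enough to separate them.\<close>

lemma nielsen_path_unique:
  assumes S: "free_generating_set S" "finite S"
    and "nielsen_path S T h" "nielsen_path S T k"
  shows "h = k"
proof (rule der_act_H1_log_injective[OF S])
  fix u :: "('a, rat) cga \<Rightarrow> ('a, rat) cga"
  assume "u \<in> cga_derivations"
  then interpret derivation_char_0 u by unfold_locales
  show "der_act u (twisted_coproduct (H1_log h)) = der_act u (twisted_coproduct (H1_log k))"
    using Div_nielsen_path(2)[OF assms(3) S(2)] Div_nielsen_path(2)[OF assms(4) S(2)] by simp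
qed

lemma nielsen_path_automorphism:
  assumes S: "free_generating_set S" "finite S" and F: "F \<in> group_aut"
  shows "\<exists>h. nielsen_path S (F ` S) h"
  using nielsen_equiv[OF group_aut_image_free[OF F S(1)] _ S] S(2) by (simp add: nielsen_equiv_def)

text \<open>The choice makes no reference to a ground field, so the same function serves over every
  field of characteristic zero.\<close>

definition nielsen_cocycle :: "'g::group_add set \<Rightarrow> ('g \<Rightarrow> 'g) \<Rightarrow> 'g H1" where
  "nielsen_cocycle S = (\<lambda>F\<in>group_aut. SOME h. nielsen_path S (F ` S) h)"

lemma nielsen_path_cocycle:
  assumes "free_generating_set S" "finite S" "F \<in> group_aut"
  shows "nielsen_path S (F ` S) (nielsen_cocycle S F)"
  using someI_ex[OF nielsen_path_automorphism[OF assms]] assms(3) by (simp add: nielsen_cocycle_def)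

lemma group_aut_comp: "F \<in> group_aut \<Longrightarrow> G \<in> group_aut \<Longrightarrow> F \<circ> G \<in> group_aut"
  by (simp add: group_aut_def bij_comp)

lemma additive_nielsen_cocycle:
  assumes S: "free_generating_set S" "finite S"
  shows "additive_cocycle (nielsen_cocycle S)"
  unfolding additive_cocycle_def
proof (intro conjI ballI)
  show "nielsen_cocycle S \<in> extensional group_aut"
    by (simp add: nielsen_cocycle_def)
  fix F G :: "'a \<Rightarrow> 'a" assume FG: "F \<in> group_aut" "G \<in> group_aut"
  have "nielsen_path S ((F \<circ> G) ` S) (nielsen_cocycle S F + H1_map F (nielsen_cocycle S G))"
    using nielsen_path.trans[OF nielsen_path_cocycle[OF S FG(1)]
        nielsen_path_image[OF FG(1) nielsen_path_cocycle[OF S FG(2)]]]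
    by (simp add: image_comp)
  then show "nielsen_cocycle S (F \<circ> G) = nielsen_cocycle S F + H1_map F (nielsen_cocycle S G)"
    by (rule nielsen_path_unique[OF S nielsen_path_cocycle[OF S group_aut_comp[OF FG]]])
qed

lemma divergence_nielsen_cocycle:
  assumes S: "free_generating_set S" "finite S"
  shows "divergence_cocycle TYPE('k::field_char_0) S (nielsen_cocycle S)"
  unfolding divergence_cocycle_def
proof (intro conjI ballI additive_nielsen_cocycle[OF S])
  fix F :: "'a \<Rightarrow> 'a" and u :: "('a, 'k) cga \<Rightarrow> ('a, 'k) cga"
  assume F: "F \<in> group_aut" and "u \<in> cga_derivations"
  then interpret derivation_char_0 u by unfold_locales
  show "Div (F ` S) u - Div S u = der_act u (twisted_coproduct (H1_log (nielsen_cocycle S F)))"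
    by (rule Div_nielsen_path(2)[OF nielsen_path_cocycle[OF S F] S(2)])
qed

lemma divergence_cocycle_unique:
  assumes S: "free_generating_set (S :: 'g::group_add set)" "finite S"
    and s: "divergence_cocycle TYPE('k::field_char_0) S s"
    and t: "divergence_cocycle TYPE('k) S t"
  shows "s = t"
proof (rule extensionalityI)
  show "s \<in> extensional group_aut" "t \<in> extensional group_aut"
    using s t by (simp_all add: divergence_cocycle_def additive_cocycle_def)
  fix F :: "'g \<Rightarrow> 'g" assume F: "F \<in> group_aut"
  show "s F = t F"
  proof (rule der_act_H1_log_injective[OF S])
    fix u :: "('g, 'k) cga \<Rightarrow> ('g, 'k) cga" assume u: "u \<in> cga_derivations"
    show "der_act u (twisted_coproduct (H1_log (s F))) = der_act u (twisted_coproduct (H1_log (t F)))"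
      using s t F u unfolding divergence_cocycle_def by metis
  qed
qed

lemma divergence_cocycle_change_of_basis:
  assumes S: "free_generating_set (S :: 'g::group_add set)" "finite S"
    and F: "F \<in> group_aut" and G: "G \<in> group_aut"
    and s: "divergence_cocycle TYPE('k::field_char_0) S s"
    and t: "divergence_cocycle TYPE('k) (G ` S) t"
  shows "t F = s F + H1_map F (s G) - s G"
proof (rule der_act_H1_log_injective[OF S])
  fix u :: "('g, 'k) cga \<Rightarrow> ('g, 'k) cga" assume u: "u \<in> cga_derivations"
  then interpret derivation_char_0 u by unfold_locales
  let ?W = "\<lambda>h. der_act u (twisted_coproduct (H1_log h))"
  have s': "Div (H ` S) u - Div S u = ?W (s H)" if "H \<in> group_aut" for H
    using s that u by (simp add: divergence_cocycle_def)
  have "?W (t F) = Div (F ` G ` S) u - Div (G ` S) u"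
    using t F u by (simp add: divergence_cocycle_def)
  \<comment> \<open>Both bases are compared with \<open>S\<close>, where the differences are known
    from \<open>s\<close>.\<close>
  also have "\<dots> = (Div ((F \<circ> G) ` S) u - Div S u) - (Div (G ` S) u - Div S u)"
    by (simp add: image_comp)
  also have "\<dots> = ?W (s (F \<circ> G)) - ?W (s G)"
    by (simp only: s' G group_aut_comp[OF F G])
  also have "s (F \<circ> G) = s F + H1_map F (s G)"
    using s F G by (simp add: divergence_cocycle_def additive_cocycle_def)
  also have "?W (s F + H1_map F (s G)) - ?W (s G) = ?W (s F + H1_map F (s G) - s G)"
    using der_act_H1_log_add[of "s F + H1_map F (s G) - s G" "s G"] by simp
  finally show "?W (t F) = ?W (s F + H1_map F (s G) - s G)" .
qed

theorem theorem4p34: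
  fixes n :: nat
  assumes "\<exists>S :: 'g::group_add set. free_generating_set S \<and> finite S \<and> card S = n"
  shows "\<forall>\<gamma> :: 'g set. free_generating_set \<gamma> \<longrightarrow>
    (\<exists>!\<s>. divergence_cocycle TYPE('k::field_char_0) \<gamma> \<s>) \<and>
    (\<forall>G\<in>group_aut. \<forall>\<s> \<s>'.
       divergence_cocycle TYPE('k) \<gamma> \<s> \<and> divergence_cocycle TYPE('k) (G ` \<gamma>) \<s>' \<longrightarrow>
       (\<forall>F\<in>group_aut. \<s>' F = \<s> F + H1_map F (\<s> G) - \<s> G))"
proof (intro allI impI conjI ballI)
  fix \<gamma> :: "'g set" assume free: "free_generating_set \<gamma>"
  \<comment> \<open>The rank hypothesis provides one finite basis; finiteness carries over to the
    given one.\<close>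
  then have fin: "finite \<gamma>" using assms free_finite by blast
  show "\<exists>!\<s>. divergence_cocycle TYPE('k) \<gamma> \<s>"
    using divergence_nielsen_cocycle[OF free fin] divergence_cocycle_unique[OF free fin] by blast
  fix F G :: "'g \<Rightarrow> 'g" and \<s> \<s>'
  assume "G \<in> group_aut" "F \<in> group_aut"
    and "divergence_cocycle TYPE('k) \<gamma> \<s> \<and> divergence_cocycle TYPE('k) (G ` \<gamma>) \<s>'"
  then show "\<s>' F = \<s> F + H1_map F (\<s> G) - \<s> G"
    using divergence_cocycle_change_of_basis[OF free fin] by blast
qed

end
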